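(* For every integer $\rho\ge 0$, the problem $\rho$-SupmodDD admits a polynomial-time $\left(1 + \ln\left(\max_{v\in V}f(v\,|\,V-v)\right)\right)$-approximation algorithm, where $f:2^V\rightarrow\mathbb{Z}_{\ge 0}$ is the input integer-valued normalized supermodular function (the factor being read as $1$ when $\max_{v\in V}f(v\,|\,V-v)=0$). Consequently, $\rho$-GraphDD for integer $\rho\ge 0$ and MatroidFVS admit polynomial-time $O(\log n)$-approximation algorithms, where $n$ is the number of vertices in the input graph.
   Context: A set function $f:2^V\to\mathbb{R}$ on a finite set $V$ is supermodular if $f(A)+f(B)\le f(A\cap B)+f(A\cup B)$ for all $A,B\subseteq V$, and normalized if $f(\emptyset)=0$. The marginal is $f(v\,|\,S):=f(S\cup\{v\})-f(S)$, and $V-v:=V\setminus\{v\}$. The density is $\lambda^*_f:=\max\{f(S)/|S|:\emptyset\neq S\subseteq V\}$ (for an empty ground set the condition $\lambda^*_f\le\rho$ is considered to hold), and $f|_{V-S}$ is the restriction of $f$ to subsets of $V\setminus S$. For a graph $G=(V,E)$, $\lambda^*_G$ is the density of the function $S\mapsto |E(S)|$, where $E(S)=E[S]$ is the set of edges with both end vertices in $S$. $\rho$-SupmodDD (for a fixed constant $\rho$): the input is an integer-valued normalized supermodular function $f:2^V\to\mathbb{Z}_{\ge0}$ given by an evaluation oracle, and element costs $c:V\to\mathbb{R}_{\ge 0}$; the goal is to find $S\subseteq V$ minimizing $\sum_{u\in S}c_u$ subject to $\lambda^*_{f|_{V-S}}\le\rho$. $\rho$-GraphDD (for a fixed constant $\rho$):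 the input is a graph $G=(V,E)$ and vertex costs $c:V\to\mathbb{R}_{\ge0}$; the goal is to find $S\subseteq V$ minimizing $\sum_{u\in S}c_u$ subject to $\lambda^*_{G-S}\le\rho$. MatroidFVS: the input is a graph $G=(V,E)$, vertex costs $c:V\to\mathbb{R}_{\ge 0}$, and a matroid $\mathcal{M}=(E,\mathcal{I})$ on the edge set with independent sets $\mathcal{I}$, given by an independence oracle; the goal is to find $S\subseteq V$ minimizing $\sum_{u\in S}c_u$ subject to $E[V-S]\in\mathcal{I}$. An $\alpha$-approximation algorithm returns a feasible solution of cost at most $\alpha$ times the optimum cost. *)

theory Defs
  imports Complex_Main
    "HOL-Library.Log_Nat"
    "HOL-Library.Landau_Symbols"
    "HOL-Computational_Algebra.Polynomial"
begin

section \<open>Set functions, density, graphs, matroids\<close>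

definition supermodular_on :: "'a set \<Rightarrow> ('a set \<Rightarrow> real) \<Rightarrow> bool" where
  "supermodular_on V f \<longleftrightarrow>
     (\<forall>A B. A \<subseteq> V \<longrightarrow> B \<subseteq> V \<longrightarrow> f A + f B \<le> f (A \<inter> B) + f (A \<union> B))"

definition normalized :: "('a set \<Rightarrow> real) \<Rightarrow> bool" where
  "normalized f \<longleftrightarrow> f {} = 0"

definition marginal :: "('a set \<Rightarrow> real) \<Rightarrow> 'a \<Rightarrow> 'a set \<Rightarrow> real" where
  "marginal f v S = f (S \<union> {v}) - f S"

text \<open>The restriction of a set function on \<open>V\<close> to the subsets of \<open>U \<subseteq> V\<close> is the same
  HOL function taken with the ground set \<open>U\<close>, so the ground set is always an explicit argument.\<close>

definition density :: "'a set \<Rightarrow> ('a set \<Rightarrow> real) \<Rightarrow> real" where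
  "density V f = Max {f S / real (card S) | S. S \<noteq> {} \<and> S \<subseteq> V}"

definition density_at_most :: "'a set \<Rightarrow> ('a set \<Rightarrow> real) \<Rightarrow> real \<Rightarrow> bool" where
  "density_at_most V f \<rho> \<longleftrightarrow> V = {} \<or> density V f \<le> \<rho>"

definition simple_graph :: "'a set \<Rightarrow> 'a set set \<Rightarrow> bool" where
  "simple_graph V E \<longleftrightarrow> finite V \<and> (\<forall>e\<in>E. e \<subseteq> V \<and> card e = 2)"

definition induced_edges :: "'a set set \<Rightarrow> 'a set \<Rightarrow> 'a set set" where
  "induced_edges E S = {e \<in> E. e \<subseteq> S}"

definition graph_density_at_most :: "'a set \<Rightarrow> 'a set set \<Rightarrow> real \<Rightarrow> bool" where
  "graph_density_at_most V E \<rho> \<longleftrightarrow>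
     density_at_most V (\<lambda>S. real (card (induced_edges E S))) \<rho>"

definition matroid :: "'e set \<Rightarrow> 'e set set \<Rightarrow> bool" where
  "matroid E \<I> \<longleftrightarrow> finite E \<and> (\<forall>X\<in>\<I>. X \<subseteq> E) \<and> {} \<in> \<I> \<and>
     (\<forall>X Y. Y \<in> \<I> \<longrightarrow> X \<subseteq> Y \<longrightarrow> X \<in> \<I>) \<and>
     (\<forall>X\<in>\<I>. \<forall>Y\<in>\<I>. card X < card Y \<longrightarrow> (\<exists>y\<in>Y - X. insert y X \<in> \<I>))"


section \<open>Model of computation\<close>

text \<open>
  A random access machine, presented as a structured while language whose variables are
  arrays of cells indexed by integers (a scalar is the cell 0 of an array).  There are two kinds of
  memory.  Integer cells are charged logarithmically: every value that is read or computed costs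
  its bit length.  Real cells hold exact real numbers; one unit is charged for reading, comparing,
  adding or subtracting them and for multiplying them by an integer (the integer being charged by its
  length).  There is no multiplication of two reals, no division of reals and no rounding, so every
  real that occurs is a combination of input reals and 1 with integer coefficients of bit length
  bounded by the running time.  In particular, on rational inputs polynomial time in this model is
  polynomial time for Turing machines.

  An evaluation query hands a whole integer array to the black box that belongs to the
  instance; it costs one unit plus the bit length of the answer.
\<close>

type_synonym vname = string
type_synonym black_box = "(int \<Rightarrow> int) \<Rightarrow> int"

record state =
  imem :: "vname \<Rightarrow> int \<Rightarrow> int"
  rmem :: "vname \<Rightarrow> int \<Rightarrow> real"

datatype iexp =
    IConst int
  | ICell vname iexp
  | IAdd iexp iexp
  | ISub iexp iexp
  | IMul iexp iexp
  | IDiv iexp iexp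

datatype rexp =
    RInt iexp
  | RCell vname iexp
  | RAdd rexp rexp
  | RSub rexp rexp
  | RScale iexp rexp

datatype bexp =
    ILe iexp iexp
  | RLe rexp rexp
  | Not bexp
  | And bexp bexp

datatype com =
    Skip
  | IAssign vname iexp iexp   \<comment> \<open>array, index, new contents\<close>
  | RAssign vname iexp rexp
  | Query vname iexp vname    \<comment> \<open>array, index, array holding the query\<close>
  | Seq com com
  | If bexp com com
  | While bexp com

definition bits :: "int \<Rightarrow> nat" where
  "bits z = 1 + floorlog 2 (nat \<bar>z\<bar>)"

primrec ival :: "iexp \<Rightarrow> state \<Rightarrow> int" where
  "ival (IConst k) s = k"
| "ival (ICell x e) s = imem s x (ival e s)"
| "ival (IAdd a b) s = ival a s + ival b s"
| "ival (ISub a b) s = ival a s - ival b s"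
| "ival (IMul a b) s = ival a s * ival b s"
| "ival (IDiv a b) s = ival a s div ival b s"

primrec icost :: "iexp \<Rightarrow> state \<Rightarrow> nat" where
  "icost (IConst k) s = bits k"
| "icost (ICell x e) s = icost e s + bits (ival (ICell x e) s)"
| "icost (IAdd a b) s = icost a s + icost b s + bits (ival (IAdd a b) s)"
| "icost (ISub a b) s = icost a s + icost b s + bits (ival (ISub a b) s)"
| "icost (IMul a b) s = icost a s + icost b s + bits (ival (IMul a b) s)"
| "icost (IDiv a b) s = icost a s + icost b s + bits (ival (IDiv a b) s)"

primrec rval :: "rexp \<Rightarrow> state \<Rightarrow> real" where
  "rval (RInt e) s = real_of_int (ival e s)"
| "rval (RCell x e) s = rmem s x (ival e s)"
| "rval (RAdd a b) s = rval a s + rval b s"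
| "rval (RSub a b) s = rval a s - rval b s"
| "rval (RScale e a) s = real_of_int (ival e s) * rval a s"

primrec rcost :: "rexp \<Rightarrow> state \<Rightarrow> nat" where
  "rcost (RInt e) s = icost e s + 1"
| "rcost (RCell x e) s = icost e s + 1"
| "rcost (RAdd a b) s = rcost a s + rcost b s + 1"
| "rcost (RSub a b) s = rcost a s + rcost b s + 1"
| "rcost (RScale e a) s = icost e s + rcost a s + 1"

primrec bval :: "bexp \<Rightarrow> state \<Rightarrow> bool" where
  "bval (ILe a b) s \<longleftrightarrow> ival a s \<le> ival b s"
| "bval (RLe a b) s \<longleftrightarrow> rval a s \<le> rval b s"
| "bval (Not b) s \<longleftrightarrow> \<not> bval b s"
| "bval (And a b) s \<longleftrightarrow> bval a s \<and> bval b s"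

primrec bcost :: "bexp \<Rightarrow> state \<Rightarrow> nat" where
  "bcost (ILe a b) s = icost a s + icost b s + 1"
| "bcost (RLe a b) s = rcost a s + rcost b s + 1"
| "bcost (Not b) s = bcost b s + 1"
| "bcost (And a b) s = bcost a s + bcost b s + 1"

definition istore :: "vname \<Rightarrow> int \<Rightarrow> int \<Rightarrow> state \<Rightarrow> state" where
  "istore x i z s = s\<lparr>imem := (imem s)(x := (imem s x)(i := z))\<rparr>"

definition rstore :: "vname \<Rightarrow> int \<Rightarrow> real \<Rightarrow> state \<Rightarrow> state" where
  "rstore x i r s = s\<lparr>rmem := (rmem s)(x := (rmem s x)(i := r))\<rparr>"

text \<open>\<open>exec q c s t s'\<close>: with black box \<open>q\<close>, the program \<open>c\<close> started in \<open>s\<close> halts in \<open>s'\<close>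
  after time \<open>t\<close>.\<close>

inductive exec :: "black_box \<Rightarrow> com \<Rightarrow> state \<Rightarrow> nat \<Rightarrow> state \<Rightarrow> bool" for q :: black_box where
  exec_Skip: "exec q Skip s 1 s"
| exec_IAssign:
    "exec q (IAssign x e a) s (1 + icost e s + icost a s) (istore x (ival e s) (ival a s) s)"
| exec_RAssign:
    "exec q (RAssign x e a) s (1 + icost e s + rcost a s) (rstore x (ival e s) (rval a s) s)"
| exec_Query:
    "exec q (Query x e y) s (1 + icost e s + bits (q (imem s y)))
       (istore x (ival e s) (q (imem s y)) s)"
| exec_Seq: "exec q c1 s t1 s1 \<Longrightarrow> exec q c2 s1 t2 s2 \<Longrightarrow> exec q (Seq c1 c2) s (1 + t1 + t2) s2"
| exec_IfTrue: "bval b s \<Longrightarrow> exec q c1 s t s' \<Longrightarrow> exec q (If b c1 c2) s (1 + bcost b s + t) s'"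
| exec_IfFalse: "\<not> bval b s \<Longrightarrow> exec q c2 s t s' \<Longrightarrow> exec q (If b c1 c2) s (1 + bcost b s + t) s'"
| exec_WhileFalse: "\<not> bval b s \<Longrightarrow> exec q (While b c) s (1 + bcost b s) s"
| exec_WhileTrue:
    "bval b s \<Longrightarrow> exec q c s t1 s1 \<Longrightarrow> exec q (While b c) s1 t2 s2 \<Longrightarrow>
     exec q (While b c) s (1 + bcost b s + t1 + t2) s2"

inductive_cases exec_SkipE: "exec q Skip s t s'"
inductive_cases exec_IAssignE: "exec q (IAssign x e a) s t s'"
inductive_cases exec_RAssignE: "exec q (RAssign x e a) s t s'"
inductive_cases exec_QueryE: "exec q (Query x e y) s t s'"
inductive_cases exec_SeqE: "exec q (Seq c1 c2) s t s'"
inductive_cases exec_IfE: "exec q (If b c1 c2) s t s'"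
inductive_cases exec_WhileE: "exec q (While b c) s t s'"

lemma exec_deterministic:
  "exec q c s t s' \<Longrightarrow> exec q c s u s'' \<Longrightarrow> u = t \<and> s'' = s'"
proof (induction arbitrary: u s'' rule: exec.induct)
  case (exec_Skip s)
  then show ?case by (rule exec_SkipE) simp
next
  case (exec_IAssign x e a s)
  then show ?case by (rule exec_IAssignE) simp
next
  case (exec_RAssign x e a s)
  then show ?case by (rule exec_RAssignE) simp
next
  case (exec_Query x e y s)
  then show ?case by (rule exec_QueryE) simp
next
  case (exec_Seq c1 s t1 s1 c2 t2 s2)
  from exec_Seq.prems show ?case
    by (rule exec_SeqE) (use exec_Seq.IH in \<open>metis plus_1_eq_Suc add.assoc\<close>)
next
  case (exec_IfTrue b s c1 t s' c2)
  from exec_IfTrue.prems show ?case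
    by (rule exec_IfE) (use exec_IfTrue.IH exec_IfTrue.hyps in \<open>metis plus_1_eq_Suc add.assoc\<close>)+
next
  case (exec_IfFalse b s c2 t s' c1)
  from exec_IfFalse.prems show ?case
    by (rule exec_IfE) (use exec_IfFalse.IH exec_IfFalse.hyps in \<open>metis plus_1_eq_Suc add.assoc\<close>)+
next
  case (exec_WhileFalse b s c)
  from exec_WhileFalse.prems show ?case
    by (rule exec_WhileE) (use exec_WhileFalse.hyps in \<open>metis plus_1_eq_Suc add.assoc\<close>)+
next
  case (exec_WhileTrue b s c t1 s1 t2 s2)
  from exec_WhileTrue.prems show ?case
    by (rule exec_WhileE) (use exec_WhileTrue.IH exec_WhileTrue.hyps in \<open>metis plus_1_eq_Suc add.assoc\<close>)+
qed


section \<open>Minimum cost deletion problems and approximation algorithms\<close>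

text \<open>The ground set of an instance with \<open>n\<close> elements is \<open>{..<n}\<close>.\<close>

record 'i problem =
  instances :: "'i set"
  num :: "'i \<Rightarrow> nat"
  elem_cost :: "'i \<Rightarrow> nat \<Rightarrow> real"
  feasible :: "'i \<Rightarrow> nat set \<Rightarrow> bool"
  int_input :: "'i \<Rightarrow> vname \<Rightarrow> int \<Rightarrow> int"
  box :: "'i \<Rightarrow> black_box"
  input_size :: "'i \<Rightarrow> nat"

definition cost :: "'i problem \<Rightarrow> 'i \<Rightarrow> nat set \<Rightarrow> real" where
  "cost P i S = (\<Sum>u\<in>S. elem_cost P i u)"

definition opt_cost :: "'i problem \<Rightarrow> 'i \<Rightarrow> real" where
  "opt_cost P i = Min (cost P i ` {S. S \<subseteq> {..<num P i} \<and> feasible P i S})"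

definition start_state :: "'i problem \<Rightarrow> 'i \<Rightarrow> state" where
  "start_state P i =
     \<lparr>imem = int_input P i,
      rmem = (\<lambda>_ _. 0)(''c'' := (\<lambda>z. if 0 \<le> z \<and> z < int (num P i) then elem_cost P i (nat z) else 0))\<rparr>"

definition decode_set :: "nat \<Rightarrow> (int \<Rightarrow> int) \<Rightarrow> nat set" where
  "decode_set n a = {v. v < n \<and> a (int v) \<noteq> 0}"

definition output_set :: "'i problem \<Rightarrow> 'i \<Rightarrow> state \<Rightarrow> nat set" where
  "output_set P i s = decode_set (num P i) (imem s ''out'')"

text \<open>One program serves all instances; its running time is polynomial in the input size.  The
  approximation factor may depend on the instance.\<close>

definition poly_time_approximable :: "'i problem \<Rightarrow> ('i \<Rightarrow> real) \<Rightarrow> bool" where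
  "poly_time_approximable P \<alpha> \<longleftrightarrow>
     (\<exists>(c :: com) (p :: nat poly). \<forall>i\<in>instances P. \<exists>t s.
        exec (box P i) c (start_state P i) t s \<and>
        t \<le> poly p (input_size P i) \<and>
        feasible P i (output_set P i s) \<and>
        cost P i (output_set P i s) \<le> \<alpha> i * opt_cost P i)"


section \<open>The three problems\<close>

record supmod_instance =
  s_num :: nat
  s_fun :: "nat set \<Rightarrow> nat"
  s_cost :: "nat \<Rightarrow> real"

abbreviation s_rfun :: "supmod_instance \<Rightarrow> nat set \<Rightarrow> real" where
  "s_rfun i \<equiv> (\<lambda>S. real (s_fun i S))"

text \<open>The input size is the number of elements plus the largest bit length of a function value.\<close>

definition SupmodDD :: "nat \<Rightarrow> supmod_instance problem" where
  "SupmodDD \<rho> =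
     \<lparr>instances = {i. supermodular_on {..<s_num i} (s_rfun i) \<and> normalized (s_rfun i) \<and>
                      (\<forall>v<s_num i. 0 \<le> s_cost i v)},
      num = s_num,
      elem_cost = s_cost,
      feasible = (\<lambda>i S. density_at_most ({..<s_num i} - S) (s_rfun i) (real \<rho>)),
      int_input = (\<lambda>i. (\<lambda>_ _. 0)(''n'' := (\<lambda>_. 0)(0 := int (s_num i)))),
      box = (\<lambda>i a. int (s_fun i (decode_set (s_num i) a))),
      input_size = (\<lambda>i. s_num i + floorlog 2 (Max (s_fun i ` Pow {..<s_num i})))\<rparr>"

text \<open>For the empty ground set the maximum is read as 0.\<close>

definition max_marginal :: "supmod_instance \<Rightarrow> real" where
  "max_marginal i =
     (if s_num i = 0 then 0
      else Max ((\<lambda>v. marginal (s_rfun i) v ({..<s_num i} - {v})) ` {..<s_num i}))"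

definition supmod_factor :: "supmod_instance \<Rightarrow> real" where
  "supmod_factor i = (if max_marginal i = 0 then 1 else 1 + ln (max_marginal i))"

text \<open>Graphs are given by their adjacency matrix, row by row; sets of edges in queries are given
  in the same format, where only the entries above the diagonal are looked at.\<close>

definition graph_input :: "nat \<Rightarrow> nat set set \<Rightarrow> vname \<Rightarrow> int \<Rightarrow> int" where
  "graph_input n E = (\<lambda>_ _. 0)
     (''n'' := (\<lambda>_. 0)(0 := int n),
      ''adj'' := (\<lambda>z. if \<exists>u<n. \<exists>v<n. z = int (u * n + v) \<and> {u, v} \<in> E then 1 else 0))"

definition decode_edges :: "nat \<Rightarrow> (int \<Rightarrow> int) \<Rightarrow> nat set set" where
  "decode_edges n a = {{u, v} | u v. u < v \<and> v < n \<and> a (int (u * n + v)) \<noteq> 0}"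

record graph_instance =
  g_num :: nat
  g_edges :: "nat set set"
  g_cost :: "nat \<Rightarrow> real"

definition GraphDD :: "nat \<Rightarrow> graph_instance problem" where
  "GraphDD \<rho> =
     \<lparr>instances = {i. simple_graph {..<g_num i} (g_edges i) \<and> (\<forall>v<g_num i. 0 \<le> g_cost i v)},
      num = g_num,
      elem_cost = g_cost,
      feasible = (\<lambda>i S. graph_density_at_most ({..<g_num i} - S)
                          (induced_edges (g_edges i) ({..<g_num i} - S)) (real \<rho>)),
      int_input = (\<lambda>i. graph_input (g_num i) (g_edges i)),
      box = (\<lambda>_ _. 0),
      input_size = g_num\<rparr>"

record matroid_instance = graph_instance +
  m_indep :: "nat set set set"

definition MatroidFVS :: "matroid_instance problem" where
  "MatroidFVS =
     \<lparr>instances = {i. simple_graph {..<g_num i} (g_edges i) \<and> (\<forall>v<g_num i. 0 \<le> g_cost i v) \<and>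
                      matroid (g_edges i) (m_indep i)},
      num = g_num,
      elem_cost = g_cost,
      feasible = (\<lambda>i S. induced_edges (g_edges i) ({..<g_num i} - S) \<in> m_indep i),
      int_input = (\<lambda>i. graph_input (g_num i) (g_edges i)),
      box = (\<lambda>i a. if decode_edges (g_num i) a \<in> m_indep i then 1 else 0),
      input_size = g_num\<rparr>"

end

theory Submission
  imports Defs
begin

text \<open>
  Let \<open>g U\<close> be the maximum of \<open>f T - \<rho> |T|\<close> over \<open>T \<subseteq> U\<close>.  It is monotone supermodular, and \<open>S\<close> is
  feasible iff \<open>g (V - S) = 0\<close>, so deletion is a submodular cover problem: Wolsey's greedy algorithm,
  which deletes the element of least cost per drop of \<open>g\<close>, loses at most the harmonic number of
  \<open>max f(v | V - v)\<close>.

  Evaluating \<open>g\<close> is the problem of maximising a supermodular function.  Since \<open>f U - \<rho> n \<le> g U \<le> f U\<close>,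
  it suffices to be greedy for \<open>f\<close> itself as long as \<open>f U > 11 \<rho> n\<close>; the loss at the change of phases is at
  most a tenth of the optimum, which is less than the gap between \<open>1 + ln k\<close> and the \<open>k\<close>-th harmonic
  number for \<open>k \<ge> 2\<close>.  In the second phase all numbers are \<open>O(\<rho> n)\<close>, and \<open>g\<close> is computed by projected
  subgradient ascent on the Lovasz extension over the integer grid \<open>{0..N}\<^sup>n\<close>.

  \<open>MatroidFVS\<close> is the case \<open>\<rho> = 0\<close> of the nullity of \<open>E[S]\<close>, which the program obtains by counting the
  edges that a greedy construction of a basis rejects.
\<close>

section \<open>Running programs within a budget\<close>

text \<open>The obstacle is that values of f may be exponential in the input size, while the ascent
  takes time polynomial in the values themselves. The constant 11 balances the two phases. In the
  first phase a solution is only known to bring f down to \<rho> n, so the remaining work is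
  measured as f U - \<rho> n, which exceeds 10 \<rho> n as long as f U > 11 \<rho> n. Dropping the
  subtraction at the change raises the measure by at most \<rho> n, a tenth of what the optimum can
  pay for at the current price. For k < 2 the logarithm leaves no slack, but none is spent: f V
  \<le> n k, so a first phase with \<rho> > 0 forces k > 11 \<rho>, and for \<rho> = 0 the jump is
  zero. In the second phase f \<le> 11 \<rho> n on the surviving elements, so each marginal of the
  excess is at most D = 12 \<rho> n in absolute value; the grid size N = 2 n D^2 + 1 = 288 \<rho>^2
  n^3 + 1 pushes the error of the ascent below one, and integrality does the rest. The machine
  cannot divide reals, so prices exist only in the analysis, and the program compares them by cross
  multiplication.\<close>

lemma bits_le_iff: "bits z \<le> Suc k \<longleftrightarrow> \<bar>z\<bar> < 2 ^ k"
proof -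
  have "bits z \<le> Suc k \<longleftrightarrow> nat \<bar>z\<bar> < 2 ^ k"
    by (simp add: bits_def floorlog_le_iff)
  also have "\<dots> \<longleftrightarrow> \<bar>z\<bar> < 2 ^ k"
    by (simp add: nat_less_iff)
  finally show ?thesis .
qed

lemma bits_pos: "1 \<le> bits z"
  by (simp add: bits_def)

lemma abs_less_bits: "\<bar>z\<bar> < 2 ^ (bits z - 1)"
  using bits_le_iff[of z "bits z - 1"] bits_pos[of z] by simp

lemma bits_mono: "\<bar>y\<bar> \<le> \<bar>z\<bar> \<Longrightarrow> bits y \<le> bits z"
  using abs_less_bits[of z] bits_le_iff[of y "bits z - 1"] bits_pos[of z] by simp

text \<open>The unit that \<open>bits\<close> adds to the logarithm pays for the carry: with
  exponents p and q the sum is below 2 * 2^(p+q), and p + q + 1 is one less than the two bit lengths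
  together.\<close>

lemma bits_abs_add: "bits (\<bar>a\<bar> + \<bar>b\<bar>) \<le> bits a + bits b"
proof -
  have "\<bar>a\<bar> + \<bar>b\<bar> < 2 ^ (bits a - 1) + 2 ^ (bits b - 1)"
    using abs_less_bits[of a] abs_less_bits[of b] by simp
  also have "\<dots> \<le> 2 ^ (bits a - 1 + (bits b - 1)) + 2 ^ (bits a - 1 + (bits b - 1))"
    by (intro add_mono power_increasing) auto
  also have "\<dots> = 2 ^ (bits a + bits b - 1)"
    using bits_pos[of a] bits_pos[of b]
    by (cases "bits a"; cases "bits b") auto
  finally show ?thesis
    using bits_le_iff[of "\<bar>a\<bar> + \<bar>b\<bar>" "bits a + bits b - 1"] bits_pos[of a] by simp
qed

lemma bits_add: "bits (a + b) \<le> bits a + bits b"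
  using bits_mono[of "a + b" "\<bar>a\<bar> + \<bar>b\<bar>"] bits_abs_add[of a b] by linarith

lemma bits_diff: "bits (a - b) \<le> bits a + bits b"
  using bits_mono[of "a - b" "\<bar>a\<bar> + \<bar>b\<bar>"] bits_abs_add[of a b] by linarith

lemma bits_mult: "bits (a * b) \<le> bits a + bits b"
proof -
  have "\<bar>a * b\<bar> < 2 ^ (bits a - 1) * 2 ^ (bits b - 1)"
    unfolding abs_mult by (intro mult_strict_mono abs_less_bits) auto
  also have "\<dots> = 2 ^ (bits a - 1 + (bits b - 1))"
    by (simp add: power_add)
  also have "\<dots> \<le> 2 ^ (bits a + bits b - 1)"
    by (intro power_increasing) auto
  finally show ?thesis
    using bits_le_iff[of "a * b" "bits a + bits b - 1"] bits_pos[of a] by simp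
qed

text \<open>Division rounds down, so a negative dividend over a positive divisor gives a quotient
  between the dividend and -1; a negative divisor is reduced to a positive one by negating both
  numbers.\<close>

lemma abs_div_le: "\<bar>a div b\<bar> \<le> \<bar>a\<bar>" for a b :: int
proof -
  have *: "\<bar>c div d\<bar> \<le> \<bar>c\<bar>" if "0 < d" for c d :: int
  proof (cases "0 \<le> c")
    case True
    then have "c div d \<le> c"
      using that by (smt (verit, del_insts) div_by_1 zdiv_mono2)
    then show ?thesis using True that by (simp add: pos_imp_zdiv_nonneg_iff)
  next
    case False
    then have "c \<le> c div d"
      using that by (smt (verit, del_insts) div_by_1 zdiv_mono2_neg)
    moreover have "c div d < 0"
      using False that by (simp add: div_neg_pos_less0)
    ultimately show ?thesis by simp
  qed
  consider "b = 0" | "0 < b" | "0 < - b" by linarith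
  then show ?thesis
  proof cases
    case 3
    then show ?thesis using *[of "- b" "- a"] by simp
  qed (use * in auto)
qed

lemma bits_div: "bits (a div b) \<le> bits a"
  by (intro bits_mono abs_div_le)

text \<open>Factors by which the bit length of a value and the cost of an expression exceed the largest
  bit length of a memory cell.\<close>

primrec iwidth :: "iexp \<Rightarrow> nat" where
  "iwidth (IConst k) = bits k"
| "iwidth (ICell x e) = 1"
| "iwidth (IAdd a b) = iwidth a + iwidth b"
| "iwidth (ISub a b) = iwidth a + iwidth b"
| "iwidth (IMul a b) = iwidth a + iwidth b"
| "iwidth (IDiv a b) = iwidth a"

primrec iweight :: "iexp \<Rightarrow> nat" where
  "iweight (IConst k) = bits k"
| "iweight (ICell x e) = iweight e + 1"
| "iweight (IAdd a b) = iweight a + iweight b + iwidth a + iwidth b"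
| "iweight (ISub a b) = iweight a + iweight b + iwidth a + iwidth b"
| "iweight (IMul a b) = iweight a + iweight b + iwidth a + iwidth b"
| "iweight (IDiv a b) = iweight a + iweight b + iwidth a"

primrec rweight :: "rexp \<Rightarrow> nat" where
  "rweight (RInt e) = iweight e + 1"
| "rweight (RCell x e) = iweight e + 1"
| "rweight (RAdd a b) = rweight a + rweight b + 1"
| "rweight (RSub a b) = rweight a + rweight b + 1"
| "rweight (RScale e a) = iweight e + rweight a + 1"

primrec bweight :: "bexp \<Rightarrow> nat" where
  "bweight (ILe a b) = iweight a + iweight b + 1"
| "bweight (RLe a b) = rweight a + rweight b + 1"
| "bweight (Not b) = bweight b + 1"
| "bweight (And a b) = bweight a + bweight b + 1"

text \<open>A bound for the running time, if every loop is left after at most \<open>m\<close> rounds and all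
  integer cells have bit length at most \<open>L\<close>.\<close>

primrec time_bound :: "nat \<Rightarrow> nat \<Rightarrow> com \<Rightarrow> nat" where
  "time_bound m L Skip = 1"
| "time_bound m L (IAssign x e a) = 1 + (iweight e + iweight a) * L"
| "time_bound m L (RAssign x e a) = 1 + (iweight e + rweight a) * L"
| "time_bound m L (Query x e y) = 1 + (iweight e + 1) * L"
| "time_bound m L (Seq c1 c2) = 1 + time_bound m L c1 + time_bound m L c2"
| "time_bound m L (If b c1 c2) = 1 + bweight b * L + time_bound m L c1 + time_bound m L c2"
| "time_bound m L (While b c) = (m + 1) * (1 + bweight b * L + time_bound m L c)"

primrec writes :: "com \<Rightarrow> vname set" where
  "writes Skip = {}"
| "writes (IAssign x e a) = {x}"
| "writes (RAssign x e a) = {x}"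
| "writes (Query x e y) = {x}"
| "writes (Seq c1 c2) = writes c1 \<union> writes c2"
| "writes (If b c1 c2) = writes c1 \<union> writes c2"
| "writes (While b c) = writes c"

definition frame :: "vname set \<Rightarrow> state \<Rightarrow> state \<Rightarrow> bool" where
  "frame W s s' \<longleftrightarrow> (\<forall>y. y \<notin> W \<longrightarrow> imem s' y = imem s y \<and> rmem s' y = rmem s y)"

lemma imem_istore: "imem (istore x i z s) y = (if y = x then (imem s x)(i := z) else imem s y)"
  by (simp add: istore_def)

lemma rmem_istore [simp]: "rmem (istore x i z s) = rmem s"
  by (simp add: istore_def)

lemma imem_rstore [simp]: "imem (rstore x i r s) = imem s"
  by (simp add: rstore_def)

lemma frame_trans: "frame W s s' \<Longrightarrow> frame W s' s'' \<Longrightarrow> frame W s s''"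
  by (simp add: frame_def)

lemma frame_mono: "frame W s s' \<Longrightarrow> W \<subseteq> W' \<Longrightarrow> frame W' s s'"
  by (auto simp: frame_def)

lemma frame_imem: "frame W s s' \<Longrightarrow> y \<notin> W \<Longrightarrow> imem s' y = imem s y"
  and frame_rmem: "frame W s s' \<Longrightarrow> y \<notin> W \<Longrightarrow> rmem s' y = rmem s y"
  by (auto simp: frame_def)

lemma exec_frame: "exec q c s t s' \<Longrightarrow> frame (writes c) s s'"
  by (induction rule: exec.induct) (auto simp: frame_def imem_istore rstore_def)

text \<open>\<open>m\<close> caps the rounds of each single loop and \<open>A\<close> the absolute
  value of each integer cell during the run. Real cells need no cap, since their cost does not
  depend on their size.\<close>

locale machine =
  fixes q :: black_box and m :: nat and A :: int
begin

abbreviation L :: nat where "L \<equiv> bits A"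

definition bounded :: "state \<Rightarrow> bool" where
  "bounded s \<longleftrightarrow> (\<forall>x j. \<bar>imem s x j\<bar> \<le> A)"

lemma bits_ival: "bounded s \<Longrightarrow> bits (ival e s) \<le> iwidth e * L"
proof (induction e)
  case (IConst k)
  show ?case using bits_pos[of A] by simp
next
  case (ICell x e)
  then have "\<bar>imem s x (ival e s)\<bar> \<le> \<bar>A\<bar>"
    by (meson abs_ge_self bounded_def order_trans)
  then show ?case by (simp add: bits_mono)
next
  case (IAdd a b)
  then show ?case using bits_add[of "ival a s" "ival b s"] by (simp add: algebra_simps)
next
  case (ISub a b)
  then show ?case using bits_diff[of "ival a s" "ival b s"] by (simp add: algebra_simps)
next
  case (IMul a b)
  then show ?case using bits_mult[of "ival a s" "ival b s"] by (simp add: algebra_simps)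
next
  case (IDiv a b)
  then show ?case using bits_div[of "ival a s" "ival b s"] by simp
qed

lemma icost_le: "bounded s \<Longrightarrow> icost e s \<le> iweight e * L"
proof (induction e)
  case (IConst k)
  show ?case using bits_pos[of A] by simp
next
  case (ICell x e)
  then show ?case using bits_ival[of s "ICell x e"] by simp
next
  case (IAdd a b)
  then show ?case using bits_ival[of s "IAdd a b"] by (simp add: algebra_simps)
next
  case (ISub a b)
  then show ?case using bits_ival[of s "ISub a b"] by (simp add: algebra_simps)
next
  case (IMul a b)
  then show ?case using bits_ival[of s "IMul a b"] by (simp add: algebra_simps)
next
  case (IDiv a b)
  then show ?case using bits_ival[of s "IDiv a b"] by (simp add: algebra_simps)
qed

lemma rcost_le: "bounded s \<Longrightarrow> rcost e s \<le> rweight e * L"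
proof (induction e)
  case (RInt e)
  then show ?case using icost_le[of s e] bits_pos[of A] by (simp add: algebra_simps)
next
  case (RCell x e)
  then show ?case using icost_le[of s e] bits_pos[of A] by (simp add: algebra_simps)
next
  case (RScale e a)
  then show ?case using icost_le[of s e] bits_pos[of A] by (simp add: algebra_simps)
qed (use bits_pos[of A] in \<open>simp_all add: algebra_simps\<close>)

lemma bcost_le: "bounded s \<Longrightarrow> bcost b s \<le> bweight b * L"
proof (induction b)
  case (ILe a b)
  then show ?case using icost_le[of s a] icost_le[of s b] bits_pos[of A] by (simp add: algebra_simps)
next
  case (RLe a b)
  then show ?case using rcost_le[of s a] rcost_le[of s b] bits_pos[of A] by (simp add: algebra_simps)
qed (use bits_pos[of A] in \<open>simp_all add: algebra_simps\<close>)

text \<open>Total correctness with the budget built in. Boundedness is both premise and conclusion,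
  so it travels through the program on its own; the time limit is read off the syntax, so it
  composes without looking at states.\<close>

definition wp :: "com \<Rightarrow> (state \<Rightarrow> bool) \<Rightarrow> state \<Rightarrow> bool" where
  "wp c Q s \<longleftrightarrow> (bounded s \<longrightarrow>
     (\<exists>t s'. exec q c s t s' \<and> t \<le> time_bound m L c \<and> bounded s' \<and> Q s'))"

lemma bounded_istore: "bounded s \<Longrightarrow> \<bar>z\<bar> \<le> A \<Longrightarrow> bounded (istore x i z s)"
  by (auto simp: bounded_def imem_istore)

lemma wp_Skip: "Q s \<Longrightarrow> wp Skip Q s"
  unfolding wp_def by (auto intro!: exI exec_Skip)

lemma wp_IAssign:
  assumes "bounded s \<Longrightarrow> \<bar>ival a s\<bar> \<le> A" "Q (istore x (ival e s) (ival a s) s)"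
  shows "wp (IAssign x e a) Q s"
  unfolding wp_def
proof (intro impI exI conjI)
  assume b: "bounded s"
  show "exec q (IAssign x e a) s (1 + icost e s + icost a s) (istore x (ival e s) (ival a s) s)"
    by (rule exec_IAssign)
  show "1 + icost e s + icost a s \<le> time_bound m L (IAssign x e a)"
    using icost_le[OF b, of e] icost_le[OF b, of a] by (simp add: algebra_simps)
  show "bounded (istore x (ival e s) (ival a s) s)"
    using b assms(1) by (simp add: bounded_istore)
qed (rule assms)

lemma wp_Query:
  assumes "\<bar>q (imem s y)\<bar> \<le> A" "Q (istore x (ival e s) (q (imem s y)) s)"
  shows "wp (Query x e y) Q s"
  unfolding wp_def
proof (intro impI exI conjI)
  assume b: "bounded s"
  show "exec q (Query x e y) s (1 + icost e s + bits (q (imem s y)))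
          (istore x (ival e s) (q (imem s y)) s)"
    by (rule exec_Query)
  have "bits (q (imem s y)) \<le> L"
    using assms(1) by (intro bits_mono) simp
  then show "1 + icost e s + bits (q (imem s y)) \<le> time_bound m L (Query x e y)"
    using icost_le[OF b, of e] by (simp add: algebra_simps)
  show "bounded (istore x (ival e s) (q (imem s y)) s)"
    using b assms(1) by (simp add: bounded_istore)
qed (rule assms)

lemma wp_Seq:
  assumes "wp c1 (wp c2 Q) s"
  shows "wp (Seq c1 c2) Q s"
  unfolding wp_def
proof
  assume b: "bounded s"
  from assms b obtain t1 s1 where 1: "exec q c1 s t1 s1" "t1 \<le> time_bound m L c1" "bounded s1"
    "wp c2 Q s1"
    unfolding wp_def[of c1] by blast
  then obtain t2 s2 where 2: "exec q c2 s1 t2 s2" "t2 \<le> time_bound m L c2" "bounded s2" "Q s2"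
    unfolding wp_def by blast
  from 1 2 show "\<exists>t s'. exec q (Seq c1 c2) s t s' \<and> t \<le> time_bound m L (Seq c1 c2) \<and> bounded s' \<and> Q s'"
    by (intro exI[of _ "1 + t1 + t2"] exI[of _ s2])
      (use exec_Seq[OF 1(1) 2(1)] in auto)
qed

lemma wp_If:
  assumes "bval b s \<Longrightarrow> wp c1 Q s" "\<not> bval b s \<Longrightarrow> wp c2 Q s"
  shows "wp (If b c1 c2) Q s"
  unfolding wp_def
proof
  assume bs: "bounded s"
  show "\<exists>t s'. exec q (If b c1 c2) s t s' \<and> t \<le> time_bound m L (If b c1 c2) \<and> bounded s' \<and> Q s'"
  proof (cases "bval b s")
    case True
    then obtain t s' where "exec q c1 s t s'" "t \<le> time_bound m L c1" "bounded s'" "Q s'"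
      using assms(1) bs unfolding wp_def by blast
    then show ?thesis using exec_IfTrue[OF True, of q c1 t s' c2] bcost_le[OF bs, of b]
      by (intro exI[of _ "1 + bcost b s + t"] exI[of _ s']) auto
  next
    case False
    then obtain t s' where "exec q c2 s t s'" "t \<le> time_bound m L c2" "bounded s'" "Q s'"
      using assms(2) bs unfolding wp_def by blast
    then show ?thesis using exec_IfFalse[OF False, of q c2 t s' c1] bcost_le[OF bs, of b]
      by (intro exI[of _ "1 + bcost b s + t"] exI[of _ s']) auto
  qed
qed

lemma wp_bounded: "(bounded s \<Longrightarrow> wp c Q s) \<Longrightarrow> wp c Q s"
  unfolding wp_def by blast

text \<open>The frame of the program comes for free here, so no postcondition has to list the arrays
  that stay unchanged.\<close>

lemma wp_conseq:
  assumes "wp c Q s" "\<And>s'. frame (writes c) s s' \<Longrightarrow> Q s' \<Longrightarrow> R s'"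
  shows "wp c R s"
  using assms exec_frame unfolding wp_def by blast

text \<open>The number of rounds \<open>k\<close> is fixed beforehand and \<open>I\<close> is
  indexed by the completed rounds, so no variant function is needed; the induction runs over the
  rounds still to come.\<close>

lemma wp_While:
  assumes "k \<le> m" "I 0 s"
    and "\<And>j s'. j < k \<Longrightarrow> I j s' \<Longrightarrow> bval b s' \<and> wp c (I (Suc j)) s'"
    and "\<And>s'. I k s' \<Longrightarrow> \<not> bval b s'"
  shows "wp (While b c) (I k) s"
proof -
  \<comment> \<open>The factor counts the remaining rounds and, as one more, the final failing
    test.\<close>
  have "\<exists>t s'. exec q (While b c) s t s' \<and>
          t \<le> (Suc (k - j)) * (1 + bweight b * L + time_bound m L c) \<and> bounded s' \<and> I k s'"
    if "j \<le> k" "I j s" "bounded s" for j s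
    using that
  proof (induction "k - j" arbitrary: j s)
    case 0
    then have "\<not> bval b s" using assms(4) by simp
    then show ?case using 0 bcost_le[of s b] exec_WhileFalse[of b s q c]
      by (intro exI[of _ "1 + bcost b s"] exI[of _ s]) auto
  next
    case (Suc d)
    then have "j < k" by simp
    then have b: "bval b s" and w: "wp c (I (Suc j)) s" using assms(3) Suc.prems by auto
    obtain t1 s1 where 1: "exec q c s t1 s1" "t1 \<le> time_bound m L c" "bounded s1" "I (Suc j) s1"
      using w Suc.prems(3) unfolding wp_def by blast
    have d: "d = k - Suc j" "Suc j \<le> k" using Suc.hyps(2) by auto
    obtain t2 s2 where 2: "exec q (While b c) s1 t2 s2"
      "t2 \<le> Suc (k - Suc j) * (1 + bweight b * L + time_bound m L c)" "bounded s2" "I k s2"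
      using Suc.hyps(1)[OF d 1(4,3)] by blast
    have e: "Suc (k - j) = Suc (Suc (k - Suc j))" using \<open>j < k\<close> by simp
    have "1 + bcost b s + t1 + t2 \<le> Suc (k - j) * (1 + bweight b * L + time_bound m L c)"
      unfolding e using 1(2) 2(2) bcost_le[OF Suc.prems(3), of b]
      by (simp add: algebra_simps)
    then show ?case using exec_WhileTrue[OF b 1(1) 2(1)] 2(3,4) by blast
  qed
  from this[of 0 s] assms(2) show ?thesis
    unfolding wp_def time_bound.simps
    using mult_le_mono1[of "Suc k" "m + 1" "1 + bweight b * L + time_bound m L c"] assms(1)
    by (fastforce intro: order_trans)
qed

end

section \<open>Counting loops\<close>

definition For :: "vname \<Rightarrow> iexp \<Rightarrow> com \<Rightarrow> com" where
  "For x e c = Seq (IAssign x (IConst 0) (IConst 0))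
     (While (Not (ILe e (ICell x (IConst 0))))
       (Seq c (IAssign x (IConst 0) (IAdd (ICell x (IConst 0)) (IConst 1)))))"

lemma writes_For [simp]: "writes (For x e c) = insert x (writes c)"
  by (auto simp: For_def)

text \<open>The guard evaluates \<open>e\<close> anew in every round, whence the hypothesis that
  \<open>e\<close> keeps its value wherever only the loop has written. The invariant is a predicate
  on the whole state, counter included, and is therefore asked for after the counter has
  moved.\<close>

lemma (in machine) wp_For:
  assumes k: "k \<le> m" "int k \<le> A" and x: "x \<notin> writes c"
    and e: "\<And>s'. frame (insert x (writes c)) s s' \<Longrightarrow> ival e s' = int k"
    and I0: "I 0 (istore x 0 0 s)"
    and step: "\<And>j s'. j < k \<Longrightarrow> bounded s' \<Longrightarrow> frame (insert x (writes c)) s s' \<Longrightarrow> imem s' x 0 = int j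
       \<Longrightarrow> I j s' \<Longrightarrow> wp c (\<lambda>s'. I (Suc j) (istore x 0 (int (Suc j)) s')) s'"
    and Q: "\<And>s'. bounded s' \<Longrightarrow> frame (insert x (writes c)) s s' \<Longrightarrow> I k s' \<Longrightarrow> Q s'"
  shows "wp (For x e c) Q s"
proof -
  let ?J = "\<lambda>j s'. bounded s' \<and> frame (insert x (writes c)) s s' \<and> imem s' x 0 = int j \<and> I j s'"
  have A: "0 \<le> A" using k by simp
  have "wp (While (Not (ILe e (ICell x (IConst 0))))
       (Seq c (IAssign x (IConst 0) (IAdd (ICell x (IConst 0)) (IConst 1))))) (?J k) s'"
    if "?J 0 s'" for s'
  proof (rule wp_While[OF k(1), where I = ?J])
    fix j s'
    assume j: "j < k" and J: "?J j s'"
    show "bval (Not (ILe e (ICell x (IConst 0)))) s' \<and>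
       wp (Seq c (IAssign x (IConst 0) (IAdd (ICell x (IConst 0)) (IConst 1)))) (?J (Suc j)) s'"
    proof
      show "bval (Not (ILe e (ICell x (IConst 0)))) s'" using J e j by simp
      have J': "bounded s'" "frame (insert x (writes c)) s s'" "imem s' x 0 = int j" "I j s'"
        using J by auto
      show "wp (Seq c (IAssign x (IConst 0) (IAdd (ICell x (IConst 0)) (IConst 1)))) (?J (Suc j)) s'"
      proof (rule wp_Seq, rule wp_conseq[OF step[OF j J']])
        fix t assume fr: "frame (writes c) s' t" and I: "I (Suc j) (istore x 0 (int (Suc j)) t)"
        have xt: "imem t x 0 = int j" using frame_imem[OF fr x] J' by simp
        show "wp (IAssign x (IConst 0) (IAdd (ICell x (IConst 0)) (IConst 1))) (?J (Suc j)) t"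
        proof (rule wp_bounded, rule wp_IAssign)
          assume b: "bounded t"
          show "\<bar>ival (IAdd (ICell x (IConst 0)) (IConst 1)) t\<bar> \<le> A" using xt j k by simp
          have "frame (insert x (writes c)) s (istore x 0 (1 + int j) t)"
            using J'(2) fr by (auto simp: frame_def imem_istore)
          then show "?J (Suc j) (istore x (ival (IConst 0) t) (ival (IAdd (ICell x (IConst 0)) (IConst 1)) t) t)"
            using I xt b k j by (auto simp: imem_istore add.commute intro!: bounded_istore)
        qed
      qed
    qed
  qed (use that e in auto)
  from wp_conseq[OF this] Q
  have W: "wp (While (Not (ILe e (ICell x (IConst 0))))
       (Seq c (IAssign x (IConst 0) (IAdd (ICell x (IConst 0)) (IConst 1))))) Q s'"
    if "?J 0 s'" for s'
    using that by blast
  show ?thesis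
    unfolding For_def
    by (rule wp_bounded, rule wp_Seq, rule wp_IAssign, use A in simp, rule W)
      (use I0 A in \<open>auto simp: imem_istore frame_def intro!: bounded_istore\<close>)
qed

section \<open>Polynomial time bounds from the program text\<close>

lemma poly_nat_mono: "x \<le> y \<Longrightarrow> poly p x \<le> poly p (y :: nat)"
  by (induction p) (auto intro!: add_mono mult_mono)

text \<open>A loop multiplies the cost of test and body by m + 1, so the degree grows with the
  nesting depth only. Since the polynomial comes from the program text, one polynomial serves all
  instances.\<close>

lemma time_bound_poly: "\<exists>p. \<forall>m L. time_bound m L c \<le> poly p (m + L)"
proof (induction c)
  case Skip
  show ?case by (rule exI[of _ "[:1:]"]) simp
next
  case (IAssign x e a)
  show ?case by (rule exI[of _ "[:1, iweight e + iweight a:]"]) (simp add: algebra_simps)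
next
  case (RAssign x e a)
  show ?case by (rule exI[of _ "[:1, iweight e + rweight a:]"]) (simp add: algebra_simps)
next
  case (Query x e y)
  show ?case by (rule exI[of _ "[:1, iweight e + 1:]"]) (simp add: algebra_simps)
next
  case (Seq c1 c2)
  then obtain p1 p2 where "\<forall>m L. time_bound m L c1 \<le> poly p1 (m + L)"
    "\<forall>m L. time_bound m L c2 \<le> poly p2 (m + L)" by blast
  then show ?case by (intro exI[of _ "1 + p1 + p2"]) (simp add: add_mono)
next
  case (If b c1 c2)
  then obtain p1 p2 where "\<forall>m L. time_bound m L c1 \<le> poly p1 (m + L)"
    "\<forall>m L. time_bound m L c2 \<le> poly p2 (m + L)" by blast
  then have "time_bound m L (If b c1 c2) \<le> poly ([:1, bweight b:] + p1 + p2) (m + L)" for m L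
    unfolding time_bound.simps poly_add by (intro add_mono) auto
  then show ?case by blast
next
  case (While b c)
  then obtain p where p: "\<forall>m L. time_bound m L c \<le> poly p (m + L)" by blast
  have "time_bound m L (While b c) \<le> poly ([:1, 1:] * ([:1, bweight b:] + p)) (m + L)" for m L
    unfolding time_bound.simps poly_mult poly_add
    by (intro mult_mono add_mono p[rule_format]) (auto simp: algebra_simps)
  then show ?case by blast
qed

section \<open>Supermodular functions\<close>

locale supermodular =
  fixes V :: "'a set" and h :: "'a set \<Rightarrow> int"
  assumes finite_V: "finite V"
    and super: "S \<subseteq> V \<Longrightarrow> T \<subseteq> V \<Longrightarrow> h S + h T \<le> h (S \<inter> T) + h (S \<union> T)"
begin

lemma marginal_mono:
  assumes "S \<subseteq> T" "insert u T \<subseteq> V" "u \<notin> T"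
  shows "h (insert u S) - h S \<le> h (insert u T) - h T"
proof -
  have "insert u S \<inter> T = S" "insert u S \<union> T = insert u T"
    using assms by auto
  moreover have "S \<subseteq> V" using assms by auto
  ultimately show ?thesis using super[of "insert u S" T] assms by simp
qed

end

locale monotone_supermodular = supermodular +
  assumes mono: "S \<subseteq> T \<Longrightarrow> T \<subseteq> V \<Longrightarrow> h S \<le> h T"
begin

text \<open>If u lies in S this is the growth of marginals; if not, the left side is zero and
  monotonicity makes the right side nonnegative.\<close>

lemma drop_mono:
  assumes "S \<subseteq> T" "T \<subseteq> V"
  shows "h S - h (S - {u}) \<le> h T - h (T - {u})"
proof (cases "u \<in> S")
  case True
  then show ?thesis
    using marginal_mono[of "S - {u}" "T - {u}" u] assms
    by (simp add: insert_absorb insert_Diff_if subset_iff)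
next
  case False
  then show ?thesis using mono[of "T - {u}" T] assms by simp
qed

lemma drop_le_sum:
  assumes "finite B" "S \<subseteq> V"
  shows "h S - h (S - B) \<le> (\<Sum>u\<in>B. h S - h (S - {u}))"
  using assms(1)
proof (induction B)
  case (insert u B)
  have "S - B - {u} = S - insert u B" by auto
  then have "h (S - B) - h (S - insert u B) \<le> h S - h (S - {u})"
    using drop_mono[of "S - B" S u] assms(2) by auto
  then show ?case using insert by simp
qed simp

end

section \<open>Harmonic numbers and the logarithm\<close>

definition harmonic :: "nat \<Rightarrow> real" where
  "harmonic n = (\<Sum>i = 1..n. 1 / real i)"

text \<open>Each of the b - a summands between the two harmonic numbers is at least 1 / b. In this
  form the lemma converts gain lost at a fixed price into a share of an element's cost.\<close>

lemma harmonic_diff_ge: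
  assumes "a \<le> b"
  shows "real (b - a) \<le> real b * (harmonic b - harmonic a)"
proof (cases "b = 0")
  case False
  have "{1..b} = {1..a} \<union> {a<..b}" "{1..a} \<inter> {a<..b} = {}" using assms by auto
  then have "harmonic b - harmonic a = (\<Sum>i\<in>{a<..b}. 1 / real i)"
    unfolding harmonic_def by (simp add: sum.union_disjoint)
  moreover have "(\<Sum>i\<in>{a<..b}. 1 / real b) \<le> (\<Sum>i\<in>{a<..b}. 1 / real i)"
    by (intro sum_mono) (auto intro!: divide_left_mono)
  ultimately have "real (b - a) / real b \<le> harmonic b - harmonic a" by simp
  then show ?thesis using False by (simp add: field_simps)
qed (use assms in simp)

lemma harmonic_mono: "a \<le> b \<Longrightarrow> harmonic a \<le> harmonic b"
  unfolding harmonic_def by (intro sum_mono2) auto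

lemma harmonic_0 [simp]: "harmonic 0 = 0"
  by (simp add: harmonic_def)

lemma harmonic_1: "harmonic 1 = 1"
  by (simp add: harmonic_def)

text \<open>The slack \<open>1 / 10\<close> absorbs the loss at the change of phases.\<close>

lemma harmonic_le_ln:
  assumes "2 \<le> k"
  shows "harmonic k + 1 / 10 \<le> 1 + ln (real k)"
  using assms
proof (induction k rule: dec_induct)
  case base
  have "harmonic 2 = 3 / 2" by (simp add: harmonic_def numeral_2_eq_2)
  \<comment> \<open>This is what 3/2 + 1/10 \<le> 1 + ln 2 requires. Applying ln x \<le> x - 1 at
    1/2 gives only 1/2; after two square roots, rounded up to 71/100 and 843/1000, it gives 4 *
    0.157 = 0.628.\<close>
  moreover have "3 / 5 \<le> ln (2 :: real)"
  proof -
    have "ln (1 / 2 :: real) = 2 * ln (sqrt (1 / 2))" by (simp add: ln_sqrt)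
    also have "\<dots> \<le> 2 * ln (71 / 100)"
    proof -
      have "sqrt (1 / 2) \<le> (71 / 100 :: real)" by (rule real_le_lsqrt) (auto simp: power2_eq_square)
      then show ?thesis by simp
    qed
    also have "ln (71 / 100 :: real) = 2 * ln (sqrt (71 / 100))" by (simp add: ln_sqrt)
    also have "ln (sqrt (71 / 100)) \<le> sqrt (71 / 100) - (1 :: real)" by (rule ln_le_minus_one) simp
    also have "sqrt (71 / 100) \<le> (843 / 1000 :: real)" by (rule real_le_lsqrt) (auto simp: power2_eq_square)
    finally show ?thesis by (simp add: ln_div)
  qed
  ultimately show ?case by simp
next
  case (step k)
  have "harmonic (Suc k) = harmonic k + 1 / real (Suc k)" by (simp add: harmonic_def)
  \<comment> \<open>The logarithm grows by at least 1 / (k + 1) here, so the slack of the base case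
    is never consumed.\<close>
  moreover have "ln (real k / real (Suc k)) \<le> real k / real (Suc k) - 1"
    using step by (intro ln_le_minus_one) simp
  then have "1 / real (Suc k) \<le> ln (real (Suc k)) - ln (real k)"
    using step by (simp add: ln_div field_simps)
  ultimately show ?case using step by simp
qed

section \<open>The two-phase greedy algorithm\<close>

locale deletion =
  fixes V :: "'a set" and f :: "'a set \<Rightarrow> nat" and \<rho> :: nat
  assumes finite: "finite V"
    and supermod: "S \<subseteq> V \<Longrightarrow> T \<subseteq> V \<Longrightarrow> f S + f T \<le> f (S \<inter> T) + f (S \<union> T)"
    and f_empty: "f {} = 0"
begin

definition excess :: "'a set \<Rightarrow> int" where
  "excess T = int (f T) - int \<rho> * int (card T)"

definition max_excess :: "'a set \<Rightarrow> int" where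
  "max_excess X = Max (excess ` Pow X)"

text \<open>While \<open>U\<close> is large, \<open>f U\<close> itself approximates the maximal excess well enough to guide the greedy
  choices; afterwards all values of \<open>f\<close> are \<open>O(\<rho> n)\<close>, so that a pseudo-polynomial maximisation of the
  excess is polynomial.\<close>

definition large :: "'a set \<Rightarrow> bool" where
  "large U \<longleftrightarrow> 11 * \<rho> * card V < f U"

text \<open>The phase is decided by U and not by X, so a gain compares two values of one function
  even if the deletion ends the first phase.\<close>

definition potential :: "'a set \<Rightarrow> 'a set \<Rightarrow> int" where
  "potential U X = (if large U then int (f X) else max_excess X)"

definition gain :: "'a set \<Rightarrow> 'a \<Rightarrow> int" where
  "gain U u = potential U U - potential U (U - {u})"

text \<open>The amount of potential that every solution is bound to remove from U. In the first
  phase \<rho> n is subtracted because the value of f left by a solution may be that large.\<close>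

definition remaining :: "'a set \<Rightarrow> int" where
  "remaining U = (if large U then int (f U) - int \<rho> * int (card V) else max_excess U)"

definition hits :: "'a set \<Rightarrow> bool" where
  "hits S \<longleftrightarrow> (\<forall>T\<subseteq>V - S. f T \<le> \<rho> * card T)"

text \<open>Nonnegative values suffice: S and T - S are disjoint, so f S + f (T - S) \<le> f
  T.\<close>

lemma f_mono: "S \<subseteq> T \<Longrightarrow> T \<subseteq> V \<Longrightarrow> f S \<le> f T"
proof -
  assume *: "S \<subseteq> T" "T \<subseteq> V"
  then have "S \<union> (T - S) = T" "S \<inter> (T - S) = {}" "S \<subseteq> V" "T - S \<subseteq> V" by auto
  then show "f S \<le> f T" using supermod[of S "T - S"] f_empty by simp
qed

lemma monotone_f: "monotone_supermodular V (\<lambda>X. int (f X))"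
proof
  show "int (f S) + int (f T) \<le> int (f (S \<inter> T)) + int (f (S \<union> T))" if "S \<subseteq> V" "T \<subseteq> V" for S T
    using supermod[OF that] by linarith
qed (use finite f_mono in auto)

lemma supermodular_excess: "supermodular V excess"
proof
  fix S T assume ST: "S \<subseteq> V" "T \<subseteq> V"
  then have "card S + card T = card (S \<union> T) + card (S \<inter> T)"
    using finite finite_subset by (metis card_Un_Int)
  then have "int \<rho> * int (card S) + int \<rho> * int (card T)
      = int \<rho> * int (card (S \<union> T)) + int \<rho> * int (card (S \<inter> T))"
    by (simp flip: distrib_left of_nat_add)
  then show "excess S + excess T \<le> excess (S \<inter> T) + excess (S \<union> T)"
    using supermod[OF ST] unfolding excess_def by linarith
qed (rule finite)

lemma excess_le_max: "T \<subseteq> X \<Longrightarrow> X \<subseteq> V \<Longrightarrow> excess T \<le> max_excess X"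
  unfolding max_excess_def using finite by (intro Max_ge) (auto intro: finite_subset)

lemma max_excess_attained:
  assumes "X \<subseteq> V"
  obtains T where "T \<subseteq> X" "max_excess X = excess T"
proof -
  have "max_excess X \<in> excess ` Pow X"
    unfolding max_excess_def using assms finite by (intro Max_in) (auto intro: finite_subset)
  then show ?thesis using that by auto
qed

lemma excess_empty [simp]: "excess {} = 0"
  by (simp add: excess_def f_empty)

lemma max_excess_nonneg: "X \<subseteq> V \<Longrightarrow> 0 \<le> max_excess X"
  using excess_le_max[of "{}" X] by simp

text \<open>Maximisers S' for S and T' for T yield the candidates S' \<inter> T' and S' \<union> T'
  for the intersection and the union, and supermodularity of the excess compares their
  values.\<close>

lemma monotone_max_excess: "monotone_supermodular V max_excess"
proof
  fix S T assume ST: "S \<subseteq> V" "T \<subseteq> V"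
  obtain S' T' where 1: "S' \<subseteq> S" "max_excess S = excess S'" "T' \<subseteq> T" "max_excess T = excess T'"
    using ST max_excess_attained by metis
  interpret e: supermodular V excess by (rule supermodular_excess)
  have "excess (S' \<inter> T') \<le> max_excess (S \<inter> T)" "excess (S' \<union> T') \<le> max_excess (S \<union> T)"
    using 1 ST by (auto intro!: excess_le_max)
  then show "max_excess S + max_excess T \<le> max_excess (S \<inter> T) + max_excess (S \<union> T)"
    using e.super[of S' T'] 1 ST by force
next
  fix S T assume *: "S \<subseteq> T" "T \<subseteq> V"
  then obtain S' where "S' \<subseteq> S" "max_excess S = excess S'"
    using max_excess_attained[of S] by blast
  then show "max_excess S \<le> max_excess T"
    using excess_le_max[of S' T] * by auto
qed (rule finite)

lemma monotone_potential: "monotone_supermodular V (potential U)"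
  using monotone_f monotone_max_excess by (cases "large U") (auto simp: potential_def[abs_def])

lemma max_excess_le: "X \<subseteq> V \<Longrightarrow> max_excess X \<le> int (f X)"
proof -
  assume X: "X \<subseteq> V"
  then obtain T where T: "T \<subseteq> X" "max_excess X = excess T" using max_excess_attained by blast
  have "excess T \<le> int (f T)" by (simp add: excess_def)
  then show ?thesis using f_mono[of T X] T X by simp
qed

text \<open>Remove u from a maximiser T of X: the result competes for X - {u}, the penalty can only
  shrink, and f drops on T by no more than on X. So the change of phases does not raise
  gains.\<close>

lemma max_excess_drop_le:
  assumes "X \<subseteq> V"
  shows "max_excess X - max_excess (X - {u}) \<le> int (f X) - int (f (X - {u}))"
proof -
  interpret f: monotone_supermodular V "\<lambda>X. int (f X)" by (rule monotone_f)
  obtain T where T: "T \<subseteq> X" "max_excess X = excess T" using assms max_excess_attained by blast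
  have fin: "finite T" using T assms finite by (meson finite_subset)
  have "excess (T - {u}) \<le> max_excess (X - {u})" using T assms by (intro excess_le_max) auto
  moreover have "int \<rho> * int (card (T - {u})) \<le> int \<rho> * int (card T)"
    using fin by (intro mult_left_mono) (auto intro: card_mono)
  then have "excess T - excess (T - {u}) \<le> int (f T) - int (f (T - {u}))"
    unfolding excess_def by linarith
  ultimately show ?thesis using f.drop_mono[of T X u] T assms by linarith
qed

lemma max_excess_hits: "hits S \<Longrightarrow> max_excess (V - S) = 0"
proof -
  assume S: "hits S"
  obtain T where T: "T \<subseteq> V - S" "max_excess (V - S) = excess T"
    using max_excess_attained[of "V - S"] by auto
  then have "excess T \<le> 0" using S
    unfolding hits_def excess_def by (metis of_nat_le_iff of_nat_mult diff_le_0_iff_le)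
  then show ?thesis using T max_excess_nonneg[of "V - S"] by simp
qed

lemma hits_if_max_excess: "max_excess (V - S) \<le> 0 \<Longrightarrow> hits S"
  unfolding hits_def
proof (intro allI impI)
  fix T assume *: "max_excess (V - S) \<le> 0" "T \<subseteq> V - S"
  then have "excess T \<le> 0" using excess_le_max[of T "V - S"] by auto
  then show "f T \<le> \<rho> * card T" unfolding excess_def
    by (metis of_nat_le_iff of_nat_mult diff_le_0_iff_le)
qed

lemma hits_all: "hits V"
  by (simp add: hits_def f_empty)

lemma f_le_of_hits:
  assumes "hits B" "X \<subseteq> V"
  shows "f (X - B) \<le> \<rho> * card V"
proof -
  have "X - B \<subseteq> V - B" using assms(2) by blast
  then have "f (X - B) \<le> \<rho> * card (X - B)" using assms(1) by (simp add: hits_def)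
  also have "\<dots> \<le> \<rho> * card V" using assms finite by (intro mult_left_mono card_mono) auto
  finally show ?thesis .
qed

lemma gain_nonneg: "U \<subseteq> V \<Longrightarrow> 0 \<le> gain U u"
proof -
  interpret p: monotone_supermodular V "potential U" by (rule monotone_potential)
  show "U \<subseteq> V \<Longrightarrow> 0 \<le> gain U u" using p.mono[of "U - {u}" U] by (auto simp: gain_def)
qed

lemma gain_notin: "u \<notin> U \<Longrightarrow> gain U u = 0"
  by (simp add: gain_def)

text \<open>Within a phase this is the growth of marginals. Across the change, the drop of the
  maximal excess is compared with the drop of f on the larger set.\<close>

lemma gain_antimono:
  assumes "U' \<subseteq> U" "U \<subseteq> V"
  shows "gain U' u \<le> gain U u"
proof -
  interpret f: monotone_supermodular V "\<lambda>X. int (f X)" by (rule monotone_f)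
  interpret g: monotone_supermodular V max_excess by (rule monotone_max_excess)
  have "large U" if "large U'" using that f_mono[OF assms] by (auto simp: large_def)
  then show ?thesis
    using f.drop_mono[OF assms, of u] g.drop_mono[OF assms, of u] max_excess_drop_le[OF assms(2), of u]
    by (auto simp: gain_def potential_def)
qed

lemma gain_le: "U \<subseteq> V \<Longrightarrow> gain U u \<le> int (f V) - int (f (V - {u}))"
proof -
  assume U: "U \<subseteq> V"
  interpret f: monotone_supermodular V "\<lambda>X. int (f X)" by (rule monotone_f)
  show ?thesis using f.drop_mono[OF U, of u] U max_excess_drop_le[OF U, of u]
    by (auto simp: gain_def potential_def split: if_splits)
qed

text \<open>After deletion of B from U the potential is at most \<rho> n in the first phase and 0 in
  the second, so the total drop is at least the remaining amount, and single drops bound the total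
  drop.\<close>

lemma remaining_le:
  assumes "hits B" "B \<subseteq> V" "U \<subseteq> V"
  shows "remaining U \<le> (\<Sum>u\<in>B. gain U u)"
proof -
  interpret p: monotone_supermodular V "potential U" by (rule monotone_potential)
  have "potential U U - potential U (U - B) \<le> (\<Sum>u\<in>B. gain U u)"
    unfolding gain_def using assms finite finite_subset by (intro p.drop_le_sum) auto
  moreover have "max_excess (U - B) \<le> max_excess (V - B)"
  proof -
    interpret g: monotone_supermodular V max_excess by (rule monotone_max_excess)
    show ?thesis using assms by (intro g.mono) auto
  qed
  then have "max_excess (U - B) \<le> 0" using max_excess_hits[OF assms(1)] by simp
  moreover have "int (f (U - B)) \<le> int \<rho> * int (card V)"
    using f_le_of_hits[OF assms(1,3)] by (metis of_nat_le_iff of_nat_mult)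
  ultimately show ?thesis by (auto simp: remaining_def potential_def split: if_splits)
qed

lemma remaining_large: "large U \<Longrightarrow> 10 * int \<rho> * int (card V) < remaining U"
proof -
  assume l: "large U"
  then have "int (11 * \<rho> * card V) < int (f U)" by (simp add: large_def del: of_nat_mult)
  then show ?thesis using l by (simp add: remaining_def algebra_simps)
qed

lemma remaining_nonneg: "U \<subseteq> V \<Longrightarrow> 0 \<le> remaining U"
  using remaining_large[of U] max_excess_nonneg[of U]
  by (cases "large U") (auto simp: remaining_def intro: order_trans[rotated])

text \<open>All of V is a solution, so without gains nothing can remain. This also rules out the
  first phase, in which the remaining amount is positive.\<close>

lemma hits_if_no_gain:
  assumes "S \<subseteq> V" "\<And>u. u \<in> V \<Longrightarrow> gain (V - S) u \<le> 0"
  shows "hits S"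
proof -
  have r: "remaining (V - S) \<le> 0"
    using remaining_le[OF hits_all, of "V - S"] assms(2) sum_nonpos[of V "gain (V - S)"] by force
  have "\<not> large (V - S)"
  proof
    assume "large (V - S)"
    from remaining_large[OF this] r have "10 * int \<rho> * int (card V) < 0" by linarith
    then show False by (simp add: mult_less_0_iff)
  qed
  then show ?thesis using r by (intro hits_if_max_excess) (simp add: remaining_def)
qed

text \<open>At the change of phases the new value is at most f (U - {v}) = f U - gain, whereas the
  old one is f U - \<rho> n; hence the surplus \<rho> n.\<close>

lemma remaining_step:
  assumes "U \<subseteq> V"
  shows "remaining (U - {v}) \<le> remaining U - gain U v
           + (if large U \<and> \<not> large (U - {v}) then int \<rho> * int (card V) else 0)"
proof -
  have "large U" if "large (U - {v})" using that f_mono[of "U - {v}" U] assms by (auto simp: large_def)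
  then show ?thesis using max_excess_le[of "U - {v}"] assms
    by (auto simp: remaining_def gain_def potential_def)
qed

text \<open>Deleting all of V shows f V \<le> n k. The lemma excludes an error term for k = 1, where
  the harmonic number equals the factor.\<close>

lemma two_le_if_large:
  assumes "large U" "U \<subseteq> V" "0 < \<rho>" "\<And>u. u \<in> V \<Longrightarrow> int (f V) - int (f (V - {u})) \<le> int k"
  shows "2 \<le> k"
proof -
  interpret f: monotone_supermodular V "\<lambda>X. int (f X)" by (rule monotone_f)
  have "int (f V) \<le> (\<Sum>u\<in>V. int (f V) - int (f (V - {u})))"
    using f.drop_le_sum[OF finite order_refl] by (simp add: f_empty)
  also have "\<dots> \<le> (\<Sum>u\<in>V. int k)" using assms(4) by (rule sum_mono)
  finally have "f V \<le> card V * k" by (simp flip: of_nat_mult)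
  moreover have "11 * \<rho> * card V < f V" using assms(1) f_mono[OF assms(2)] by (simp add: large_def)
  ultimately have "(11 * \<rho>) * card V < k * card V"
    by (metis mult.commute order_less_le_trans)
  then have "11 * \<rho> < k" by (simp only: mult_less_cancel2)
  then show ?thesis using assms(3) by simp
qed

text \<open>The greedy invariant: \<open>\<theta>\<close> is the last price paid per unit of gain.  The bound on the sum
  charges to every element \<open>u\<close> of a solution \<open>B\<close> the cost share of the gain it has already lost;
  \<open>e\<close> pays for the growth of the remaining potential when the phase changes.\<close>

definition greedy_inv :: "('a \<Rightarrow> real) \<Rightarrow> nat \<Rightarrow> 'a set \<Rightarrow> 'a set \<Rightarrow> bool" where
  "greedy_inv c k B S \<longleftrightarrow> (\<exists>(\<theta> :: real) (e :: real). 0 \<le> \<theta> \<and> (\<forall>u\<in>V. \<theta> * gain (V - S) u \<le> c u) \<and>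
     e \<le> sum c B / 10 \<and> (k < 2 \<longrightarrow> e = 0) \<and> (large (V - S) \<longrightarrow> e = 0) \<and>
     sum c S + \<theta> * remaining (V - S) \<le>
       (\<Sum>u\<in>B. c u * (harmonic k - harmonic (nat (gain (V - S) u))) + \<theta> * gain (V - S) u) + e)"

text \<open>At price 0 the left side vanishes, and the right side is nonnegative because no gain
  exceeds k.\<close>

lemma greedy_inv_start:
  assumes "\<And>u. u \<in> V \<Longrightarrow> 0 \<le> c u" "B \<subseteq> V"
    and "\<And>u. u \<in> V \<Longrightarrow> int (f V) - int (f (V - {u})) \<le> int k"
  shows "greedy_inv c k B {}"
  unfolding greedy_inv_def
proof (intro exI[of _ 0] conjI ballI impI)
  have "harmonic (nat (gain V u)) \<le> harmonic k" if "u \<in> V" for u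
    using gain_le[of V u] assms(3)[OF that] by (intro harmonic_mono) simp
  then show "sum c {} + 0 * real_of_int (remaining (V - {})) \<le>
      (\<Sum>u\<in>B. c u * (harmonic k - harmonic (nat (gain (V - {}) u))) + 0 * real_of_int (gain (V - {}) u)) + 0"
    using assms by (auto intro!: sum_nonneg mult_nonneg_nonneg)
  show "0 \<le> sum c B / 10" using assms by (simp add: subset_iff sum_nonneg)
qed (use assms in auto)

text \<open>Two moves. Raising the price with the gains fixed adds (\<theta>' - \<theta>) *
  remaining on the left, which the gains of B cover on the right. Deleting v at price \<theta>' then
  shifts its cost from the remaining potential to the sum of costs, while every gain that shrinks is
  paid by the harmonic share of its element.\<close>

lemma greedy_inv_step:
  assumes c: "\<And>u. u \<in> V \<Longrightarrow> 0 \<le> c u" and B: "B \<subseteq> V" "hits B"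
    and k: "\<And>u. u \<in> V \<Longrightarrow> int (f V) - int (f (V - {u})) \<le> int k"
    and S: "S \<subseteq> V" and inv: "greedy_inv c k B S"
    and v: "v \<in> V" "0 < gain (V - S) v"
    and best: "\<And>u. u \<in> V \<Longrightarrow> c v * gain (V - S) u \<le> c u * gain (V - S) v"
  shows "greedy_inv c k B (insert v S)"
proof -
  let ?U = "V - S"
  let ?U' = "V - insert v S"
  let ?a = "gain ?U" and ?a' = "gain ?U'"
  have U': "?U' = ?U - {v}" by auto
  obtain \<theta> e :: real where \<theta>: "0 \<le> \<theta>" "\<And>u. u \<in> V \<Longrightarrow> \<theta> * ?a u \<le> c u"
    and e: "e \<le> sum c B / 10" "k < 2 \<Longrightarrow> e = 0" "large ?U \<Longrightarrow> e = 0"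
    and le: "sum c S + \<theta> * remaining ?U \<le> (\<Sum>u\<in>B. c u * (harmonic k - harmonic (nat (?a u))) + \<theta> * ?a u) + e"
    using inv unfolding greedy_inv_def by blast
  \<comment> \<open>By the choice of v this is the least cost per unit of gain, so it is at least
    the old price, and \<theta>' times any gain is still within the cost of the element.\<close>
  define \<theta>' where "\<theta>' = c v / ?a v"
  have \<theta>'0: "0 \<le> \<theta>'" using c[OF v(1)] v(2) by (simp add: \<theta>'_def)
  have \<theta>\<theta>': "\<theta> \<le> \<theta>'" using \<theta>(2)[OF v(1)] v(2) by (simp add: \<theta>'_def field_simps)
  have \<theta>'a: "\<theta>' * ?a u \<le> c u" if "u \<in> V" for u
    using best[OF that] v(2) by (simp add: \<theta>'_def field_simps)
  have a': "0 \<le> ?a' u" "?a' u \<le> ?a u" for u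
    by (auto intro: gain_nonneg gain_antimono)
  have vS: "v \<notin> S" using v gain_notin[of v ?U] by auto
  have r: "remaining ?U \<le> (\<Sum>u\<in>B. ?a u)" using B by (intro remaining_le) auto
  have finB: "finite B" using B finite finite_subset by auto
  \<comment> \<open>The remaining potential, valued at the new price, costs no more than B; this is
    the budget for the error at the change of phases.\<close>
  have optB: "\<theta>' * remaining ?U \<le> sum c B"
  proof -
    have "\<theta>' * remaining ?U \<le> \<theta>' * real_of_int (\<Sum>u\<in>B. ?a u)"
      using r \<theta>'0 by (intro mult_left_mono) linarith+
    also have "\<dots> = (\<Sum>u\<in>B. \<theta>' * ?a u)" by (simp add: sum_distrib_left)
    also have "\<dots> \<le> sum c B" using B \<theta>'a by (intro sum_mono) auto
    finally show ?thesis .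
  qed
  define \<epsilon> where "\<epsilon> = (if large ?U \<and> \<not> large ?U' then int \<rho> * int (card V) else 0)"
  define e' where "e' = e + \<theta>' * \<epsilon>"
  \<comment> \<open>If the phase changes now, e was 0 so far, and the jump is at most a tenth of the
    remaining potential; then \<open>optB\<close> applies.\<close>
  have e'1: "e' \<le> sum c B / 10"
  proof (cases "large ?U \<and> \<not> large ?U'")
    case True
    then have "10 * \<epsilon> \<le> remaining ?U"
      using remaining_large[of ?U] by (simp add: \<epsilon>_def)
    then have "real_of_int (10 * \<epsilon>) \<le> remaining ?U" by (simp only: of_int_le_iff)
    then have "\<theta>' * (10 * \<epsilon>) \<le> \<theta>' * remaining ?U"
      using \<theta>'0 by (intro mult_left_mono) auto
    then show ?thesis using True e(3) optB by (simp add: e'_def)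
  qed (use e(1) in \<open>auto simp: e'_def \<epsilon>_def\<close>)
  have e'2: "e' = 0" if "k < 2"
  proof -
    have "\<rho> = 0" if "large ?U"
    proof (rule ccontr)
      assume "\<rho> \<noteq> 0"
      then have "2 \<le> k" using two_le_if_large[OF that _ _ k] by auto
      then show False using \<open>k < 2\<close> by simp
    qed
    then show ?thesis using e(2)[OF \<open>k < 2\<close>] by (auto simp: e'_def \<epsilon>_def)
  qed
  have e'3: "e' = 0" if "large ?U'"
  proof -
    have "f ?U' \<le> f ?U" by (intro f_mono) auto
    then have "large ?U" using that by (simp add: large_def)
    then show ?thesis using e(3) that by (auto simp: e'_def \<epsilon>_def)
  qed
  have cv: "c v = \<theta>' * ?a v" using v by (simp add: \<theta>'_def)
  have rr: "remaining ?U' \<le> remaining ?U - ?a v + \<epsilon>"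
    unfolding U' \<epsilon>_def by (rule remaining_step) auto
  \<comment> \<open>The gain lost by u is valued at \<theta>' per unit. As \<theta>' times the old
    gain is at most c u, the harmonic difference times c u covers the loss.\<close>
  have charge: "c u * (harmonic k - harmonic (nat (?a u))) + \<theta>' * ?a u
      \<le> c u * (harmonic k - harmonic (nat (?a' u))) + \<theta>' * ?a' u" if "u \<in> V" for u
  proof (cases "?a u = 0")
    case True
    then show ?thesis using a'[of u] by simp
  next
    case False
    let ?n = "nat (?a u)" and ?n' = "nat (?a' u)"
    have n: "0 < ?n" "?n' \<le> ?n" using False a'[of u] by auto
    have "\<theta>' * real (?n - ?n') \<le> \<theta>' * (real ?n * (harmonic ?n - harmonic ?n'))"
      using n \<theta>'0 by (intro mult_left_mono harmonic_diff_ge) auto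
    also have "\<dots> = (\<theta>' * ?a u) * (harmonic ?n - harmonic ?n')" using a'[of u] by simp
    also have "\<dots> \<le> c u * (harmonic ?n - harmonic ?n')"
      using \<theta>'a[OF that] harmonic_mono[OF n(2)] by (intro mult_right_mono) auto
    finally show ?thesis using n a'[of u] by (simp add: algebra_simps of_nat_diff)
  qed
  have "sum c (insert v S) + \<theta>' * remaining ?U' \<le> sum c S + \<theta>' * ?a v + \<theta>' * real_of_int (remaining ?U - ?a v + \<epsilon>)"
  proof -
    have "\<theta>' * remaining ?U' \<le> \<theta>' * real_of_int (remaining ?U - ?a v + \<epsilon>)"
      using rr \<theta>'0 by (intro mult_left_mono) linarith+
    moreover have "sum c (insert v S) = c v + sum c S"
      using vS S finite by (intro sum.insert) (auto intro: finite_subset)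
    ultimately show ?thesis using cv by linarith
  qed
  also have "\<dots> = (sum c S + \<theta> * remaining ?U) + (\<theta>' - \<theta>) * remaining ?U + \<theta>' * \<epsilon>"
    by (simp add: algebra_simps)
  also have "\<dots> \<le> ((\<Sum>u\<in>B. c u * (harmonic k - harmonic (nat (?a u))) + \<theta> * ?a u) + e)
      + (\<theta>' - \<theta>) * real_of_int (\<Sum>u\<in>B. ?a u) + \<theta>' * \<epsilon>"
  proof -
    have "(\<theta>' - \<theta>) * remaining ?U \<le> (\<theta>' - \<theta>) * real_of_int (\<Sum>u\<in>B. ?a u)"
      using r \<theta>\<theta>' by (intro mult_left_mono) linarith+
    then show ?thesis using le by linarith
  qed
  also have "\<dots> = (\<Sum>u\<in>B. c u * (harmonic k - harmonic (nat (?a u))) + \<theta>' * ?a u) + e'"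
    by (simp add: e'_def sum.distrib sum_distrib_left algebra_simps sum_subtractf)
  also have "\<dots> \<le> (\<Sum>u\<in>B. c u * (harmonic k - harmonic (nat (?a' u))) + \<theta>' * ?a' u) + e'"
    using B by (intro add_right_mono sum_mono charge) auto
  finally have final: "sum c (insert v S) + \<theta>' * remaining ?U' \<le>
      (\<Sum>u\<in>B. c u * (harmonic k - harmonic (nat (?a' u))) + \<theta>' * ?a' u) + e'" .
  have \<theta>'a': "\<theta>' * ?a' u \<le> c u" if "u \<in> V" for u
  proof -
    have "\<theta>' * ?a' u \<le> \<theta>' * ?a u" using a'[of u] \<theta>'0 by (intro mult_left_mono) auto
    then show ?thesis using \<theta>'a[OF that] by linarith
  qed
  show ?thesis unfolding greedy_inv_def
    by (intro exI[of _ \<theta>'] exI[of _ e'] conjI ballI impI)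
      (use \<theta>'0 \<theta>'a' e'1 e'2 e'3 final in auto)
qed

text \<open>If the gain of u is positive, its harmonic number is at least 1, so an unspent share of
  at least c u covers the price term; if it is zero, that term vanishes. Hence the total is at most
  \<open>harmonic k\<close> times the cost of B, plus the error.\<close>

lemma greedy_inv_cost:
  assumes c: "\<And>u. u \<in> V \<Longrightarrow> 0 \<le> c u" and B: "B \<subseteq> V" and "greedy_inv c k B S"
  shows "sum c S \<le> (if k = 0 then 1 else 1 + ln (real k)) * sum c B"
proof -
  let ?a = "gain (V - S)"
  obtain \<theta> e :: real where \<theta>: "0 \<le> \<theta>" "\<And>u. u \<in> V \<Longrightarrow> \<theta> * ?a u \<le> c u"
    and e: "e \<le> sum c B / 10" "k < 2 \<Longrightarrow> e = 0"
    and le: "sum c S + \<theta> * remaining (V - S) \<le>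
      (\<Sum>u\<in>B. c u * (harmonic k - harmonic (nat (?a u))) + \<theta> * ?a u) + e"
    using assms(3) unfolding greedy_inv_def by blast
  have "c u * (harmonic k - harmonic (nat (?a u))) + \<theta> * ?a u \<le> c u * harmonic k" if "u \<in> B" for u
  proof (cases "?a u \<le> 0")
    case True
    then have "?a u = 0" using gain_nonneg[of "V - S" u] by auto
    then show ?thesis by simp
  next
    case False
    then have "1 \<le> harmonic (nat (?a u))" using harmonic_mono[of 1 "nat (?a u)"] harmonic_1 by simp
    then have "c u * 1 \<le> c u * harmonic (nat (?a u))" using c that B by (intro mult_left_mono) auto
    then show ?thesis using \<theta>(2)[of u] that B by (auto simp: algebra_simps)
  qed
  from sum_mono[of B, OF this]
  have "(\<Sum>u\<in>B. c u * (harmonic k - harmonic (nat (?a u))) + \<theta> * ?a u) \<le> harmonic k * sum c B"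
    by (simp add: sum_distrib_left mult.commute)
  moreover have "0 \<le> \<theta> * remaining (V - S)" using \<theta>(1) remaining_nonneg[of "V - S"] by simp
  ultimately have *: "sum c S \<le> harmonic k * sum c B + e" using le by linarith
  have cB: "0 \<le> sum c B" using c B by (auto intro: sum_nonneg)
  consider "k = 0" | "k = 1" | "2 \<le> k" by linarith
  then show ?thesis
  proof cases
    case 3
    have "sum c S \<le> (harmonic k + 1 / 10) * sum c B" using * e(1) by (simp add: algebra_simps)
    also have "\<dots> \<le> (1 + ln (real k)) * sum c B"
      using harmonic_le_ln[OF 3] cB by (intro mult_right_mono) auto
    finally show ?thesis using 3 by simp
  qed (use * e(2) cB harmonic_1 in auto)
qed

end


section \<open>Maximising a supermodular function by projected subgradient ascent\<close>

text \<open>Elements are added to the chain by decreasing \<open>x\<close>, ties being broken by the index.\<close>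

definition rank_key :: "nat \<Rightarrow> (nat \<Rightarrow> int) \<Rightarrow> nat \<Rightarrow> int" where
  "rank_key n x v = int v - int n * x v"

definition before :: "nat \<Rightarrow> (nat \<Rightarrow> int) \<Rightarrow> nat \<Rightarrow> nat set" where
  "before n x v = {u. u < n \<and> rank_key n x u < rank_key n x v}"

text \<open>Edmonds' greedy vector for the order of decreasing x. For supermodular h the Lovasz
  extension is concave, and this vector is a supergradient of it at x.\<close>

definition subgradient :: "nat \<Rightarrow> (nat set \<Rightarrow> int) \<Rightarrow> (nat \<Rightarrow> int) \<Rightarrow> nat \<Rightarrow> int" where
  "subgradient n h x v = h (insert v (before n x v)) - h (before n x v)"

text \<open>Indices differ by less than n, so a single unit of x outweighs every difference of
  indices.\<close>

lemma rank_key_less_iff: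
  assumes "u < n" "v < n"
  shows "rank_key n x u < rank_key n x v \<longleftrightarrow> x v < x u \<or> x u = x v \<and> u < v"
proof -
  consider "x u = x v" | "x v + 1 \<le> x u" | "x u + 1 \<le> x v" by linarith
  then show ?thesis
  proof cases
    case 2
    then have "int n * (x v + 1) \<le> int n * x u" by (intro mult_left_mono) auto
    then show ?thesis using assms 2 by (simp add: rank_key_def algebra_simps)
  next
    case 3
    then have "int n * (x u + 1) \<le> int n * x v" by (intro mult_left_mono) auto
    then show ?thesis using assms 3 by (simp add: rank_key_def algebra_simps)
  qed (auto simp: rank_key_def)
qed

lemma rank_key_inj: "u < n \<Longrightarrow> v < n \<Longrightarrow> rank_key n x u = rank_key n x v \<Longrightarrow> u = v"
  using rank_key_less_iff[of u n v x] rank_key_less_iff[of v n u x] by auto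

lemma before_iff:
  "v < n \<Longrightarrow> before n x v = {u. u < n \<and> (x v < x u \<or> x u = x v \<and> u < v)}"
  by (auto simp: before_def rank_key_less_iff)

locale normalized_supermodular = supermodular "{..<n}" h for n :: nat and h +
  assumes h_empty: "h {} = 0"
begin

text \<open>The elements of S are inserted in the order of their keys. When v comes, the earlier
  ones all lie in \<open>before n x v\<close>, where the marginal of v is at least as large.\<close>

lemma le_sum_subgradient:
  assumes "S \<subseteq> {..<n}"
  shows "h S \<le> sum (subgradient n h x) S"
proof -
  have "finite S" using assms(1) finite_subset by auto
  then show ?thesis using assms
  proof (induction S rule: finite_ranking_induct[where f = "rank_key n x"])
    case (insert v S)
    show ?case
    proof (cases "v \<in> S")
      case False
      have "S \<subseteq> before n x v"
      proof
        fix u assume u: "u \<in> S"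
        then have "rank_key n x u \<noteq> rank_key n x v"
          using rank_key_inj[of u n v x] insert.prems False by auto
        then show "u \<in> before n x v"
          using insert.hyps(2)[OF u] insert.prems u by (auto simp: before_def)
      qed
      then have "h (insert v S) - h S \<le> subgradient n h x v"
        unfolding subgradient_def using insert.prems
        by (intro marginal_mono) (auto simp: before_def)
      then show ?thesis using insert False by simp
    qed (use insert in \<open>simp add: insert_absorb\<close>)
  qed (simp add: h_empty)
qed

text \<open>In a set closed under predecessors, \<open>before n x v\<close> is exactly the part
  inserted before v, so the marginals telescope.\<close>

lemma sum_subgradient_initial:
  assumes "S \<subseteq> {..<n}" "\<And>u v. v \<in> S \<Longrightarrow> u < n \<Longrightarrow> rank_key n x u < rank_key n x v \<Longrightarrow> u \<in> S"
  shows "sum (subgradient n h x) S = h S"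
proof -
  have "finite S" using assms(1) finite_subset by auto
  then show ?thesis using assms
  proof (induction S rule: finite_ranking_induct[where f = "rank_key n x"])
    case (insert v S)
    show ?case
    proof (cases "v \<in> S")
      case False
      have "before n x v \<subseteq> S"
        using insert.prems(2)[of v] by (auto simp: before_def)
      moreover have "S \<subseteq> before n x v"
      proof
        fix u assume u: "u \<in> S"
        then have "rank_key n x u \<noteq> rank_key n x v"
          using rank_key_inj[of u n v x] insert.prems False by auto
        then show "u \<in> before n x v"
          using insert.hyps(2)[OF u] insert.prems u by (auto simp: before_def)
      qed
      ultimately have S: "before n x v = S" by auto
      have "sum (subgradient n h x) S = h S"
      proof (rule insert.IH)
        fix u w assume *: "w \<in> S" "u < n" "rank_key n x u < rank_key n x w"
        then have "u \<in> insert v S" using insert.prems(2)[of w u] by auto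
        moreover have "u \<noteq> v" using * insert.hyps(2)[of w] by auto
        ultimately show "u \<in> S" by auto
      qed (use insert.prems in auto)
      then show ?thesis using insert.hyps False S by (simp add: subgradient_def)
    next
      case True
      then show ?thesis using insert by (simp add: insert_absorb)
    qed
  qed (simp add: h_empty)
qed

text \<open>The left side is the Lovasz extension at x, cut into N levels: x v counts the thresholds
  in {1..N} that it reaches, and each level set is an initial segment of the order, so its greedy
  sum is its value under h.\<close>

lemma sum_subgradient_mult_le:
  assumes x: "\<And>v. v < n \<Longrightarrow> 0 \<le> x v \<and> x v \<le> int N"
    and b: "\<And>\<theta>. h {v. v < n \<and> int \<theta> \<le> x v} \<le> b"
  shows "(\<Sum>v<n. subgradient n h x v * x v) \<le> int N * b"
proof -
  let ?w = "subgradient n h x"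
  have xv: "x v = (\<Sum>\<theta>\<in>{1..N}. if int \<theta> \<le> x v then 1 else 0)" if "v < n" for v
  proof -
    have "{\<theta>\<in>{1..N}. int \<theta> \<le> x v} = {1..nat (x v)}" using x[OF that] by auto
    then have "x v = int (card {\<theta>\<in>{1..N}. int \<theta> \<le> x v})" using x[OF that] by simp
    then show ?thesis by (simp add: sum.If_cases Int_def)
  qed
  have "(\<Sum>v<n. ?w v * x v) = (\<Sum>v<n. \<Sum>\<theta>\<in>{1..N}. if int \<theta> \<le> x v then ?w v else 0)"
    by (intro sum.cong refl, subst xv) (auto simp: sum_distrib_left if_distrib intro!: sum.cong)
  also have "\<dots> = (\<Sum>\<theta>\<in>{1..N}. \<Sum>v<n. if int \<theta> \<le> x v then ?w v else 0)"
    by (rule sum.swap)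
  also have "\<dots> = (\<Sum>\<theta>\<in>{1..N}. sum ?w {v. v < n \<and> int \<theta> \<le> x v})"
    by (intro sum.cong[OF refl] sum.mono_neutral_cong_right) auto
  also have "\<dots> = (\<Sum>\<theta>\<in>{1..N}. h {v. v < n \<and> int \<theta> \<le> x v})"
    by (intro sum.cong refl sum_subgradient_initial) (auto simp: rank_key_less_iff)
  also have "\<dots> \<le> (\<Sum>\<theta>\<in>{1..N}. b)" by (intro sum_mono b)
  finally show ?thesis by simp
qed

text \<open>Squared Euclidean distance from x to the corner that represents S, the unit cube being
  stretched by N to keep the ascent in the integers.\<close>

definition distance :: "nat \<Rightarrow> (nat \<Rightarrow> int) \<Rightarrow> nat set \<Rightarrow> int" where
  "distance N x S = (\<Sum>v<n. (x v - (if v \<in> S then int N else 0))\<^sup>2)"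

text \<open>One step of the ascent brings \<open>x\<close> closer to every set that beats the best value \<open>b\<close> by
  enough, since clipping to \<open>[0, N]\<close> does not increase distances.\<close>

lemma distance_step:
  assumes x: "\<And>v. v < n \<Longrightarrow> 0 \<le> x v \<and> x v \<le> int N"
    and b: "\<And>\<theta>. h {v. v < n \<and> int \<theta> \<le> x v} \<le> b"
    and D: "\<And>v. v < n \<Longrightarrow> \<bar>subgradient n h x v\<bar> \<le> D"
    and S: "S \<subseteq> {..<n}"
    and x': "\<And>v. v < n \<Longrightarrow> x' v = max 0 (min (int N) (x v + subgradient n h x v))"
  shows "2 * int N * h S + distance N x' S \<le> distance N x S + int n * D\<^sup>2 + 2 * int N * b"
proof -
  let ?w = "subgradient n h x" and ?y = "\<lambda>v. if v \<in> S then int N else 0"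
  have "(x' v - ?y v)\<^sup>2 \<le> (x v - ?y v)\<^sup>2 + 2 * (?w v * x v) - 2 * (?w v * ?y v) + D\<^sup>2" if "v < n" for v
  proof -
    have "\<bar>x' v - ?y v\<bar> \<le> \<bar>x v + ?w v - ?y v\<bar>" using x'[OF that] by auto
    then have "(x' v - ?y v)\<^sup>2 \<le> (x v + ?w v - ?y v)\<^sup>2" by (simp add: abs_le_square_iff)
    also have "\<dots> = (x v - ?y v)\<^sup>2 + 2 * (?w v * x v) - 2 * (?w v * ?y v) + (?w v)\<^sup>2"
      by (simp add: power2_eq_square algebra_simps)
    also have "(?w v)\<^sup>2 \<le> D\<^sup>2" using D[OF that] by (simp add: abs_le_square_iff[symmetric])
    finally show ?thesis by simp
  qed
  then have "distance N x' S \<le> (\<Sum>v<n. (x v - ?y v)\<^sup>2 + 2 * (?w v * x v) - 2 * (?w v * ?y v) + D\<^sup>2)"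
    unfolding distance_def by (intro sum_mono) auto
  also have "\<dots> = distance N x S + 2 * (\<Sum>v<n. ?w v * x v) - 2 * (\<Sum>v<n. ?w v * ?y v) + int n * D\<^sup>2"
    by (simp add: distance_def sum.distrib sum_subtractf sum_distrib_left)
  also have "(\<Sum>v<n. ?w v * x v) \<le> int N * b" by (rule sum_subgradient_mult_le[OF x b])
  also have "(\<Sum>v<n. ?w v * ?y v) = int N * sum ?w S"
  proof -
    have "(\<Sum>v<n. ?w v * ?y v) = (\<Sum>v\<in>S. ?w v * ?y v)"
      using S by (intro sum.mono_neutral_right) auto
    then show ?thesis by (simp add: sum_distrib_left mult.commute)
  qed
  finally have "distance N x' S + 2 * (int N * sum ?w S)
      \<le> distance N x S + 2 * (int N * b) + int n * D\<^sup>2" by simp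
  \<comment> \<open>The greedy vector dominates h on every set, so its inner product with the corner
    of S may be replaced by N h S.\<close>
  moreover have "int N * h S \<le> int N * sum ?w S"
    using le_sum_subgradient[OF S] by (intro mult_left_mono) auto
  ultimately show ?thesis by (simp add: algebra_simps)
qed

text \<open>With \<open>N > 2nD\<^sup>2\<close> and \<open>2nN\<close> steps the accumulated error is below one.\<close>

lemma ascent_optimal:
  assumes "2 * int t * int N * h S + distance N x S \<le> int n * (int N)\<^sup>2 + int t * int n * D\<^sup>2 + 2 * int t * int N * b"
    and N: "int N = 2 * int n * D\<^sup>2 + 1" and t: "t = 2 * n * N" and S: "S \<subseteq> {..<n}" and b: "0 \<le> b"
  shows "h S \<le> b"
proof (rule ccontr)
  assume "\<not> h S \<le> b"
  then have "b + 1 \<le> h S" by simp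
  have n: "0 < n"
  proof (rule ccontr)
    assume "\<not> 0 < n"
    then have "S = {}" using S by auto
    then show False using \<open>b + 1 \<le> h S\<close> h_empty b by simp
  qed
  have N0: "0 < int N" using N by (simp add: add_nonneg_pos)
  have "2 * int t * int N * (b + 1) \<le> 2 * int t * int N * h S"
    using \<open>b + 1 \<le> h S\<close> by (intro mult_left_mono) auto
  moreover have "0 \<le> distance N x S" by (simp add: distance_def sum_nonneg)
  ultimately have "2 * int t * int N \<le> int n * (int N)\<^sup>2 + int t * int n * D\<^sup>2"
    using assms(1) by (simp add: algebra_simps)
  \<comment> \<open>For t = 2 n N every term carries the factor n N; without it, 4 N \<le> N + 2 n
    D^2 remains, which is 4 N \<le> 2 N - 1 by the choice of N.\<close>
  then have "(int n * int N) * (4 * int N) \<le> (int n * int N) * (int N + 2 * int n * D\<^sup>2)"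
    by (simp add: t power2_eq_square algebra_simps)
  then have "4 * int N \<le> int N + 2 * int n * D\<^sup>2" using n N0 by (simp add: mult_le_cancel_left)
  then have "4 * int N \<le> int N + (int N - 1)" using N by simp
  then show False using N0 by simp
qed

end

section \<open>The program\<close>

abbreviation cell :: "vname \<Rightarrow> iexp" where "cell x \<equiv> ICell x (IConst 0)"
abbreviation entry :: "vname \<Rightarrow> vname \<Rightarrow> iexp" where "entry x i \<equiv> ICell x (cell i)"
abbreviation assign :: "vname \<Rightarrow> iexp \<Rightarrow> com" where "assign x a \<equiv> IAssign x (IConst 0) a"
abbreviation assign_entry :: "vname \<Rightarrow> vname \<Rightarrow> iexp \<Rightarrow> com" where
  "assign_entry x i a \<equiv> IAssign x (cell i) a"
abbreviation IEq :: "iexp \<Rightarrow> iexp \<Rightarrow> bexp" where "IEq a b \<equiv> And (ILe a b) (ILe b a)"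

text \<open>The array \<open>out\<close> holds the set of deleted elements; the program fragment \<open>ev\<close> writes the
  value of the set function at the set in \<open>p\<close> to \<open>val\<close>.\<close>

definition load_alive :: com where
  "load_alive = For ''j'' (cell ''n'')
     (If (IEq (entry ''out'' ''j'') (IConst 0))
        (assign_entry ''p'' ''j'' (IConst 1)) (assign_entry ''p'' ''j'' (IConst 0)))"

definition clear_array :: "vname \<Rightarrow> com" where
  "clear_array x = For ''j'' (cell ''n'') (assign_entry x ''j'' (IConst 0))"

text \<open>Scanning the levels N, N - 1, ..., 0 and the indices within each level yields the order
  of the chain without sorting. Deleted elements stay out of \<open>p\<close> and get weight 0.
  \<open>fo\<close> holds the previous value of f, \<open>h\<close> the excess of the chain so far,
  \<open>phi\<close> the best excess seen.\<close>

definition visit :: "nat \<Rightarrow> com \<Rightarrow> com" where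
  "visit \<rho> ev = If (IEq (entry ''x'' ''j'') (ISub (cell ''N'') (cell ''i'')))
     (If (IEq (entry ''out'' ''j'') (IConst 0))
       (Seq (assign_entry ''p'' ''j'' (IConst 1))
       (Seq ev
       (Seq (assign_entry ''w'' ''j'' (ISub (ISub (cell ''val'') (cell ''fo'')) (IConst (int \<rho>))))
       (Seq (assign ''fo'' (cell ''val''))
       (Seq (assign ''h'' (IAdd (cell ''h'') (entry ''w'' ''j'')))
         (If (ILe (cell ''phi'') (cell ''h'')) (assign ''phi'' (cell ''h'')) Skip))))))
       (assign_entry ''w'' ''j'' (IConst 0)))
     Skip"

definition ascent_chain :: "nat \<Rightarrow> com \<Rightarrow> com" where
  "ascent_chain \<rho> ev = Seq (clear_array ''p'') (Seq (assign ''fo'' (IConst 0)) (Seq (assign ''h'' (IConst 0))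
     (For ''i'' (IAdd (cell ''N'') (IConst 1)) (For ''j'' (cell ''n'') (visit \<rho> ev)))))"

definition move_point :: com where
  "move_point = For ''j'' (cell ''n'')
     (If (ILe (IAdd (entry ''x'' ''j'') (entry ''w'' ''j'')) (IConst 0)) (assign_entry ''x'' ''j'' (IConst 0))
     (If (ILe (cell ''N'') (IAdd (entry ''x'' ''j'') (entry ''w'' ''j'')))
        (assign_entry ''x'' ''j'' (cell ''N''))
        (assign_entry ''x'' ''j'' (IAdd (entry ''x'' ''j'') (entry ''w'' ''j'')))))"

definition ascent :: "nat \<Rightarrow> com \<Rightarrow> com" where
  "ascent \<rho> ev = Seq (assign ''phi'' (IConst 0)) (Seq (clear_array ''x'')
     (For ''t'' (cell ''T'') (Seq (ascent_chain \<rho> ev) move_point)))"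

text \<open>The phase is read off \<open>fu\<close>, the value before the tentative deletion, as
  \<open>potential U X\<close> demands; \<open>out\<close> may already describe the smaller set
  X.\<close>

definition evaluate_potential :: "nat \<Rightarrow> com \<Rightarrow> com" where
  "evaluate_potential \<rho> ev = If (ILe (cell ''fu'') (IMul (IConst (11 * int \<rho>)) (cell ''n''))) (ascent \<rho> ev)
     (Seq load_alive (Seq ev (assign ''phi'' (cell ''val''))))"

text \<open>The candidate is deleted tentatively and restored. Ratios of cost to gain are compared
  by cross multiplication with integer factors; while \<open>bg\<close> is 0 the comparison always
  succeeds for nonnegative costs, so the first element of positive gain is accepted.\<close>

definition probe :: "nat \<Rightarrow> com \<Rightarrow> com" where
  "probe \<rho> ev = If (IEq (entry ''out'' ''v'') (IConst 0))
     (Seq (assign_entry ''out'' ''v'' (IConst 1)) (Seq (evaluate_potential \<rho> ev) (Seq (assign_entry ''out'' ''v'' (IConst 0))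
       (If (And (ILe (IAdd (cell ''phi'') (IConst 1)) (cell ''cur''))
             (RLe (RScale (cell ''bg'') (RCell ''c'' (cell ''v'')))
                (RScale (ISub (cell ''cur'') (cell ''phi'')) (RCell ''c'' (cell ''best'')))))
         (Seq (assign ''best'' (cell ''v'')) (assign ''bg'' (ISub (cell ''cur'') (cell ''phi''))))
         Skip)))) Skip"

definition greedy_round :: "nat \<Rightarrow> com \<Rightarrow> com" where
  "greedy_round \<rho> ev = Seq load_alive (Seq ev (Seq (assign ''fu'' (cell ''val''))
     (Seq (evaluate_potential \<rho> ev) (Seq (assign ''cur'' (cell ''phi''))
     (Seq (assign ''best'' (IConst 0)) (Seq (assign ''bg'' (IConst 0))
     (Seq (For ''v'' (cell ''n'') (probe \<rho> ev))
       (If (ILe (IConst 1) (cell ''bg'')) (assign_entry ''out'' ''best'' (IConst 1)) Skip))))))))"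

definition greedy_deletion :: "nat \<Rightarrow> com \<Rightarrow> com" where
  "greedy_deletion \<rho> ev =
     Seq (assign ''N'' (IAdd (IMul (IConst (288 * (int \<rho>)\<^sup>2)) (IMul (cell ''n'') (IMul (cell ''n'') (cell ''n'')))) (IConst 1)))
     (Seq (assign ''T'' (IMul (IConst 2) (IMul (cell ''n'') (cell ''N''))))
       (For ''it'' (cell ''n'') (greedy_round \<rho> ev)))"

definition reserved :: "vname set" where
  "reserved = {''n'', ''adj'', ''c'', ''p'', ''out'', ''x'', ''w'', ''fo'', ''h'', ''phi'', ''N'', ''T'',
     ''i'', ''j'', ''t'', ''it'', ''v'', ''best'', ''bg'', ''fu'', ''cur''}"

definition grid :: "nat \<Rightarrow> nat \<Rightarrow> nat" where
  "grid \<rho> n = 288 * \<rho>\<^sup>2 * n ^ 3 + 1"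

definition steps :: "nat \<Rightarrow> nat \<Rightarrow> nat" where
  "steps \<rho> n = 2 * n * grid \<rho> n"

section \<open>Correctness of the ascent program\<close>

lemma decode_set_upd:
  "v < n \<Longrightarrow> decode_set n (a(int v := z)) = (if z = 0 then decode_set n a - {v} else insert v (decode_set n a))"
  by (auto simp: decode_set_def)

lemma decode_set_subset: "decode_set n a \<subseteq> {..<n}"
  by (auto simp: decode_set_def)

text \<open>\<open>ev\<close> stays abstract so that the same loops serve a value oracle and a
  computed set function. \<open>F\<close> may be exponential: it enters the bound \<open>A\<close>
  on the cells, but not the bound \<open>m\<close> on the rounds.\<close>

locale program = machine q m A + deletion "{..<n}" f \<rho>
  for q m A and n :: nat and f \<rho> +
  fixes ev :: com and adj :: "int \<Rightarrow> int" and F :: nat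
  assumes ev_writes: "writes ev \<inter> reserved = {}"
    and ev: "imem s ''n'' 0 = int n \<Longrightarrow> imem s ''adj'' = adj \<Longrightarrow>
       wp ev (\<lambda>s'. imem s' ''val'' 0 = int (f (decode_set n (imem s ''p'')))) s"
    and f_le: "T \<subseteq> {..<n} \<Longrightarrow> f T \<le> F"
    and A_ge: "2 + int F + int (grid \<rho> n) + int (steps \<rho> n) + int n + 12 * int \<rho> * int n \<le> A"
    and m_ge: "grid \<rho> n + 1 + steps \<rho> n + n \<le> m"
begin

lemma not_in_ev [simp]:
  "''n'' \<notin> writes ev" "''adj'' \<notin> writes ev" "''c'' \<notin> writes ev" "''p'' \<notin> writes ev"
  "''out'' \<notin> writes ev" "''x'' \<notin> writes ev" "''w'' \<notin> writes ev" "''fo'' \<notin> writes ev"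
  "''h'' \<notin> writes ev" "''phi'' \<notin> writes ev" "''N'' \<notin> writes ev" "''T'' \<notin> writes ev"
  "''i'' \<notin> writes ev" "''j'' \<notin> writes ev" "''t'' \<notin> writes ev" "''it'' \<notin> writes ev"
  "''v'' \<notin> writes ev" "''best'' \<notin> writes ev" "''bg'' \<notin> writes ev" "''fu'' \<notin> writes ev"
  "''cur'' \<notin> writes ev"
  using ev_writes by (auto simp: reserved_def)

abbreviation V :: "nat set" where "V \<equiv> {..<n}"
abbreviation N :: nat where "N \<equiv> grid \<rho> n"

definition alive :: "state \<Rightarrow> nat set" where
  "alive s = V - decode_set n (imem s ''out'')"

definition env :: "state \<Rightarrow> bool" where
  "env s \<longleftrightarrow> imem s ''n'' 0 = int n \<and> imem s ''adj'' = adj"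

lemma env_frame: "env s \<Longrightarrow> frame W s s' \<Longrightarrow> ''n'' \<notin> W \<Longrightarrow> ''adj'' \<notin> W \<Longrightarrow> env s'"
  by (simp add: env_def frame_def)

lemma alive_frame: "frame W s s' \<Longrightarrow> ''out'' \<notin> W \<Longrightarrow> alive s' = alive s"
  by (simp add: alive_def frame_def)

lemma A_bounds: "2 \<le> A" "int F \<le> A" "int N + 12 * int \<rho> * int n \<le> A" "int N + 1 \<le> A" "N + 1 \<le> m"
  "int (steps \<rho> n) \<le> A" "steps \<rho> n \<le> m" and n_le: "n \<le> m" "int n \<le> A"
proof -
  have "0 \<le> 12 * int \<rho> * int n" by simp
  then show "2 \<le> A" "int F \<le> A" "int N + 12 * int \<rho> * int n \<le> A" "int N + 1 \<le> A" "N + 1 \<le> m"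
    "int (steps \<rho> n) \<le> A" "steps \<rho> n \<le> m" "n \<le> m" "int n \<le> A"
    using A_ge m_ge by linarith+
qed

lemma wp_load_alive:
  assumes "env s"
  shows "wp load_alive (\<lambda>s'. decode_set n (imem s' ''p'') = alive s) s"
  unfolding load_alive_def
proof (rule wp_For[where k = n and I = "\<lambda>k s'. \<forall>j<k. imem s' ''p'' (int j) \<noteq> 0 \<longleftrightarrow> imem s ''out'' (int j) = 0"],
    goal_cases)
  case (6 j s')
  then have "imem s' ''out'' = imem s ''out''" by (simp add: frame_def)
  then show ?case using 6 A_bounds
    by (intro wp_If wp_IAssign) (auto simp: imem_istore less_Suc_eq)
qed (use assms n_le in \<open>auto simp: env_def frame_def imem_istore alive_def decode_set_def\<close>)

lemma wp_clear:
  assumes "env s" "x \<noteq> ''j''" "x \<noteq> ''n''"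
  shows "wp (clear_array x) (\<lambda>s'. \<forall>j<n. imem s' x (int j) = 0) s"
  unfolding clear_array_def
proof (rule wp_For[where k = n and I = "\<lambda>k s'. \<forall>j<k. imem s' x (int j) = 0"], goal_cases)
  case (6 j s')
  then show ?case using A_bounds assms
    by (intro wp_IAssign) (auto simp: imem_istore less_Suc_eq)
qed (use assms n_le in \<open>auto simp: env_def frame_def imem_istore\<close>)

text \<open>Deleted elements are made irrelevant instead of removed, so the ascent always works on
  the coordinates 0, ..., n - 1, and its maximum over subsets of V is the maximal excess within
  X.\<close>

definition restricted :: "nat set \<Rightarrow> nat set \<Rightarrow> int" where
  "restricted X T = excess (T \<inter> X)"

lemma normalized_restricted: "X \<subseteq> V \<Longrightarrow> normalized_supermodular n (restricted X)"
proof
  interpret e: supermodular V excess by (rule supermodular_excess)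
  fix S T assume "S \<subseteq> V" "T \<subseteq> V"
  then have "excess (S \<inter> X) + excess (T \<inter> X) \<le> excess ((S \<inter> X) \<inter> (T \<inter> X)) + excess ((S \<inter> X) \<union> (T \<inter> X))"
    by (intro e.super) auto
  moreover have "(S \<inter> X) \<inter> (T \<inter> X) = S \<inter> T \<inter> X" "(S \<inter> X) \<union> (T \<inter> X) = (S \<union> T) \<inter> X" by auto
  ultimately show "restricted X S + restricted X T \<le> restricted X (S \<inter> T) + restricted X (S \<union> T)"
    by (simp add: restricted_def)
qed (simp_all add: restricted_def)

lemma restricted_marginal:
  assumes "v \<in> X" "v \<notin> T" "finite T"
  shows "restricted X (insert v T) - restricted X T = int (f (insert v T \<inter> X)) - int (f (T \<inter> X)) - int \<rho>"
proof -
  have "insert v T \<inter> X = insert v (T \<inter> X)" using assms by auto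
  then show ?thesis using assms by (simp add: restricted_def excess_def algebra_simps)
qed

text \<open>Marginals of f along the chain lie between 0 and 11 \<rho> n, and the penalty \<rho> is
  at most \<rho> n because v < n; hence 12. A deleted element has marginal 0.\<close>

lemma abs_subgradient_le:
  assumes X: "X \<subseteq> V" "f X \<le> 11 * \<rho> * n" and v: "v < n"
  shows "\<bar>subgradient n (restricted X) x v\<bar> \<le> 12 * int \<rho> * int n"
proof (cases "v \<in> X")
  case True
  let ?P = "before n x v"
  have P: "v \<notin> ?P" "finite ?P" by (auto simp: before_def)
  have "f (?P \<inter> X) \<le> f (insert v ?P \<inter> X)" "f (insert v ?P \<inter> X) \<le> f X"
    using X by (auto intro!: f_mono)
  moreover have "int (f X) \<le> 11 * int \<rho> * int n" using X(2) by (metis of_nat_le_iff of_nat_mult of_nat_numeral)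
  moreover have "int \<rho> * 1 \<le> int \<rho> * int n" using v by (intro mult_left_mono) auto
  ultimately show ?thesis
    unfolding subgradient_def restricted_marginal[OF True P] by linarith
next
  case False
  then have "insert v (before n x v) \<inter> X = before n x v \<inter> X" by auto
  then show ?thesis by (simp add: subgradient_def restricted_def)
qed

text \<open>The set treated when the scan stands at level N - i and index k. For k = 0 it consists
  of the v with x v > N - i, so completed levels yield level sets of x.\<close>

definition visited :: "(nat \<Rightarrow> int) \<Rightarrow> nat \<Rightarrow> nat \<Rightarrow> nat set" where
  "visited x i k = {v. v < n \<and> (int N - int i < x v \<or> x v = int N - int i \<and> v < k)}"

lemma visited_next: "visited x i n = visited x (Suc i) 0"
  by (auto simp: visited_def)

lemma visited_Suc:
  assumes "k < n"
  shows "visited x i (Suc k) = (if x k = int N - int i then insert k (visited x i k) else visited x i k)"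
  using assms by (auto simp: visited_def less_Suc_eq)

text \<open>\<open>b\<close> is the value of \<open>phi\<close> before the pass. Attainment inside X
  keeps \<open>phi\<close> from exceeding the maximum; its dominance over completed levels is what a
  step of the ascent needs.\<close>

definition chain_inv :: "nat set \<Rightarrow> (nat \<Rightarrow> int) \<Rightarrow> int \<Rightarrow> nat \<Rightarrow> nat \<Rightarrow> state \<Rightarrow> bool" where
  "chain_inv X x b i k s \<longleftrightarrow> (let P = visited x i k in
     decode_set n (imem s ''p'') = P \<inter> X \<and>
     imem s ''fo'' 0 = int (f (P \<inter> X)) \<and>
     imem s ''h'' 0 = restricted X P \<and>
     (\<forall>v\<in>P. imem s ''w'' (int v) = subgradient n (restricted X) x v) \<and>
     b \<le> imem s ''phi'' 0 \<and> (\<exists>T\<subseteq>X. imem s ''phi'' 0 = excess T) \<and>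
     restricted X P \<le> imem s ''phi'' 0 \<and>
     (\<forall>i'\<le>i. restricted X (visited x i' 0) \<le> imem s ''phi'' 0))"

lemma abs_excess_le: "T \<subseteq> V \<Longrightarrow> \<bar>excess T\<bar> \<le> A"
proof -
  assume T: "T \<subseteq> V"
  then have "card T \<le> n" using card_mono[of V T] by simp
  then have "int \<rho> * int (card T) \<le> int \<rho> * int n" "0 \<le> int \<rho> * int (card T)" "int (f T) \<le> int F"
    using f_le[OF T] by (auto intro!: mult_left_mono)
  then show ?thesis unfolding excess_def using A_bounds A_ge by linarith
qed

lemma wp_visit:
  assumes X: "X \<subseteq> V" "f X \<le> 11 * \<rho> * n" and k: "k < n" and "env s" and X_def: "alive s = X"
    and x: "\<And>v. v < n \<Longrightarrow> imem s ''x'' (int v) = x v"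
    and s: "imem s ''N'' 0 = int N" "imem s ''i'' 0 = int i" "imem s ''j'' 0 = int k"
    and inv: "chain_inv X x b i k s"
  shows "wp (visit \<rho> ev) (chain_inv X x b i (Suc k)) s"
proof -
  let ?P = "visited x i k"
  have in_X: "imem s ''out'' (int k) = 0 \<longleftrightarrow> k \<in> X"
    using k X_def by (auto simp: alive_def decode_set_def)
  show ?thesis
  proof (cases "x k = int N - int i")
    case False
    then show ?thesis using inv k x s
      unfolding visit_def by (intro wp_If wp_Skip) (auto simp: chain_inv_def visited_Suc)
  next
    case xk: True
    \<comment> \<open>Visited so far are the higher levels and the smaller indices of the same
      level, which is the order of the chain; so the increment measured now is coordinate k of the
      greedy vector.\<close>
    have P: "before n x k = ?P" using k xk by (auto simp: before_iff visited_def)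
    have kP: "k \<notin> ?P" "finite ?P" using xk by (auto simp: visited_def)
    have Suc: "visited x i (Suc k) = insert k ?P" using k xk by (simp add: visited_Suc)
    have P': "insert k ?P \<inter> X \<subseteq> V" "?P \<inter> X \<subseteq> V" using X by auto
    let ?w = "subgradient n (restricted X) x k"
    have w: "?w = restricted X (insert k ?P) - restricted X ?P" by (simp add: subgradient_def P)
    have absw: "\<bar>?w\<bar> \<le> A"
      using abs_subgradient_le[OF X k, of x] A_bounds by linarith
    show ?thesis
    proof (cases "k \<in> X")
      case False
      then have I: "insert k ?P \<inter> X = ?P \<inter> X" by auto
      then have r: "restricted X (insert k ?P) = restricted X ?P" by (simp add: restricted_def)
      then have "?w = 0" by (simp add: w)
      then show ?thesis
        unfolding visit_def using inv xk x[OF k] k s False in_X kP A_bounds r I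
        by (intro wp_If wp_IAssign wp_Skip) (auto simp: chain_inv_def Suc imem_istore Let_def)
    next
      case True
      have I: "insert k (?P \<inter> X) = insert k ?P \<inter> X" using True by auto
      define s1 where "s1 = istore ''p'' (int k) 1 s"
      have env1: "env s1" using \<open>env s\<close> by (simp add: s1_def env_def imem_istore)
      have d1: "decode_set n (imem s1 ''p'') = insert k ?P \<inter> X"
        using inv k I by (simp add: s1_def imem_istore decode_set_upd chain_inv_def Let_def)
      have "wp (Seq (assign_entry ''w'' ''j'' (ISub (ISub (cell ''val'') (cell ''fo'')) (IConst (int \<rho>))))
       (Seq (assign ''fo'' (cell ''val''))
       (Seq (assign ''h'' (IAdd (cell ''h'') (entry ''w'' ''j'')))
         (If (ILe (cell ''phi'') (cell ''h'')) (assign ''phi'' (cell ''h'')) Skip))))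
         (chain_inv X x b i (Suc k)) s2"
        if fr: "frame (writes ev) s1 s2" and val: "imem s2 ''val'' 0 = int (f (insert k ?P \<inter> X))" for s2
      proof -
        have s2: "imem s2 ''p'' = imem s1 ''p''" "imem s2 ''w'' = imem s ''w''"
          "imem s2 ''fo'' = imem s ''fo''" "imem s2 ''h'' = imem s ''h''" "imem s2 ''j'' = imem s ''j''"
          "imem s2 ''phi'' = imem s ''phi''"
          using fr by (simp_all add: frame_def s1_def imem_istore)
        have wk: "int (f (insert k ?P \<inter> X)) - imem s ''fo'' 0 - int \<rho> = ?w"
          using restricted_marginal[OF True kP] inv by (simp add: w chain_inv_def Let_def)
        have hk: "imem s ''h'' 0 + ?w = restricted X (insert k ?P)"
          using inv by (simp add: w chain_inv_def Let_def)
        have b1: "\<bar>restricted X (insert k ?P)\<bar> \<le> A" unfolding restricted_def by (rule abs_excess_le[OF P'(1)])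
        have b2: "int (f (insert k ?P \<inter> X)) \<le> A" using f_le[OF P'(1)] A_bounds by linarith
        have T: "\<exists>T\<subseteq>X. restricted X (insert k ?P) = excess T"
          unfolding restricted_def by auto
        have inv': "\<forall>v\<in>?P. imem s ''w'' (int v) = subgradient n (restricted X) x v"
          "b \<le> imem s ''phi'' 0" "\<exists>T\<subseteq>X. imem s ''phi'' 0 = excess T"
          "\<forall>i'\<le>i. restricted X (visited x i' 0) \<le> imem s ''phi'' 0"
          using inv by (auto simp: chain_inv_def Let_def)
        show ?thesis
          by (intro wp_Seq wp_IAssign wp_If wp_Skip)
            (use val s2 s wk hk b1 b2 absw T inv' d1 kP in
              \<open>auto simp: imem_istore chain_inv_def Let_def Suc add.commute intro: order_trans\<close>)
      qed
      note tail = this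
      have "wp (Seq (assign_entry ''p'' ''j'' (IConst 1))
       (Seq ev
       (Seq (assign_entry ''w'' ''j'' (ISub (ISub (cell ''val'') (cell ''fo'')) (IConst (int \<rho>))))
       (Seq (assign ''fo'' (cell ''val''))
       (Seq (assign ''h'' (IAdd (cell ''h'') (entry ''w'' ''j'')))
         (If (ILe (cell ''phi'') (cell ''h'')) (assign ''phi'' (cell ''h'')) Skip))))))
         (chain_inv X x b i (Suc k)) s"
      proof (rule wp_Seq, rule wp_IAssign, goal_cases)
        case 2
        show ?case
          by (rule wp_Seq, rule wp_conseq[OF ev])
            (use env1 s d1 tail in \<open>simp_all add: env_def s1_def[symmetric]\<close>)
      qed (use A_bounds in simp)
      then show ?thesis
        unfolding visit_def using True in_X x[OF k] xk s k by (intro wp_If) auto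
    qed
  qed
qed


lemma chain_inv_istore:
  assumes "y \<noteq> ''p''" "y \<noteq> ''fo''" "y \<noteq> ''h''" "y \<noteq> ''w''" "y \<noteq> ''phi''"
  shows "chain_inv X x b i k (istore y a z s) = chain_inv X x b i k s"
proof -
  have "imem (istore y a z s) u = imem s u" if "u \<in> {''p'', ''fo'', ''h'', ''w'', ''phi''}" for u
    using assms that by (auto simp: imem_istore)
  then show ?thesis by (simp add: chain_inv_def)
qed

lemma chain_inv_next: "chain_inv X x b i n s \<Longrightarrow> chain_inv X x b (Suc i) 0 s"
  by (auto simp: chain_inv_def Let_def visited_next le_Suc_eq)

lemma writes_visit: "writes (visit \<rho> ev) = {''p'', ''w'', ''fo'', ''h'', ''phi''} \<union> writes ev"
  by (auto simp: visit_def)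

lemma writes_chain:
  "writes (ascent_chain \<rho> ev) = {''p'', ''w'', ''fo'', ''h'', ''phi'', ''i'', ''j''} \<union> writes ev"
  by (auto simp: ascent_chain_def clear_array_def writes_visit)

lemma wp_chain:
  assumes X: "X \<subseteq> V" "f X \<le> 11 * \<rho> * n" and env: "env s" and X_def: "alive s = X"
    and x: "\<And>v. v < n \<Longrightarrow> imem s ''x'' (int v) = x v" "\<And>v. v < n \<Longrightarrow> 0 \<le> x v \<and> x v \<le> int N"
    and N: "imem s ''N'' 0 = int N"
    and phi: "imem s ''phi'' 0 = b" "0 \<le> b" "\<exists>T\<subseteq>X. b = excess T"
  shows "wp (ascent_chain \<rho> ev) (chain_inv X x b (Suc N) 0) s"
proof -
  \<comment> \<open>No coordinate exceeds N, so the scan starts at the top level with nothing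
    visited; getting past level 0 takes N + 1 rounds, whence the \<open>Suc N\<close>.\<close>
  have start: "visited x 0 0 = {}" using x(2) by (force simp: visited_def)
  have loops: "wp (For ''i'' (IAdd (cell ''N'') (IConst 1)) (For ''j'' (cell ''n'') (visit \<rho> ev)))
      (chain_inv X x b (Suc N) 0) s1"
    if fr: "frame {''p'', ''fo'', ''h'', ''j''} s s1" and inv: "chain_inv X x b 0 0 s1" for s1
  proof (rule wp_For[where k = "Suc N" and I = "\<lambda>i. chain_inv X x b i 0"], goal_cases)
    case (4 s')
    then show ?case using N fr by (simp add: frame_def writes_visit)
  next
    case (6 i s2)
    have fr2: "frame ({''p'', ''fo'', ''h'', ''j'', ''w'', ''phi'', ''i''} \<union> writes ev) s s2"
      by (rule frame_trans[of _ s s1]; rule frame_mono, rule fr 6(3)) (auto simp: writes_visit)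
    show ?case
    proof (rule wp_For[where k = n and I = "chain_inv X x b i"], goal_cases)
      case (4 s')
      then show ?case using env fr2 by (simp add: frame_def writes_visit env_def)
    next
      case (6 k s3)
      have fr3: "frame ({''p'', ''fo'', ''h'', ''j'', ''w'', ''phi''} \<union> writes ev) s2 s3"
        by (rule frame_mono[OF 6(3)]) (auto simp: writes_visit)
      have fr3': "frame ({''p'', ''fo'', ''h'', ''j'', ''w'', ''phi'', ''i''} \<union> writes ev) s s3"
        by (rule frame_trans[OF fr2]) (rule frame_mono[OF fr3], auto)
      have i3: "imem s3 ''i'' 0 = int i" using frame_imem[OF fr3, of "''i''"] \<open>imem s2 ''i'' 0 = int i\<close> by simp
      have "wp (visit \<rho> ev) (chain_inv X x b i (Suc k)) s3"
      proof (rule wp_visit)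
        show "env s3" by (rule env_frame[OF env fr3']) auto
        show "alive s3 = X" using alive_frame[OF fr3'] X_def by simp
      qed (use 6 X x N i3 frame_imem[OF fr3'] in auto)
      then show ?case by (rule wp_conseq) (simp add: chain_inv_istore)
    qed (use n_le 6 in \<open>auto simp: writes_visit chain_inv_istore dest: chain_inv_next\<close>)
  qed (use A_bounds inv in \<open>auto simp: writes_visit chain_inv_istore\<close>)
  show ?thesis
    unfolding ascent_chain_def
  proof (rule wp_Seq, rule wp_conseq[OF wp_clear[OF env]])
    fix s' assume fr: "frame (writes (clear_array ''p'')) s s'" and c: "\<forall>j<n. imem s' ''p'' (int j) = 0"
    have p: "decode_set n (imem s' ''p'') = {}" using c by (auto simp: decode_set_def)
    let ?s = "istore ''h'' 0 0 (istore ''fo'' 0 0 s')"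
    have phi': "imem s' ''phi'' 0 = b" using phi frame_imem[OF fr, of "''phi''"] by (simp add: clear_array_def)
    have "frame {''p'', ''fo'', ''h'', ''j''} s ?s"
      using fr by (auto simp: frame_def imem_istore clear_array_def)
    moreover have "chain_inv X x b 0 0 ?s"
      unfolding chain_inv_def start Let_def
      using phi phi' p f_empty start by (simp add: imem_istore restricted_def)
    ultimately show "wp (Seq (assign ''fo'' (IConst 0)) (Seq (assign ''h'' (IConst 0))
      (For ''i'' (IAdd (cell ''N'') (IConst 1)) (For ''j'' (cell ''n'') (visit \<rho> ev)))))
      (chain_inv X x b (Suc N) 0) s'"
      using A_bounds loops[of ?s] by (intro wp_Seq wp_IAssign) auto
  qed auto
qed

lemma wp_move:
  assumes env: "env s" and N: "imem s ''N'' 0 = int N"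
  shows "wp move_point (\<lambda>s'. \<forall>v<n. imem s' ''x'' (int v) =
    max 0 (min (int N) (imem s ''x'' (int v) + imem s ''w'' (int v)))) s"
  unfolding move_point_def
proof (rule wp_For[where k = n and I = "\<lambda>k s'. (\<forall>v<k. imem s' ''x'' (int v) =
    max 0 (min (int N) (imem s ''x'' (int v) + imem s ''w'' (int v)))) \<and>
    (\<forall>v\<ge>k. imem s' ''x'' (int v) = imem s ''x'' (int v))"], goal_cases)
  case (6 j s')
  then have "imem s' ''w'' = imem s ''w''" "imem s' ''N'' = imem s ''N''" by (simp_all add: frame_def)
  then show ?case using 6 A_bounds N
    by (intro wp_If wp_IAssign) (auto simp: imem_istore less_Suc_eq max_def min_def)
qed (use assms n_le in \<open>auto simp: env_def frame_def imem_istore\<close>)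

text \<open>The inequality of a single step summed over t steps. The start is the origin, whose
  distance to any corner is at most n N^2.\<close>

definition ascent_inv :: "nat set \<Rightarrow> nat \<Rightarrow> state \<Rightarrow> bool" where
  "ascent_inv X t s \<longleftrightarrow> (let x = \<lambda>v. imem s ''x'' (int v); b = imem s ''phi'' 0 in
     (\<forall>v<n. 0 \<le> x v \<and> x v \<le> int N) \<and> 0 \<le> b \<and> (\<exists>T\<subseteq>X. b = excess T) \<and>
     (\<forall>S\<subseteq>V. 2 * int t * int N * restricted X S + normalized_supermodular.distance n N x S
        \<le> int n * (int N)\<^sup>2 + int t * int n * (12 * int \<rho> * int n)\<^sup>2 + 2 * int t * int N * b))"

lemma ascent_inv_istore:
  assumes "y \<noteq> ''x''" "y \<noteq> ''phi''"
  shows "ascent_inv X t (istore y a z s) = ascent_inv X t s"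
proof -
  have "imem (istore y a z s) ''x'' = imem s ''x''" "imem (istore y a z s) ''phi'' = imem s ''phi''"
    using assms by (auto simp: imem_istore)
  then show ?thesis by (simp only: ascent_inv_def)
qed

lemma grid_eq: "int N = 2 * int n * (12 * int \<rho> * int n)\<^sup>2 + 1"
  by (simp add: grid_def power2_eq_square power3_eq_cube)

lemma ascent_inv_start:
  assumes "X \<subseteq> V" "\<And>v. v < n \<Longrightarrow> imem s ''x'' (int v) = 0" "imem s ''phi'' 0 = 0"
  shows "ascent_inv X 0 s"
proof -
  interpret r: normalized_supermodular n "restricted X" by (rule normalized_restricted[OF assms(1)])
  have "r.distance N (\<lambda>v. imem s ''x'' (int v)) S \<le> (\<Sum>v<n. (int N)\<^sup>2)" for S
    unfolding r.distance_def by (intro sum_mono) (auto simp: assms(2))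
  moreover have "\<exists>T\<subseteq>X. 0 = excess T" by (rule exI[of _ "{}"]) simp
  ultimately show ?thesis using assms unfolding ascent_inv_def Let_def by auto
qed

text \<open>The accumulated inequality shows that no subset of X beats \<open>phi\<close>; its
  attainment by a subset of X gives the converse.\<close>

lemma ascent_inv_end:
  assumes "X \<subseteq> V" "ascent_inv X (steps \<rho> n) s"
  shows "imem s ''phi'' 0 = max_excess X"
proof -
  interpret r: normalized_supermodular n "restricted X" by (rule normalized_restricted[OF assms(1)])
  obtain T where T: "T \<subseteq> X" "imem s ''phi'' 0 = excess T" using assms(2) by (auto simp: ascent_inv_def Let_def)
  obtain S where S: "S \<subseteq> X" "max_excess X = excess S" using max_excess_attained[OF assms(1)] by blast
  have "restricted X S \<le> imem s ''phi'' 0"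
    by (rule r.ascent_optimal[OF _ grid_eq refl, where x = "\<lambda>v. imem s ''x'' (int v)"])
      (use assms S in \<open>auto simp: ascent_inv_def Let_def steps_def\<close>)
  moreover have "restricted X S = max_excess X" using S by (simp add: restricted_def Int_absorb2)
  ultimately show ?thesis using excess_le_max[OF T(1) assms(1)] T(2) by simp
qed

lemma ascent_inv_Suc:
  assumes X: "X \<subseteq> V" "f X \<le> 11 * \<rho> * n" and t: "ascent_inv X t s"
    and inv: "chain_inv X (\<lambda>v. imem s ''x'' (int v)) (imem s ''phi'' 0) (Suc N) 0 s1"
    and s2: "\<And>v. v < n \<Longrightarrow> imem s2 ''x'' (int v) =
       max 0 (min (int N) (imem s ''x'' (int v) + imem s1 ''w'' (int v)))"
      "imem s2 ''phi'' 0 = imem s1 ''phi'' 0"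
  shows "ascent_inv X (Suc t) s2"
proof -
  interpret r: normalized_supermodular n "restricted X" by (rule normalized_restricted[OF X(1)])
  let ?x = "\<lambda>v. imem s ''x'' (int v)" and ?x' = "\<lambda>v. imem s2 ''x'' (int v)"
  let ?b = "imem s ''phi'' 0" and ?b' = "imem s1 ''phi'' 0" and ?D = "12 * int \<rho> * int n"
  have x: "0 \<le> ?x v \<and> ?x v \<le> int N" if "v < n" for v
    using t that by (auto simp: ascent_inv_def Let_def)
  have all: "visited ?x (Suc N) 0 = V" using x by (force simp: visited_def)
  have b: "?b \<le> ?b'" "\<exists>T\<subseteq>X. ?b' = excess T" "0 \<le> ?b"
    using inv t by (auto simp: chain_inv_def ascent_inv_def Let_def)
  have w: "imem s1 ''w'' (int v) = subgradient n (restricted X) ?x v" if "v < n" for v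
    using inv that by (simp add: chain_inv_def Let_def all)
  \<comment> \<open>Thresholds up to N occur as prefixes of the scan, at
    \<open>Suc N - \<theta>\<close> because \<open>visited\<close> uses the strict inequality x v >
    N - i. Thresholds above N give the empty set, and \<open>phi\<close> is nonnegative.\<close>
  have levels: "restricted X {v. v < n \<and> int \<theta> \<le> ?x v} \<le> ?b'" for \<theta>
  proof (cases "\<theta> \<le> N")
    case True
    then have "{v. v < n \<and> int \<theta> \<le> ?x v} = visited ?x (Suc N - \<theta>) 0"
      by (auto simp: visited_def)
    moreover have "\<forall>i'\<le>Suc N. restricted X (visited ?x i' 0) \<le> ?b'"
      using inv by (simp add: chain_inv_def Let_def)
    ultimately show ?thesis by simp
  next
    case False
    then have "{v. v < n \<and> int \<theta> \<le> ?x v} = {}" using x by force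
    then show ?thesis using b r.h_empty by (simp only: order_trans)
  qed
  have "2 * int (Suc t) * int N * restricted X S + r.distance N ?x' S
      \<le> int n * (int N)\<^sup>2 + int (Suc t) * int n * ?D\<^sup>2 + 2 * int (Suc t) * int N * ?b'"
    if S: "S \<subseteq> V" for S
  proof -
    have "2 * int N * restricted X S + r.distance N ?x' S \<le> r.distance N ?x S + int n * ?D\<^sup>2 + 2 * int N * ?b'"
      by (rule r.distance_step[OF x levels abs_subgradient_le[OF X] S]) (simp_all add: s2 w)
    moreover have "2 * int t * int N * restricted X S + r.distance N ?x S
        \<le> int n * (int N)\<^sup>2 + int t * int n * ?D\<^sup>2 + 2 * int t * int N * ?b"
      using t S by (simp add: ascent_inv_def Let_def)
    \<comment> \<open>The best value never falls, so the earlier steps may be charged at the new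
      one.\<close>
    moreover have "2 * int t * int N * ?b \<le> 2 * int t * int N * ?b'"
      using b by (intro mult_left_mono) auto
    ultimately show ?thesis unfolding of_nat_Suc by (simp only: distrib_right distrib_left mult_1 mult_1_right)
  qed
  then show ?thesis using b s2 unfolding ascent_inv_def Let_def by auto
qed

lemma writes_ascent:
  "writes (ascent \<rho> ev) = {''x'', ''p'', ''w'', ''fo'', ''h'', ''phi'', ''i'', ''j'', ''t''} \<union> writes ev"
  by (auto simp: ascent_def move_point_def clear_array_def writes_chain)

lemma wp_ascent:
  assumes env: "env s" and X: "f (alive s) \<le> 11 * \<rho> * n"
    and NT: "imem s ''N'' 0 = int N" "imem s ''T'' 0 = int (steps \<rho> n)"
  shows "wp (ascent \<rho> ev) (\<lambda>s'. imem s' ''phi'' 0 = max_excess (alive s)) s"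
proof -
  let ?X = "alive s"
  have XV: "?X \<subseteq> V" by (auto simp: alive_def)
  let ?W = "{''x'', ''p'', ''w'', ''fo'', ''h'', ''phi'', ''i'', ''j'', ''t''} \<union> writes ev"
  have loop: "wp (For ''t'' (cell ''T'') (Seq (ascent_chain \<rho> ev) move_point))
      (\<lambda>s'. imem s' ''phi'' 0 = max_excess (alive s)) s1"
    if fr: "frame {''x'', ''phi'', ''j''} s s1" and inv: "ascent_inv ?X 0 s1" for s1
  proof (rule wp_For[where k = "steps \<rho> n" and I = "ascent_inv ?X"], goal_cases)
    case (4 s')
    then show ?case using NT fr by (simp add: frame_def writes_chain move_point_def)
  next
    case (6 t s2)
    have fr2: "frame ?W s s2"
      by (rule frame_trans[of _ s s1]; rule frame_mono, rule fr 6(3)) (auto simp: writes_chain move_point_def)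
    have env2: "env s2" by (rule env_frame[OF env fr2]) auto
    have N2: "imem s2 ''N'' 0 = int N" using frame_imem[OF fr2, of "''N''"] NT by simp
    have phi2: "0 \<le> imem s2 ''phi'' 0" "\<exists>T\<subseteq>?X. imem s2 ''phi'' 0 = excess T"
      "\<And>v. v < n \<Longrightarrow> 0 \<le> imem s2 ''x'' (int v) \<and> imem s2 ''x'' (int v) \<le> int N"
      using 6(5) by (auto simp: ascent_inv_def Let_def)
    show ?case
    proof (rule wp_Seq, rule wp_conseq[OF wp_chain[OF XV X env2 _ refl phi2(3) N2 refl phi2(1,2)]])
      show "alive s2 = ?X" by (rule alive_frame[OF fr2]) auto
      fix s3 assume fr3: "frame (writes (ascent_chain \<rho> ev)) s2 s3"
        and inv3: "chain_inv ?X (\<lambda>v. imem s2 ''x'' (int v)) (imem s2 ''phi'' 0) (Suc N) 0 s3"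
      have env3: "env s3" by (rule env_frame[OF env2 fr3]) (auto simp: writes_chain)
      have 3: "imem s3 ''x'' = imem s2 ''x''" "imem s3 ''N'' = imem s2 ''N''"
        by (rule frame_imem[OF fr3], simp add: writes_chain)+
      show "wp move_point (\<lambda>s'. ascent_inv ?X (Suc t) (istore ''t'' 0 (int (Suc t)) s')) s3"
      proof (rule wp_conseq[OF wp_move[OF env3]])
        fix s4 assume "frame (writes move_point) s3 s4" and 4: "\<forall>v<n. imem s4 ''x'' (int v) =
          max 0 (min (int N) (imem s3 ''x'' (int v) + imem s3 ''w'' (int v)))"
        then have "imem s4 ''phi'' 0 = imem s3 ''phi'' 0" by (simp add: frame_def move_point_def)
        then have "ascent_inv ?X (Suc t) s4"
          using 4 3 by (intro ascent_inv_Suc[OF XV X 6(5) inv3]) auto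
        then show "ascent_inv ?X (Suc t) (istore ''t'' 0 (int (Suc t)) s4)"
          by (simp add: ascent_inv_istore)
      qed (use 3 N2 in simp)
    qed
  qed (use A_bounds inv XV in \<open>auto simp: ascent_inv_istore writes_chain move_point_def dest: ascent_inv_end\<close>)
  show ?thesis
    unfolding ascent_def
  proof (rule wp_Seq, rule wp_IAssign, goal_cases)
    case 2
    let ?s = "istore ''phi'' 0 0 s"
    show ?case
    proof (rule wp_Seq, rule wp_conseq[OF wp_clear])
      fix s' assume fr: "frame (writes (clear_array ''x'')) (istore ''phi'' (ival (IConst 0) s) (ival (IConst 0) s) s) s'"
        and z: "\<forall>j<n. imem s' ''x'' (int j) = 0"
      have fr': "frame {''x'', ''phi'', ''j''} s s'"
        using fr by (auto simp: frame_def clear_array_def imem_istore)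
      have "imem s' ''phi'' 0 = 0"
        using frame_imem[OF fr, of "''phi''"] by (simp add: clear_array_def imem_istore)
      then have "ascent_inv ?X 0 s'" using z by (intro ascent_inv_start[OF XV]) auto
      then show "wp (For ''t'' (cell ''T'') (Seq (ascent_chain \<rho> ev) move_point))
          (\<lambda>s'. imem s' ''phi'' 0 = max_excess (alive s)) s'"
        by (rule loop[OF fr'])
    qed (use env in \<open>auto simp: env_def imem_istore\<close>)
  qed (use A_bounds in simp)
qed

end

text \<open>Transitivity for ratios of cost to gain in cross multiplied form: multiply by
  \<open>gb\<close>, pass through \<open>cb\<close>, cancel \<open>gb\<close>. Only
  \<open>gb\<close> has to be positive; \<open>gu\<close> and \<open>gv\<close> may vanish.\<close>

lemma ratio_le_trans:
  fixes cb cu cv gb gu gv :: real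
  assumes "cb * gu \<le> cu * gb" "gb * cv \<le> gv * cb" "0 < gb" "0 \<le> gu" "0 \<le> gv"
  shows "cv * gu \<le> cu * gv"
proof -
  have "(gb * cv) * gu \<le> (gv * cb) * gu" using assms by (intro mult_right_mono)
  also have "\<dots> = gv * (cb * gu)" by simp
  also have "\<dots> \<le> gv * (cu * gb)" using assms by (intro mult_left_mono)
  finally have "gb * (cv * gu) \<le> gb * (cu * gv)" by (simp add: algebra_simps)
  then show ?thesis using assms(3) by simp
qed

section \<open>Correctness of the greedy loop\<close>

context program
begin

definition ready :: "state \<Rightarrow> bool" where
  "ready s \<longleftrightarrow> env s \<and> imem s ''N'' 0 = int N \<and> imem s ''T'' 0 = int (steps \<rho> n)"

lemma ready_frame:
  "ready s \<Longrightarrow> frame W s s' \<Longrightarrow> ''n'' \<notin> W \<Longrightarrow> ''adj'' \<notin> W \<Longrightarrow> ''N'' \<notin> W \<Longrightarrow> ''T'' \<notin> W \<Longrightarrow> ready s'"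
  unfolding ready_def using env_frame[of s W s'] by (simp add: frame_def)

lemma writes_load_alive: "writes load_alive = {''p'', ''j''}"
  by (auto simp: load_alive_def)

lemma writes_evaluate:
  "writes (evaluate_potential \<rho> ev) = {''x'', ''p'', ''w'', ''fo'', ''h'', ''phi'', ''i'', ''j'', ''t''} \<union> writes ev"
  by (auto simp: evaluate_potential_def writes_ascent writes_load_alive)

lemma wp_evaluate:
  assumes "ready s" and fu: "imem s ''fu'' 0 = int (f U)" and U: "alive s \<subseteq> U" "U \<subseteq> V"
  shows "wp (evaluate_potential \<rho> ev) (\<lambda>s'. imem s' ''phi'' 0 = potential U (alive s)) s"
proof -
  have env: "env s" and n: "imem s ''n'' 0 = int n" using assms(1) by (simp_all add: ready_def env_def)
  have l: "11 * int \<rho> * int n < int (f U) \<longleftrightarrow> large U"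
  proof -
    have "11 * int \<rho> * int n = int (11 * \<rho> * n)" by simp
    then show ?thesis by (simp only: large_def card_lessThan of_nat_less_iff)
  qed
  have fA: "int (f (alive s)) \<le> A"
    using f_le[OF subset_trans[OF U]] A_bounds(2) by linarith
  show ?thesis
  proof (cases "large U")
    case False
    then have "f U \<le> 11 * \<rho> * n" by (simp add: large_def)
    then have "f (alive s) \<le> 11 * \<rho> * n" using f_mono[OF U] by simp
    then have "wp (ascent \<rho> ev) (\<lambda>s'. imem s' ''phi'' 0 = potential U (alive s)) s"
      using wp_ascent[OF env] False assms(1) by (simp add: potential_def ready_def)
    then show ?thesis unfolding evaluate_potential_def
      using False l fu n by (intro wp_If) auto
  next
    case True
    have "wp (Seq load_alive (Seq ev (assign ''phi'' (cell ''val'')))) (\<lambda>s'. imem s' ''phi'' 0 = potential U (alive s)) s"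
    proof (rule wp_Seq, rule wp_conseq[OF wp_load_alive[OF env]])
      fix s1 assume fr: "frame (writes load_alive) s s1" and d: "decode_set n (imem s1 ''p'') = alive s"
      have env1: "env s1" by (rule env_frame[OF env fr]) (auto simp: writes_load_alive)
      show "wp (Seq ev (assign ''phi'' (cell ''val''))) (\<lambda>s'. imem s' ''phi'' 0 = potential U (alive s)) s1"
      proof (rule wp_Seq, rule wp_conseq[OF ev])
        fix s2 :: state assume "imem s2 ''val'' 0 = int (f (decode_set n (imem s1 ''p'')))"
        then show "wp (assign ''phi'' (cell ''val'')) (\<lambda>s'. imem s' ''phi'' 0 = potential U (alive s)) s2"
          using True d fA by (intro wp_IAssign) (auto simp: imem_istore potential_def)
      qed (use env1 in \<open>auto simp: env_def\<close>)
    qed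
    then show ?thesis unfolding evaluate_potential_def
      using True l fu n by (intro wp_If) auto
  qed
qed

text \<open>\<open>bg = 0\<close> says that no element of positive gain has been met;
  \<open>best\<close> is then the default 0, which is an element only if n > 0.\<close>

definition probe_inv :: "nat set \<Rightarrow> (nat \<Rightarrow> real) \<Rightarrow> nat \<Rightarrow> state \<Rightarrow> bool" where
  "probe_inv U c k s \<longleftrightarrow> alive s = U \<and> (\<exists>b. imem s ''best'' 0 = int b \<and> (b < n \<or> b = 0) \<and>
     0 \<le> imem s ''bg'' 0 \<and> (0 < imem s ''bg'' 0 \<longrightarrow> b < n \<and> imem s ''bg'' 0 = gain U b) \<and>
     (imem s ''bg'' 0 = 0 \<longrightarrow> (\<forall>u<k. gain U u \<le> 0)) \<and>
     (\<forall>u<k. c b * gain U u \<le> c u * imem s ''bg'' 0))"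

lemma probe_inv_istore:
  assumes "y \<noteq> ''out''" "y \<noteq> ''best''" "y \<noteq> ''bg''"
  shows "probe_inv U c k (istore y a z s) = probe_inv U c k s"
proof -
  have "imem (istore y a z s) u = imem s u" if "u \<in> {''out'', ''best'', ''bg''}" for u
    using assms that by (auto simp: imem_istore)
  then show ?thesis by (simp add: probe_inv_def alive_def)
qed

lemma writes_probe:
  "writes (probe \<rho> ev) =
     {''x'', ''p'', ''w'', ''fo'', ''h'', ''phi'', ''i'', ''j'', ''t'', ''out'', ''best'', ''bg''} \<union> writes ev"
  by (auto simp: probe_def writes_evaluate)

lemma abs_potential_le:
  assumes "X \<subseteq> V"
  shows "0 \<le> potential U X" "potential U X \<le> int F"
  using max_excess_nonneg[OF assms] max_excess_le[OF assms] f_le[OF assms]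
  by (auto simp: potential_def)

lemma gain_le_F: "U \<subseteq> V \<Longrightarrow> gain U u \<le> int F"
  unfolding gain_def using abs_potential_le[of "U - {u}" U] abs_potential_le[of U U] by force

lemma wp_probe:
  assumes ready: "ready s" and fu: "imem s ''fu'' 0 = int (f U)" and cur: "imem s ''cur'' 0 = potential U U"
    and k: "k < n" "imem s ''v'' 0 = int k" and U: "U \<subseteq> V"
    and c: "\<And>u. u < n \<Longrightarrow> 0 \<le> c u" "\<And>u. u < n \<Longrightarrow> rmem s ''c'' (int u) = c u"
    and inv: "probe_inv U c k s"
  shows "wp (probe \<rho> ev) (probe_inv U c (Suc k)) s"
proof -
  have U_eq: "alive s = U" using inv by (simp add: probe_inv_def)
  have in_U: "imem s ''out'' (int k) = 0 \<longleftrightarrow> k \<in> U"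
    using U_eq k(1) by (auto simp: alive_def decode_set_def)
  obtain b where b: "imem s ''best'' 0 = int b" "b < n \<or> b = 0" "0 \<le> imem s ''bg'' 0"
    "0 < imem s ''bg'' 0 \<longrightarrow> b < n \<and> imem s ''bg'' 0 = gain U b"
    "imem s ''bg'' 0 = 0 \<longrightarrow> (\<forall>u<k. gain U u \<le> 0)"
    "\<forall>u<k. c b * gain U u \<le> c u * imem s ''bg'' 0"
    using inv unfolding probe_inv_def by blast
  have bn: "b < n" using b(2) k(1) by auto
  show ?thesis
  proof (cases "k \<in> U")
    case False
    then have g: "gain U k = 0" by (rule gain_notin)
    have "probe_inv U c (Suc k) s"
      unfolding probe_inv_def using b U_eq g c(1)[OF k(1)]
      by (intro conjI exI[of _ b]) (auto simp: less_Suc_eq)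
    then show ?thesis unfolding probe_def using False in_U k
      by (intro wp_If wp_Skip) auto
  next
    case True
    define s1 where "s1 = istore ''out'' (int k) 1 s"
    have alive1: "alive s1 = U - {k}"
      using U_eq k(1) by (auto simp: alive_def s1_def imem_istore decode_set_upd)
    have ready1: "ready s1" using ready by (simp add: ready_def env_def s1_def imem_istore)
    have rest: "wp (Seq (assign_entry ''out'' ''v'' (IConst 0))
       (If (And (ILe (IAdd (cell ''phi'') (IConst 1)) (cell ''cur''))
             (RLe (RScale (cell ''bg'') (RCell ''c'' (cell ''v'')))
                (RScale (ISub (cell ''cur'') (cell ''phi'')) (RCell ''c'' (cell ''best'')))))
         (Seq (assign ''best'' (cell ''v'')) (assign ''bg'' (ISub (cell ''cur'') (cell ''phi''))))
         Skip)) (probe_inv U c (Suc k)) s2"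
      if fr: "frame (writes (evaluate_potential \<rho> ev)) s1 s2" and phi: "imem s2 ''phi'' 0 = potential U (U - {k})" for s2
    proof -
      have s2: "imem s2 ''out'' = (imem s ''out'')(int k := 1)" "imem s2 ''v'' 0 = int k"
        "imem s2 ''cur'' 0 = potential U U" "imem s2 ''best'' 0 = int b" "imem s2 ''bg'' = imem s ''bg''"
        using fr k cur b by (simp_all add: frame_def s1_def imem_istore writes_evaluate)
      have rc: "rmem s2 ''c'' = rmem s ''c''"
        using fr by (simp add: frame_def s1_def writes_evaluate)
      have g: "gain U k = potential U U - imem s2 ''phi'' 0" by (simp add: gain_def phi)
      have g0: "0 \<le> gain U k" by (rule gain_nonneg[OF U])
      let ?s3 = "istore ''out'' (int k) 0 s2"
      have out3: "imem ?s3 ''out'' = imem s ''out''" using s2 in_U True by (auto simp: imem_istore)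
      have alive3: "alive ?s3 = U" using U_eq by (simp add: alive_def out3)
      \<comment> \<open>The candidate beats the old best, which beats all earlier elements; if there
        was no best, all earlier gains are zero.\<close>
      have yes: "probe_inv U c (Suc k) (istore ''bg'' 0 (gain U k) (istore ''best'' 0 (int k) ?s3))"
        if *: "0 < gain U k" "imem s ''bg'' 0 * c k \<le> gain U k * c b"
      proof -
        have "c k * gain U u \<le> c u * gain U k" if "u < k" for u
        proof (cases "imem s ''bg'' 0 = 0")
          case True
          then have "gain U u = 0" using b(5) that gain_nonneg[OF U, of u] by auto
          then show ?thesis using c(1)[of u] that k(1) g0 by simp
        next
          case False
          then show ?thesis
            using ratio_le_trans[of "c b" "gain U u" "c u" "imem s ''bg'' 0" "c k" "gain U k"] b(3,6) that * g0
              gain_nonneg[OF U, of u] by auto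
        qed
        then show ?thesis unfolding probe_inv_def using k(1) * alive3
          by (intro conjI exI[of _ k]) (auto simp: imem_istore alive_def less_Suc_eq)
      qed
      have no: "probe_inv U c (Suc k) ?s3"
        if *: "\<not> (0 < gain U k \<and> imem s ''bg'' 0 * c k \<le> gain U k * c b)"
      proof -
        have "c b * gain U k \<le> c k * imem s ''bg'' 0"
          using * g0 b(3) c(1)[OF k(1)] by (cases "gain U k = 0") (auto simp: mult.commute)
        \<comment> \<open>With \<open>bg\<close> zero the ratio test reads 0 \<le> gain * c b and
          cannot fail for a positive gain.\<close>
        moreover have "gain U k \<le> 0" if "imem s ''bg'' 0 = 0"
          using * that c(1)[OF bn] g0 by (auto simp: zero_le_mult_iff)
        ultimately show ?thesis unfolding probe_inv_def using b s2 alive3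
          by (intro conjI exI[of _ b]) (auto simp: imem_istore less_Suc_eq)
      qed
      have gA: "\<bar>gain U k\<bar> \<le> A" using gain_le_F[OF U, of k] g0 A_bounds by linarith
      have kA: "int k \<le> A" using n_le k by simp
      have cond: "bval (And (ILe (IAdd (cell ''phi'') (IConst 1)) (cell ''cur''))
             (RLe (RScale (cell ''bg'') (RCell ''c'' (cell ''v'')))
                (RScale (ISub (cell ''cur'') (cell ''phi'')) (RCell ''c'' (cell ''best''))))) ?s3 \<longleftrightarrow>
          0 < gain U k \<and> imem s ''bg'' 0 * c k \<le> gain U k * c b"
        using s2 phi rc c(2)[OF k(1)] c(2)[OF bn] by (auto simp: imem_istore gain_def)
      show ?thesis
      proof (rule wp_Seq, rule wp_IAssign)
        show "wp (If (And (ILe (IAdd (cell ''phi'') (IConst 1)) (cell ''cur''))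
             (RLe (RScale (cell ''bg'') (RCell ''c'' (cell ''v'')))
                (RScale (ISub (cell ''cur'') (cell ''phi'')) (RCell ''c'' (cell ''best'')))))
           (Seq (assign ''best'' (cell ''v'')) (assign ''bg'' (ISub (cell ''cur'') (cell ''phi''))))
           Skip) (probe_inv U c (Suc k)) (istore ''out'' (ival (cell ''v'') s2) (ival (IConst 0) s2) s2)"
          unfolding ival.simps s2(2)
        proof (rule wp_If, goal_cases)
          case 1
          then have "probe_inv U c (Suc k) (istore ''bg'' 0 (gain U k) (istore ''best'' 0 (int k) ?s3))"
            unfolding cond by (intro yes) auto
          then show ?case
            by (intro wp_Seq wp_IAssign) (use kA gA g s2 in \<open>auto simp: imem_istore\<close>)
        next
          case 2
          then show ?case unfolding cond by (intro wp_Skip no)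
        qed
      qed (use A_bounds in simp)
    qed
    show ?thesis unfolding probe_def
    proof (rule wp_If, rule wp_Seq, rule wp_IAssign, goal_cases)
      case 2
      have "wp (evaluate_potential \<rho> ev) (\<lambda>s'. imem s' ''phi'' 0 = potential U (U - {k})) s1"
      proof -
        have "imem s1 ''fu'' 0 = int (f U)" using fu by (simp add: s1_def imem_istore)
        then show ?thesis using wp_evaluate[OF ready1 _ _ U] by (simp add: alive1)
      qed
      then show ?case unfolding ival.simps k(2) s1_def[symmetric]
        by (intro wp_Seq, rule wp_conseq) (use rest in auto)
    qed (use A_bounds in_U True k in auto)
  qed
qed

definition round_result :: "nat set \<Rightarrow> (nat \<Rightarrow> real) \<Rightarrow> state \<Rightarrow> bool" where
  "round_result S c s \<longleftrightarrow> (let S' = decode_set n (imem s ''out'') in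
     S' = S \<and> (\<forall>u\<in>V. gain (V - S) u \<le> 0) \<or>
     (\<exists>v\<in>V. 0 < gain (V - S) v \<and> (\<forall>u\<in>V. c v * gain (V - S) u \<le> c u * gain (V - S) v) \<and> S' = insert v S))"

lemma writes_round:
  "writes (greedy_round \<rho> ev) = {''x'', ''p'', ''w'', ''fo'', ''h'', ''phi'', ''i'', ''j'', ''t'', ''out'', ''best'',
     ''bg'', ''fu'', ''cur'', ''v''} \<union> writes ev"
  by (auto simp: greedy_round_def writes_probe writes_evaluate writes_load_alive)

lemma wp_round:
  assumes ready: "ready s"
    and c: "\<And>u. u < n \<Longrightarrow> 0 \<le> c u" "\<And>u. u < n \<Longrightarrow> rmem s ''c'' (int u) = c u"
  shows "wp (greedy_round \<rho> ev) (round_result (decode_set n (imem s ''out'')) c) s"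
proof -
  let ?S = "decode_set n (imem s ''out'')" and ?U = "alive s"
  have U: "?U \<subseteq> V" by (auto simp: alive_def)
  have S: "V - ?S = ?U" by (simp add: alive_def)
  have finish: "wp (If (ILe (IConst 1) (cell ''bg'')) (assign_entry ''out'' ''best'' (IConst 1)) Skip)
      (round_result ?S c) s3" if inv: "probe_inv ?U c n s3" for s3
  proof -
    obtain b where b: "imem s3 ''best'' 0 = int b" "b < n \<or> b = 0" "0 \<le> imem s3 ''bg'' 0"
      "0 < imem s3 ''bg'' 0 \<longrightarrow> b < n \<and> imem s3 ''bg'' 0 = gain ?U b"
      "imem s3 ''bg'' 0 = 0 \<longrightarrow> (\<forall>u<n. gain ?U u \<le> 0)"
      "\<forall>u<n. c b * gain ?U u \<le> c u * imem s3 ''bg'' 0"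
      using inv unfolding probe_inv_def by blast
    have a: "alive s3 = ?U" using inv by (simp add: probe_inv_def)
    have d: "decode_set n (imem s3 ''out'') = ?S"
      using a decode_set_subset[of n "imem s3 ''out''"] decode_set_subset[of n "imem s ''out''"]
      by (auto simp: alive_def)
    show ?thesis
    proof (rule wp_If, rule wp_IAssign)
      assume "bval (ILe (IConst 1) (cell ''bg'')) s3"
      then have *: "0 < imem s3 ''bg'' 0" "b < n" "imem s3 ''bg'' 0 = gain ?U b" using b by auto
      have "b \<in> V" "0 < gain ?U b" "\<forall>u\<in>V. c b * gain ?U u \<le> c u * gain ?U b"
        using * b(6) by auto
      moreover have "decode_set n (imem (istore ''out'' (int b) 1 s3) ''out'') = insert b ?S"
        using * d by (simp add: imem_istore decode_set_upd)
      ultimately show "round_result ?S c (istore ''out'' (ival (cell ''best'') s3) (ival (IConst 1) s3) s3)"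
        unfolding round_result_def Let_def S ival.simps b(1) by blast
    next
      assume "\<not> bval (ILe (IConst 1) (cell ''bg'')) s3"
      then have "imem s3 ''bg'' 0 = 0" using b(3) by simp
      then show "wp Skip (round_result ?S c) s3"
        using b(5) d by (intro wp_Skip) (simp add: round_result_def S)
    qed (use A_bounds in simp)
  qed
  have loop: "wp (For ''v'' (cell ''n'') (probe \<rho> ev)) (probe_inv ?U c n) s2"
    if ready2: "ready s2" and fu: "imem s2 ''fu'' 0 = int (f ?U)" and cur: "imem s2 ''cur'' 0 = potential ?U ?U"
      and a2: "alive s2 = ?U" and z: "imem s2 ''best'' 0 = 0" "imem s2 ''bg'' 0 = 0"
      and r2: "rmem s2 ''c'' = rmem s ''c''" for s2
  proof (rule wp_For[where k = n and I = "probe_inv ?U c"], goal_cases)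
    case (4 s')
    then show ?case using ready2 by (simp add: frame_def writes_probe ready_def env_def)
  next
    case 5
    show ?case unfolding probe_inv_def
      using a2 z by (intro conjI exI[of _ 0]) (auto simp: imem_istore alive_def)
  next
    case (6 k s')
    have fr: "imem s' ''fu'' = imem s2 ''fu''" "imem s' ''cur'' = imem s2 ''cur''"
      by (rule frame_imem[OF 6(3)], simp add: writes_probe)+
    have "rmem s' ''c'' = rmem s2 ''c''"
      by (rule frame_rmem[OF 6(3)], simp add: writes_probe)
    moreover have "ready s'" by (rule ready_frame[OF ready2 6(3)]) (auto simp: writes_probe)
    ultimately have "wp (probe \<rho> ev) (probe_inv ?U c (Suc k)) s'"
      using 6 fr fu cur c r2 U by (intro wp_probe) auto
    then show ?case by (simp add: probe_inv_istore)
  qed (use n_le in \<open>auto simp: writes_probe\<close>)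
  have env: "env s" using ready by (simp add: ready_def)
  have "wp load_alive (wp (Seq ev (Seq (assign ''fu'' (cell ''val''))
     (Seq (evaluate_potential \<rho> ev) (Seq (assign ''cur'' (cell ''phi''))
     (Seq (assign ''best'' (IConst 0)) (Seq (assign ''bg'' (IConst 0))
     (Seq (For ''v'' (cell ''n'') (probe \<rho> ev))
       (If (ILe (IConst 1) (cell ''bg'')) (assign_entry ''out'' ''best'' (IConst 1)) Skip))))))))
     (round_result ?S c)) s"
  proof (rule wp_conseq[OF wp_load_alive[OF env]])
    fix s1 assume fr1: "frame (writes load_alive) s s1" and d: "decode_set n (imem s1 ''p'') = ?U"
    have env1: "env s1" by (rule env_frame[OF env fr1]) (auto simp: writes_load_alive)
    show "wp (Seq ev (Seq (assign ''fu'' (cell ''val''))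
     (Seq (evaluate_potential \<rho> ev) (Seq (assign ''cur'' (cell ''phi''))
     (Seq (assign ''best'' (IConst 0)) (Seq (assign ''bg'' (IConst 0))
     (Seq (For ''v'' (cell ''n'') (probe \<rho> ev))
       (If (ILe (IConst 1) (cell ''bg'')) (assign_entry ''out'' ''best'' (IConst 1)) Skip))))))))
     (round_result ?S c) s1"
    proof (rule wp_Seq, rule wp_conseq[OF ev])
      fix s2 assume fr2: "frame (writes ev) s1 s2"
        and val: "imem s2 ''val'' 0 = int (f (decode_set n (imem s1 ''p'')))"
      let ?s2 = "istore ''fu'' 0 (int (f ?U)) s2"
      have fr: "frame ({''p'', ''j'', ''fu''} \<union> writes ev) s ?s2"
        using fr1 fr2 by (auto simp: frame_def imem_istore writes_load_alive)
      have r2: "ready ?s2" by (rule ready_frame[OF ready fr]) auto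
      have a2: "alive ?s2 = ?U" by (rule alive_frame[OF fr]) auto
      have fA: "int (f ?U) \<le> A" using f_le[OF U] A_bounds by linarith
      have tail: "wp (Seq (assign ''cur'' (cell ''phi''))
     (Seq (assign ''best'' (IConst 0)) (Seq (assign ''bg'' (IConst 0))
     (Seq (For ''v'' (cell ''n'') (probe \<rho> ev))
       (If (ILe (IConst 1) (cell ''bg'')) (assign_entry ''out'' ''best'' (IConst 1)) Skip)))))
        (round_result ?S c) s3"
        if fr3: "frame (writes (evaluate_potential \<rho> ev)) ?s2 s3" and phi: "imem s3 ''phi'' 0 = potential ?U ?U" for s3
      proof -
        have pA: "\<bar>potential ?U ?U\<bar> \<le> A" using abs_potential_le[OF U, of ?U] A_bounds by linarith
        let ?s4 = "istore ''bg'' 0 0 (istore ''best'' 0 0 (istore ''cur'' 0 (potential ?U ?U) s3))"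
        have fu4: "imem s3 ''fu'' 0 = int (f ?U)"
          using frame_imem[OF fr3, of "''fu''"] by (simp add: writes_evaluate imem_istore)
        have fr4: "frame ({''bg'', ''best'', ''cur''} \<union> writes (evaluate_potential \<rho> ev)) ?s2 ?s4"
          using fr3 by (auto simp: frame_def imem_istore)
        have "wp (For ''v'' (cell ''n'') (probe \<rho> ev)) (probe_inv ?U c n) ?s4"
        proof (rule loop)
          show "ready ?s4" by (rule ready_frame[OF r2 fr4]) (auto simp: writes_evaluate)
          show "alive ?s4 = ?U" using alive_frame[OF fr4] a2 by (simp add: writes_evaluate)
          show "rmem ?s4 ''c'' = rmem s ''c''"
            using frame_rmem[OF fr4, of "''c''"] frame_rmem[OF fr, of "''c''"] by (simp add: writes_evaluate)
        qed (simp_all add: imem_istore fu4)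
        then have "wp (For ''v'' (cell ''n'') (probe \<rho> ev))
            (wp (If (ILe (IConst 1) (cell ''bg'')) (assign_entry ''out'' ''best'' (IConst 1)) Skip)
              (round_result ?S c)) ?s4"
          by (rule wp_conseq) (rule finish)
        then show ?thesis
          by (intro wp_Seq wp_IAssign) (use phi pA A_bounds in auto)
      qed
      have "wp (evaluate_potential \<rho> ev) (\<lambda>s'. imem s' ''phi'' 0 = potential ?U ?U) ?s2"
        using wp_evaluate[OF r2, of ?U] U by (simp add: a2 imem_istore)
      then have "wp (Seq (evaluate_potential \<rho> ev) (Seq (assign ''cur'' (cell ''phi''))
         (Seq (assign ''best'' (IConst 0)) (Seq (assign ''bg'' (IConst 0))
         (Seq (For ''v'' (cell ''n'') (probe \<rho> ev))
           (If (ILe (IConst 1) (cell ''bg'')) (assign_entry ''out'' ''best'' (IConst 1)) Skip))))))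
          (round_result ?S c) ?s2"
        by (intro wp_Seq, rule wp_conseq) (use tail in auto)
      then show "wp (Seq (assign ''fu'' (cell ''val'')) (Seq (evaluate_potential \<rho> ev) (Seq (assign ''cur'' (cell ''phi''))
         (Seq (assign ''best'' (IConst 0)) (Seq (assign ''bg'' (IConst 0))
         (Seq (For ''v'' (cell ''n'') (probe \<rho> ev))
           (If (ILe (IConst 1) (cell ''bg'')) (assign_entry ''out'' ''best'' (IConst 1)) Skip)))))))
          (round_result ?S c) s2"
        using val d fA by (intro wp_Seq[of "assign ''fu'' (cell ''val'')"] wp_IAssign) auto
    qed (use env1 in \<open>auto simp: env_def\<close>)
  qed
  then show ?thesis unfolding greedy_round_def by (rule wp_Seq)
qed

lemma wp_greedy:
  assumes env: "env s" and out: "imem s ''out'' = (\<lambda>_. 0)"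
    and c: "\<And>u. u < n \<Longrightarrow> 0 \<le> c u" "\<And>u. u < n \<Longrightarrow> rmem s ''c'' (int u) = c u"
    and B: "B \<subseteq> V" "hits B" and k: "\<And>u. u \<in> V \<Longrightarrow> int (f V) - int (f (V - {u})) \<le> int k"
  shows "wp (greedy_deletion \<rho> ev) (\<lambda>s'. hits (decode_set n (imem s' ''out'')) \<and>
     sum c (decode_set n (imem s' ''out'')) \<le> (if k = 0 then 1 else 1 + ln (real k)) * sum c B) s"
proof -
  \<comment> \<open>Every round deletes a new element or certifies that no gain is left, so after n
    rounds all of V is deleted or the certificate holds.\<close>
  define inv where "inv = (\<lambda>j (s' :: state). let S = decode_set n (imem s' ''out'') in
    greedy_inv c k B S \<and> (j \<le> card S \<or> (\<forall>u\<in>V. gain (V - S) u \<le> 0)))"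
  have inv_istore: "inv j (istore ''it'' a z s') = inv j s'" for j a z s'
    by (simp add: inv_def imem_istore)
  let ?s = "istore ''T'' 0 (int (steps \<rho> n)) (istore ''N'' 0 (int N) s)"
  have ready: "ready ?s" using env by (simp add: ready_def env_def imem_istore)
  have r: "rmem ?s = rmem s" by simp
  have loop: "wp (For ''it'' (cell ''n'') (greedy_round \<rho> ev)) (\<lambda>s'. hits (decode_set n (imem s' ''out'')) \<and>
     sum c (decode_set n (imem s' ''out'')) \<le> (if k = 0 then 1 else 1 + ln (real k)) * sum c B) ?s"
  proof (rule wp_For[where k = n and I = inv], goal_cases)
    case (4 s')
    then show ?case using ready by (simp add: frame_def writes_round ready_def env_def)
  next
    case 5
    have "decode_set n (imem ?s ''out'') = {}" using out by (simp add: imem_istore decode_set_def)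
    then show ?case unfolding inv_istore
      using greedy_inv_start[of c B k] c(1) B k by (simp add: inv_def)
  next
    case (6 j s')
    let ?S = "decode_set n (imem s' ''out'')"
    have S: "?S \<subseteq> V" by (rule decode_set_subset)
    have ready': "ready s'" by (rule ready_frame[OF ready 6(3)]) (auto simp: writes_round)
    have rc: "rmem s' ''c'' = rmem s ''c''"
      using frame_rmem[OF 6(3), of "''c''"] by (simp add: writes_round)
    show ?case unfolding inv_istore
    proof (rule wp_conseq[OF wp_round[OF ready', of c]])
      fix s'' assume *: "round_result ?S c s''"
      let ?S' = "decode_set n (imem s'' ''out'')"
      consider "?S' = ?S" "\<forall>u\<in>V. gain (V - ?S) u \<le> 0"
        | v where "v \<in> V" "0 < gain (V - ?S) v" "\<forall>u\<in>V. c v * gain (V - ?S) u \<le> c u * gain (V - ?S) v"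
            "?S' = insert v ?S"
        using * unfolding round_result_def Let_def by blast
      then show "inv (Suc j) s''"
      proof cases
        case 1
        then show ?thesis using 6(5) by (auto simp: inv_def Let_def)
      next
        case 2
        have "v \<notin> ?S" using 2(2) gain_notin[of v "V - ?S"] by auto
        moreover have "finite ?S" using S finite by (rule finite_subset)
        ultimately have card: "card ?S' = Suc (card ?S)" using 2(4) by simp
        have "j \<le> card ?S" using 6(5) 2(1,2) by (force simp: inv_def Let_def)
        moreover have "greedy_inv c k B ?S'" unfolding 2(4)
          by (rule greedy_inv_step[OF _ B k S])
            (use c(1) 2 6(5) in \<open>auto simp: inv_def Let_def\<close>)
        ultimately show ?thesis using card by (simp add: inv_def)
      qed
    qed (use c rc in auto)
  next
    case (7 s')
    let ?S = "decode_set n (imem s' ''out'')"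
    have S: "?S \<subseteq> V" by (rule decode_set_subset)
    have i: "greedy_inv c k B ?S" "n \<le> card ?S \<or> (\<forall>u\<in>V. gain (V - ?S) u \<le> 0)"
      using 7(3) by (auto simp: inv_def Let_def)
    have "hits ?S" using i(2)
    proof
      assume "n \<le> card ?S"
      then have "?S = V" using S card_seteq[OF finite S] by simp
      then show ?thesis using hits_all by simp
    next
      assume "\<forall>u\<in>V. gain (V - ?S) u \<le> 0"
      then show ?thesis using hits_if_no_gain[OF S] by auto
    qed
    then show ?case using greedy_inv_cost[OF _ B(1) i(1)] c(1) by auto
  qed (use n_le in \<open>auto simp: writes_round\<close>)
  have n: "imem s ''n'' 0 = int n" using env by (simp add: env_def)
  have N_eq: "288 * (int \<rho>)\<^sup>2 * (int n * (int n * int n)) + 1 = int N"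
    by (simp add: grid_def power3_eq_cube)
  have T_eq: "2 * (int n * int N) = int (steps \<rho> n)" by (simp add: steps_def)
  show ?thesis unfolding greedy_deletion_def
    by (rule wp_Seq, rule wp_IAssign, goal_cases, simp add: n N_eq, use A_bounds in linarith,
      rule wp_Seq, rule wp_IAssign, goal_cases, simp add: n N_eq T_eq imem_istore, use A_bounds in linarith)
      (use loop in \<open>simp add: n N_eq T_eq imem_istore\<close>)
qed

end

section \<open>Polynomial running time\<close>

text \<open>Adding 1 lengthens a binary expansion by at most one digit. The bound is crude in b,
  which is harmless as long as b is polynomial in the input size; only a may be exponential.\<close>

lemma floorlog_add_le: "floorlog 2 (a + b) \<le> floorlog 2 a + b"
proof (induction b)
  case (Suc b)
  have "floorlog 2 (Suc x) \<le> Suc (floorlog 2 x)" for x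
  proof -
    have "Suc x \<le> 2 ^ floorlog 2 x" using floorlog_leD[of 2 x "floorlog 2 x"] by simp
    also have "\<dots> < 2 ^ Suc (floorlog 2 x)" by simp
    finally show ?thesis by (simp only: floorlog_le_iff) simp
  qed
  from this[of "a + b"] Suc show ?case by simp
qed simp

lemma cost_opt:
  assumes "S0 \<subseteq> {..<num P i}" "feasible P i S0"
  obtains B where "B \<subseteq> {..<num P i}" "feasible P i B" "opt_cost P i = cost P i B"
proof -
  have "opt_cost P i \<in> cost P i ` {S. S \<subseteq> {..<num P i} \<and> feasible P i S}"
    unfolding opt_cost_def using assms by (intro Min_in) auto
  then show ?thesis using that by auto
qed

text \<open>All that is specific to a problem enters here: how f is evaluated, how large its
  single-element drops are, and that its values have polynomial length. The factor depends on
  \<open>k\<close> alone.\<close>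

lemma poly_time_greedy:
  fixes P :: "'i problem" and f :: "'i \<Rightarrow> nat set \<Rightarrow> nat" and F k :: "'i \<Rightarrow> nat" and r :: "nat poly"
  assumes del: "\<And>i. i \<in> instances P \<Longrightarrow> deletion {..<num P i} (f i)"
    and F: "\<And>i T. i \<in> instances P \<Longrightarrow> T \<subseteq> {..<num P i} \<Longrightarrow> f i T \<le> F i"
    and ev_writes: "writes ev \<inter> reserved = {}"
    and ev: "\<And>i m A s. i \<in> instances P \<Longrightarrow> num P i \<le> m \<Longrightarrow> int (F i) + int (num P i) + 2 \<le> A \<Longrightarrow>
       imem s ''n'' 0 = int (num P i) \<Longrightarrow> imem s ''adj'' = int_input P i ''adj'' \<Longrightarrow>
       machine.wp (box P i) m A ev
         (\<lambda>s'. imem s' ''val'' 0 = int (f i (decode_set (num P i) (imem s ''p'')))) s"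
    and n: "\<And>i. i \<in> instances P \<Longrightarrow> int_input P i ''n'' 0 = int (num P i)"
    and out: "\<And>i. i \<in> instances P \<Longrightarrow> int_input P i ''out'' = (\<lambda>_. 0)"
    and input: "\<And>i x j. i \<in> instances P \<Longrightarrow> \<bar>int_input P i x j\<bar> \<le> int (num P i) + 1"
    and feasible: "\<And>i S. i \<in> instances P \<Longrightarrow> S \<subseteq> {..<num P i} \<Longrightarrow>
       feasible P i S \<longleftrightarrow> deletion.hits {..<num P i} (f i) \<rho> S"
    and cost: "\<And>i u. i \<in> instances P \<Longrightarrow> u < num P i \<Longrightarrow> 0 \<le> elem_cost P i u"
    and k: "\<And>i u. i \<in> instances P \<Longrightarrow> u < num P i \<Longrightarrow>
       int (f i {..<num P i}) - int (f i ({..<num P i} - {u})) \<le> int (k i)"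
    and size: "\<And>i. i \<in> instances P \<Longrightarrow> num P i \<le> input_size P i"
       "\<And>i. i \<in> instances P \<Longrightarrow> floorlog 2 (F i) \<le> poly r (input_size P i)"
  shows "poly_time_approximable P (\<lambda>i. if k i = 0 then 1 else 1 + ln (real (k i)))"
proof -
  obtain p where p: "\<And>m L. time_bound m L (greedy_deletion \<rho> ev) \<le> poly p (m + L)"
    using time_bound_poly by blast
  \<comment> \<open>g, h and a copy \<open>grid\<close>, \<open>steps\<close> and the part of the
    cell bound apart from \<open>F\<close>; r' bounds the loop bound plus the bit length of the cell
    bound.\<close>
  define g :: "nat poly" where "g = 1 + [:288 * \<rho>\<^sup>2:] * [:0, 1:] ^ 3"
  define h :: "nat poly" where "h = [:0, 2:] * g"
  define a :: "nat poly" where "a = 2 + g + h + [:0, 1:] + [:0, 12 * \<rho>:]"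
  define r' :: "nat poly" where "r' = (g + 1 + h + [:0, 1:]) + (1 + (r + a))"
  have "\<exists>t s. exec (box P i) (greedy_deletion \<rho> ev) (start_state P i) t s \<and>
        t \<le> poly (p \<circ>\<^sub>p r') (input_size P i) \<and> feasible P i (output_set P i s) \<and>
        cost P i (output_set P i s) \<le> (if k i = 0 then 1 else 1 + ln (real (k i))) * opt_cost P i"
    if i: "i \<in> instances P" for i
  proof -
    let ?n = "num P i"
    let ?m = "grid \<rho> ?n + 1 + steps \<rho> ?n + ?n"
    let ?a = "2 + grid \<rho> ?n + steps \<rho> ?n + ?n + 12 * \<rho> * ?n"
    let ?A = "int (F i + ?a)"
    have g_eq: "poly g x = grid \<rho> x" for x by (simp add: g_def grid_def power3_eq_cube)
    have h_eq: "poly h x = steps \<rho> x" for x by (simp add: h_def steps_def g_eq)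
    have a_eq: "poly a ?n = ?a" by (simp add: a_def g_eq h_eq)
    interpret deletion "{..<?n}" "f i" \<rho> using del[OF i] .
    interpret program "box P i" ?m ?A ?n "f i" \<rho> ev "int_input P i ''adj''" "F i"
    proof (unfold_locales, goal_cases)
      case (2 s)
      have "0 \<le> 12 * int \<rho> * int ?n" by simp
      then show ?case using 2 by (intro ev[OF i]) (simp_all add: algebra_simps)
    qed (use ev_writes F[OF i] in auto)
    let ?s = "start_state P i"
    have "\<bar>imem ?s x j\<bar> \<le> ?A" for x j
    proof -
      have "\<bar>imem ?s x j\<bar> \<le> int ?n + 1" using input[OF i, of x j] by (simp add: start_state_def)
      also have "\<dots> \<le> int (2 + ?n)" by simp
      also have "\<dots> \<le> ?A" unfolding of_nat_le_iff by simp
      finally show ?thesis .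
    qed
    then have b: "bounded ?s" unfolding bounded_def by blast
    have "feasible P i {..<?n}" using feasible[OF i order_refl] hits_all by simp
    from cost_opt[OF order_refl this] obtain B where
      B: "B \<subseteq> {..<?n}" "feasible P i B" "opt_cost P i = cost P i B" by metis
    have "wp (greedy_deletion \<rho> ev) (\<lambda>s'. hits (decode_set ?n (imem s' ''out'')) \<and>
       sum (elem_cost P i) (decode_set ?n (imem s' ''out''))
         \<le> (if k i = 0 then 1 else 1 + ln (real (k i))) * sum (elem_cost P i) B) ?s"
    proof (rule wp_greedy)
      show "env ?s" using n[OF i] by (simp add: env_def start_state_def)
      show "imem ?s ''out'' = (\<lambda>_. 0)" using out[OF i] by (simp add: start_state_def)
      show "rmem ?s ''c'' (int u) = elem_cost P i u" if "u < ?n" for u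
        using that by (simp add: start_state_def)
      show "hits B" using B feasible[OF i] by simp
    qed (use cost[OF i] B k[OF i] in auto)
    then obtain t s' where e: "exec (box P i) (greedy_deletion \<rho> ev) ?s t s'" "t \<le> time_bound ?m (bits ?A) (greedy_deletion \<rho> ev)"
      and s': "hits (decode_set ?n (imem s' ''out''))"
       "sum (elem_cost P i) (decode_set ?n (imem s' ''out''))
         \<le> (if k i = 0 then 1 else 1 + ln (real (k i))) * sum (elem_cost P i) B"
      using b unfolding wp_def by blast
    have "bits ?A = 1 + floorlog 2 (F i + ?a)" by (simp only: bits_def abs_of_nat nat_int)
    also have "\<dots> \<le> 1 + (floorlog 2 (F i) + ?a)" by (rule add_left_mono[OF floorlog_add_le])
    also have "\<dots> \<le> 1 + (poly r (input_size P i) + poly a (input_size P i))"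
      using size(2)[OF i] poly_nat_mono[OF size(1)[OF i], of a] a_eq by simp
    finally have "?m + bits ?A \<le> poly (g + 1 + h + [:0, 1:]) ?n + (1 + (poly r (input_size P i) + poly a (input_size P i)))"
      by (simp add: g_eq h_eq)
    also have "\<dots> \<le> poly r' (input_size P i)"
      using poly_nat_mono[OF size(1)[OF i], of "g + 1 + h + [:0, 1:]"] by (simp add: r'_def)
    finally have "t \<le> poly p (poly r' (input_size P i))"
      using e(2) p[of ?m "bits ?A"] poly_nat_mono[of "?m + bits ?A" "poly r' (input_size P i)" p] by linarith
    then show ?thesis
      using e(1) s' B feasible[OF i decode_set_subset]
      by (intro exI[of _ t] exI[of _ s']) (simp add: poly_pcompose output_set_def cost_def)
  qed
  then show ?thesis unfolding poly_time_approximable_def by blast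
qed

section \<open>Density constraints as pointwise inequalities\<close>

lemma density_at_most_iff:
  assumes "finite U"
  shows "density_at_most U h r \<longleftrightarrow> (\<forall>T\<subseteq>U. T \<noteq> {} \<longrightarrow> h T \<le> r * real (card T))"
proof (cases "U = {}")
  case False
  let ?D = "{h S / real (card S) |S. S \<noteq> {} \<and> S \<subseteq> U}"
  have "?D = (\<lambda>S. h S / real (card S)) ` (Pow U - {{}})" by auto
  then have fin: "finite ?D" using assms by simp
  have "?D \<noteq> {}" using False by auto
  then have "density U h \<le> r \<longleftrightarrow> (\<forall>T\<subseteq>U. T \<noteq> {} \<longrightarrow> h T / real (card T) \<le> r)"
    unfolding density_def using fin by (subst Max_le_iff) auto
  moreover have "h T / real (card T) \<le> r \<longleftrightarrow> h T \<le> r * real (card T)" if "T \<subseteq> U" "T \<noteq> {}" for T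
  proof -
    have "0 < card T" using that assms finite_subset by (simp add: card_gt_0_iff)
    then show ?thesis by (simp add: pos_divide_le_eq)
  qed
  ultimately show ?thesis using False unfolding density_at_most_def by blast
qed (simp add: density_at_most_def)

lemma (in deletion) density_iff_hits:
  assumes "\<And>T. T \<subseteq> V - S \<Longrightarrow> h T = real (f T)"
  shows "density_at_most (V - S) h (real \<rho>) \<longleftrightarrow> hits S"
proof -
  have "h T \<le> real \<rho> * real (card T) \<longleftrightarrow> f T \<le> \<rho> * card T" if "T \<subseteq> V - S" for T
    using assms[OF that] by (simp flip: of_nat_mult)
  then have "(\<forall>T\<subseteq>V - S. T \<noteq> {} \<longrightarrow> h T \<le> real \<rho> * real (card T)) \<longleftrightarrow>
      (\<forall>T\<subseteq>V - S. T \<noteq> {} \<longrightarrow> f T \<le> \<rho> * card T)" by blast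
  \<comment> \<open>The empty set, excluded from the density, satisfies the inequality
    anyway.\<close>
  also have "\<dots> \<longleftrightarrow> hits S" unfolding hits_def using f_empty by (metis le0)
  finally show ?thesis using finite by (simp add: density_at_most_iff)
qed

lemma poly_time_approximable_cong:
  assumes "\<And>i. i \<in> instances P \<Longrightarrow> \<beta> i = \<alpha> i" "poly_time_approximable P \<alpha>"
  shows "poly_time_approximable P \<beta>"
proof -
  obtain c p where *: "\<forall>i\<in>instances P. \<exists>t s. exec (box P i) c (start_state P i) t s \<and>
        t \<le> poly p (input_size P i) \<and> feasible P i (output_set P i s) \<and>
        cost P i (output_set P i s) \<le> \<alpha> i * opt_cost P i"
    using assms(2) unfolding poly_time_approximable_def by blast
  show ?thesis
    unfolding poly_time_approximable_def
    by (intro exI[of _ c] exI[of _ p] ballI) (use * assms(1) in fastforce)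
qed

lemma SupmodDD_approximable: "poly_time_approximable (SupmodDD \<rho>) supmod_factor"
proof -
  let ?P = "SupmodDD \<rho>"
  \<comment> \<open>Subtraction of naturals does not truncate here, because f is monotone on valid
    instances; so k is the maximal marginal.\<close>
  define k :: "supmod_instance \<Rightarrow> nat" where "k i = (if s_num i = 0 then 0 else
    Max ((\<lambda>v. s_fun i {..<s_num i} - s_fun i ({..<s_num i} - {v})) ` {..<s_num i}))" for i
  have del: "deletion {..<s_num i} (s_fun i)" if "i \<in> instances ?P" for i
  proof
    show "s_fun i S + s_fun i T \<le> s_fun i (S \<inter> T) + s_fun i (S \<union> T)" if "S \<subseteq> {..<s_num i}" "T \<subseteq> {..<s_num i}" for S T
    proof -
      have "real (s_fun i S) + real (s_fun i T) \<le> real (s_fun i (S \<inter> T)) + real (s_fun i (S \<union> T))"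
        using \<open>i \<in> instances ?P\<close> that by (simp add: SupmodDD_def supermodular_on_def)
      then show ?thesis by linarith
    qed
  qed (use that in \<open>auto simp: SupmodDD_def normalized_def\<close>)
  have "poly_time_approximable ?P (\<lambda>i. if k i = 0 then 1 else 1 + ln (real (k i)))"
  proof (rule poly_time_greedy[where f = s_fun and F = "\<lambda>i. Max (s_fun i ` Pow {..<s_num i})"
        and \<rho> = \<rho> and ev = "Query ''val'' (IConst 0) ''p''" and r = "[:0, 1:]"])
    fix i assume i: "i \<in> instances ?P"
    interpret deletion "{..<s_num i}" "s_fun i" \<rho> by (rule del[OF i])
    show "deletion {..<num ?P i} (s_fun i)" using del[OF i] by (simp add: SupmodDD_def)
    show F: "s_fun i T \<le> Max (s_fun i ` Pow {..<s_num i})" if "T \<subseteq> {..<num ?P i}" for T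
      using that by (simp add: SupmodDD_def)
    show "machine.wp (box ?P i) m A (Query ''val'' (IConst 0) ''p'')
        (\<lambda>s'. imem s' ''val'' 0 = int (s_fun i (decode_set (num ?P i) (imem s ''p'')))) s"
      if "int (Max (s_fun i ` Pow {..<s_num i})) + int (num ?P i) + 2 \<le> A" for m A s
      using that F[OF decode_set_subset[of _ "imem s ''p''"]]
      by (intro machine.wp_Query) (auto simp: SupmodDD_def imem_istore)
    show "feasible ?P i S \<longleftrightarrow> deletion.hits {..<num ?P i} (s_fun i) \<rho> S" for S
      using density_iff_hits[of S "s_rfun i"] by (simp add: SupmodDD_def)
    show "int (s_fun i {..<num ?P i}) - int (s_fun i ({..<num ?P i} - {u})) \<le> int (k i)" if "u < num ?P i" for u
    proof -
      have "s_fun i {..<s_num i} - s_fun i ({..<s_num i} - {u}) \<le> k i"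
        using that by (auto simp: SupmodDD_def k_def intro!: Max_ge)
      then show ?thesis by (simp add: SupmodDD_def)
    qed
  qed (auto simp: SupmodDD_def reserved_def)
  moreover have "supmod_factor i = (if k i = 0 then 1 else 1 + ln (real (k i)))" if i: "i \<in> instances ?P" for i
  proof -
    interpret deletion "{..<s_num i}" "s_fun i" \<rho> by (rule del[OF i])
    let ?d = "\<lambda>v. s_fun i {..<s_num i} - s_fun i ({..<s_num i} - {v})"
    have "marginal (s_rfun i) v ({..<s_num i} - {v}) = real (?d v)" if "v < s_num i" for v
    proof -
      have "{..<s_num i} - {v} \<union> {v} = {..<s_num i}" using that by auto
      then show ?thesis using f_mono[of "{..<s_num i} - {v}" "{..<s_num i}"]
        by (simp add: marginal_def of_nat_diff Diff_subset)
    qed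
    then have im: "(\<lambda>v. marginal (s_rfun i) v ({..<s_num i} - {v})) ` {..<s_num i} = real ` (?d ` {..<s_num i})"
      unfolding image_image by (intro image_cong) auto
    have "max_marginal i = real (k i)"
    proof (cases "s_num i = 0")
      case False
      then have "real (Max (?d ` {..<s_num i})) = Max (real ` ?d ` {..<s_num i})"
        by (intro mono_Max_commute) (auto simp: mono_def)
      then show ?thesis using False by (simp only: max_marginal_def k_def im if_False)
    qed (simp add: max_marginal_def k_def)
    then show ?thesis by (simp add: supmod_factor_def)
  qed
  ultimately show ?thesis by (rule poly_time_approximable_cong[rotated])
qed

section \<open>Nullity in a matroid\<close>

locale finite_matroid =
  fixes E :: "'e set" and \<I> :: "'e set set"
  assumes matroid: "matroid E \<I>"
begin

lemma finite_E: "finite E"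
  and indep_subset: "J \<in> \<I> \<Longrightarrow> J \<subseteq> E"
  and indep_empty: "{} \<in> \<I>"
  and indep_mono: "J \<in> \<I> \<Longrightarrow> I \<subseteq> J \<Longrightarrow> I \<in> \<I>"
  and augment: "I \<in> \<I> \<Longrightarrow> J \<in> \<I> \<Longrightarrow> card I < card J \<Longrightarrow> \<exists>y\<in>J - I. insert y I \<in> \<I>"
  using matroid unfolding matroid_def by blast+

lemma finite_indep: "J \<in> \<I> \<Longrightarrow> finite J"
  using indep_subset finite_E finite_subset by blast

definition rank :: "'e set \<Rightarrow> nat" where
  "rank X = Max (card ` {J \<in> \<I>. J \<subseteq> X})"

definition nullity :: "'e set \<Rightarrow> nat" where
  "nullity X = card X - rank X"

lemma finite_indep_sets: "finite {J \<in> \<I>. J \<subseteq> X}"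
  by (rule finite_subset[of _ "Pow E"]) (use finite_E indep_subset in auto)

lemma card_le_rank: "J \<in> \<I> \<Longrightarrow> J \<subseteq> X \<Longrightarrow> card J \<le> rank X"
  unfolding rank_def using finite_indep_sets by (intro Max_ge) auto

text \<open>Take an independent set of maximal size between I and X. Were it smaller than the rank,
  augmentation from a largest independent subset of X would enlarge it.\<close>

lemma extend_to_basis:
  assumes "I \<in> \<I>" "I \<subseteq> X"
  obtains B where "I \<subseteq> B" "B \<in> \<I>" "B \<subseteq> X" "card B = rank X"
proof -
  let ?K = "{J \<in> \<I>. I \<subseteq> J \<and> J \<subseteq> X}"
  have fin: "finite ?K" by (rule finite_subset[OF _ finite_indep_sets[of X]]) auto
  have "Max (card ` ?K) \<in> card ` ?K" using fin assms by (intro Max_in) auto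
  then obtain B where B: "B \<in> \<I>" "I \<subseteq> B" "B \<subseteq> X" "card B = Max (card ` ?K)" by auto
  have "rank X \<in> card ` {J \<in> \<I>. J \<subseteq> X}"
    unfolding rank_def using finite_indep_sets assms by (intro Max_in) auto
  then obtain J where J: "J \<in> \<I>" "J \<subseteq> X" "rank X = card J" by auto
  have "\<not> card B < card J"
  proof
    assume "card B < card J"
    then obtain y where y: "y \<in> J - B" "insert y B \<in> \<I>" using augment B J by blast
    then have "card (insert y B) \<le> Max (card ` ?K)" using B J fin by (intro Max_ge) auto
    then show False using y B finite_indep[OF B(1)] by simp
  qed
  then have "card B = rank X" using card_le_rank[OF B(1,3)] J by simp
  then show ?thesis using that B by blast
qed

lemma rank_le_card: "finite X \<Longrightarrow> rank X \<le> card X"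
  using extend_to_basis[OF indep_empty, of X] by (metis card_mono empty_subsetI)

text \<open>Extend a basis C of the intersection to a basis B of the union. Then |B \<inter> X| + |B
  \<inter> Y| = |B| + |B \<inter> X \<inter> Y|, the last set contains C, and the sets on the left
  are independent.\<close>

lemma rank_submodular: "rank (X \<inter> Y) + rank (X \<union> Y) \<le> rank X + rank Y"
proof -
  obtain C where C: "C \<in> \<I>" "C \<subseteq> X \<inter> Y" "card C = rank (X \<inter> Y)"
    using extend_to_basis[OF indep_empty, of "X \<inter> Y"] by auto
  obtain B where B: "C \<subseteq> B" "B \<in> \<I>" "B \<subseteq> X \<union> Y" "card B = rank (X \<union> Y)"
    using extend_to_basis[OF C(1), of "X \<union> Y"] C(2) by blast
  have fin: "finite B" by (rule finite_indep[OF B(2)])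
  have "card C \<le> card (B \<inter> (X \<inter> Y))" using B C fin by (intro card_mono) auto
  moreover have "card (B \<inter> X) + card (B \<inter> Y) = card B + card (B \<inter> (X \<inter> Y))"
  proof -
    have "(B \<inter> X) \<union> (B \<inter> Y) = B" "(B \<inter> X) \<inter> (B \<inter> Y) = B \<inter> (X \<inter> Y)" using B by auto
    then show ?thesis using card_Un_Int[of "B \<inter> X" "B \<inter> Y"] fin by simp
  qed
  moreover have "card (B \<inter> X) \<le> rank X" "card (B \<inter> Y) \<le> rank Y"
    by (auto intro!: card_le_rank intro: indep_mono[OF B(2)])
  ultimately show ?thesis using B C by linarith
qed

lemma rank_mono: "X \<subseteq> Y \<Longrightarrow> rank X \<le> rank Y"
  using extend_to_basis[OF indep_empty, of X] by (metis card_le_rank empty_subsetI order_trans)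

lemma rank_le_add:
  assumes "X \<subseteq> Y" "finite Y"
  shows "rank Y \<le> rank X + card (Y - X)"
proof -
  obtain B where B: "B \<in> \<I>" "B \<subseteq> Y" "card B = rank Y"
    using extend_to_basis[OF indep_empty, of Y] by auto
  have "card B \<le> card (B \<inter> X) + card (B - X)"
    using card_Un_le[of "B \<inter> X" "B - X"] by (simp add: Int_Diff_Un)
  moreover have "card (B \<inter> X) \<le> rank X" by (intro card_le_rank) (auto intro: indep_mono[OF B(1)])
  moreover have "card (B - X) \<le> card (Y - X)" using B assms by (intro card_mono) auto
  ultimately show ?thesis using B by linarith
qed

lemma nullity_mono:
  assumes "X \<subseteq> Y" "finite Y"
  shows "nullity X \<le> nullity Y"
proof -
  have "card Y = card X + card (Y - X)"
    using assms by (metis card_Diff_subset card_mono finite_subset le_add_diff_inverse)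
  then show ?thesis using rank_le_add[OF assms] by (simp add: nullity_def)
qed

lemma nullity_le_add:
  assumes "X \<subseteq> Y" "finite Y"
  shows "nullity Y \<le> nullity X + card (Y - X)"
proof -
  have "card Y = card X + card (Y - X)"
    using assms by (metis card_Diff_subset card_mono finite_subset le_add_diff_inverse)
  then show ?thesis using rank_mono[OF assms(1)] by (simp add: nullity_def)
qed

lemma nullity_supermodular:
  assumes "finite X" "finite Y"
  shows "nullity X + nullity Y \<le> nullity (X \<inter> Y) + nullity (X \<union> Y)"
  using rank_submodular[of X Y] card_Un_Int[OF assms] rank_le_card[of X] rank_le_card[of Y]
    rank_le_card[of "X \<inter> Y"] rank_le_card[of "X \<union> Y"] assms
  unfolding nullity_def by simp

lemma nullity_eq_0_iff:
  assumes "X \<subseteq> E"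
  shows "nullity X = 0 \<longleftrightarrow> X \<in> \<I>"
proof
  have fin: "finite X" using assms finite_E finite_subset by blast
  assume "nullity X = 0"
  then have "card X \<le> rank X" by (simp add: nullity_def)
  moreover obtain B where B: "B \<in> \<I>" "B \<subseteq> X" "card B = rank X"
    using extend_to_basis[OF indep_empty, of X] by auto
  ultimately have "B = X" using fin by (intro card_seteq) auto
  then show "X \<in> \<I>" using B by simp
next
  assume "X \<in> \<I>"
  then show "nullity X = 0" using card_le_rank[of X X] by (simp add: nullity_def)
qed

text \<open>Extending J to a basis of X could only add elements that the hypothesis forbids. Thus a
  greedy construction computes the rank.\<close>

lemma maximal_card:
  assumes "J \<in> \<I>" "J \<subseteq> X" "\<And>x. x \<in> X - J \<Longrightarrow> insert x J \<notin> \<I>"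
  shows "card J = rank X"
proof -
  obtain B where B: "J \<subseteq> B" "B \<in> \<I>" "B \<subseteq> X" "card B = rank X"
    using extend_to_basis[OF assms(1,2)] by blast
  have "B = J"
  proof (rule ccontr)
    assume "B \<noteq> J"
    then obtain x where "x \<in> B" "x \<notin> J" using B by auto
    then show False using assms(3)[of x] indep_mono[OF B(2), of "insert x J"] B by auto
  qed
  then show ?thesis using B by simp
qed

end

section \<open>Deletion problems on graphs\<close>

locale graph_matroid = finite_matroid E \<I> for E :: "nat set set" and \<I> +
  fixes n :: nat
  assumes graph: "simple_graph {..<n} E"
begin

definition dependence :: "nat set \<Rightarrow> nat" where
  "dependence S = nullity (induced_edges E S)"

lemma edgeE:
  assumes "e \<in> E"
  obtains u v where "e = {u, v}" "u < v" "v < n"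
proof -
  have e: "card e = 2" "e \<subseteq> {..<n}" using assms graph unfolding simple_graph_def by blast+
  obtain u v where uv: "e = {u, v}" "u \<noteq> v" using e(1) by (meson card_2_iff)
  have lt: "u < n" "v < n" using e(2) uv(1) by auto
  from uv(2) consider "u < v" | "v < u" by linarith
  then show ?thesis
  proof cases
    case 1
    then show ?thesis using that[of u v] uv lt by simp
  next
    case 2
    then show ?thesis using that[of v u] uv lt by (simp add: insert_commute)
  qed
qed

lemma finite_induced: "finite (induced_edges E S)"
  using finite_E by (simp add: induced_edges_def)

text \<open>An edge between S - T and T - S is induced by the union only, so induced edge sets unite
  only up to inclusion; monotonicity of the nullity closes the gap.\<close>

lemma deletion_dependence: "deletion {..<n} dependence"
proof
  fix S T
  have "induced_edges E S \<inter> induced_edges E T = induced_edges E (S \<inter> T)"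
    by (auto simp: induced_edges_def)
  moreover have "induced_edges E S \<union> induced_edges E T \<subseteq> induced_edges E (S \<union> T)"
    by (auto simp: induced_edges_def)
  then have "nullity (induced_edges E S \<union> induced_edges E T) \<le> nullity (induced_edges E (S \<union> T))"
    by (rule nullity_mono) (rule finite_induced)
  ultimately show "dependence S + dependence T \<le> dependence (S \<inter> T) + dependence (S \<union> T)"
    using nullity_supermodular[OF finite_induced finite_induced, of S T] by (simp add: dependence_def)
next
  have "induced_edges E {} = {}" by (auto simp: induced_edges_def elim: edgeE)
  then show "dependence {} = 0" by (simp add: dependence_def nullity_def)
qed simp

lemma card_edges_le: "card E \<le> n\<^sup>2"
proof -
  have "E \<subseteq> (\<lambda>(u, v). {u, v}) ` ({..<n} \<times> {..<n})" by (force elim!: edgeE)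
  then have "card E \<le> card ((\<lambda>(u, v). {u, v}) ` ({..<n} \<times> {..<n}))" by (intro card_mono) auto
  also have "\<dots> \<le> card ({..<n} \<times> {..<n})" by (rule card_image_le) simp
  finally show ?thesis by (simp add: power2_eq_square)
qed

lemma dependence_le: "dependence S \<le> n\<^sup>2"
proof -
  have "dependence S \<le> card (induced_edges E S)" by (simp add: dependence_def nullity_def)
  also have "\<dots> \<le> card E" using finite_E by (intro card_mono) (auto simp: induced_edges_def)
  finally show ?thesis using card_edges_le by simp
qed

text \<open>Every edge lost with u has the form {u, v}, so at most n edges are lost and the nullity
  falls by no more. This turns the factor into 1 + ln n.\<close>

lemma dependence_drop: "int (dependence {..<n}) - int (dependence ({..<n} - {u})) \<le> int n"
proof -
  let ?X = "induced_edges E ({..<n} - {u})" and ?Y = "induced_edges E {..<n}"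
  have "?Y - ?X \<subseteq> (\<lambda>v. {u, v}) ` {..<n}"
  proof
    fix e assume e: "e \<in> ?Y - ?X"
    then have "e \<in> E" by (simp add: induced_edges_def)
    then obtain v w where "e = {v, w}" "v < w" "w < n" by (rule edgeE)
    then show "e \<in> (\<lambda>v. {u, v}) ` {..<n}" using e by (auto simp: induced_edges_def insert_commute)
  qed
  then have "card (?Y - ?X) \<le> card ((\<lambda>v. {u, v}) ` {..<n})" by (intro card_mono) auto
  also have "\<dots> \<le> n" using card_image_le[of "{..<n}"] by simp
  finally have "card (?Y - ?X) \<le> n" .
  moreover have "nullity ?Y \<le> nullity ?X + card (?Y - ?X)"
    by (rule nullity_le_add) (auto simp: induced_edges_def finite_E)
  ultimately show ?thesis by (simp add: dependence_def)
qed

end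

section \<open>Nullity by independence queries\<close>

abbreviation edge_index :: iexp where
  "edge_index \<equiv> IAdd (IMul (cell ''a'') (cell ''n'')) (cell ''b'')"

text \<open>The matrix \<open>e\<close> holds an independent set J of edges. The current edge is
  inserted, tested by a query and withdrawn if J becomes dependent; \<open>val\<close> counts the
  withdrawals. The test b > a meets each edge once, above the diagonal.\<close>

definition count_edge :: com where
  "count_edge = If (And (Not (ILe (cell ''b'') (cell ''a'')))
       (And (Not (IEq (ICell ''adj'' edge_index) (IConst 0)))
       (And (Not (IEq (entry ''p'' ''a'') (IConst 0))) (Not (IEq (entry ''p'' ''b'') (IConst 0))))))
     (Seq (IAssign ''e'' edge_index (IConst 1)) (Seq (Query ''ok'' (IConst 0) ''e'')
       (If (IEq (cell ''ok'') (IConst 0))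
         (Seq (IAssign ''e'' edge_index (IConst 0)) (assign ''val'' (IAdd (cell ''val'') (IConst 1))))
         Skip)))
     Skip"

lemma writes_count_edge: "writes count_edge = {''e'', ''ok'', ''val''}"
  by (auto simp: count_edge_def)

definition count_dependent :: com where
  "count_dependent =
     Seq (For ''a'' (cell ''n'') (For ''b'' (cell ''n'') (IAssign ''e'' edge_index (IConst 0))))
    (Seq (assign ''val'' (IConst 0))
       (For ''a'' (cell ''n'') (For ''b'' (cell ''n'') count_edge)))"

lemma edge_index_inj:
  assumes "u * n + v = u' * n + v'" "v < n" "v' < (n :: nat)"
  shows "u = u' \<and> v = v'"
proof -
  have "(x * n + y) div n = x" "(x * n + y) mod n = y" if "y < n" for x y
    using that by simp_all
  then show ?thesis using assms by metis
qed

lemma decode_edgesE: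
  assumes "e \<in> decode_edges n a"
  obtains u v where "e = {u, v}" "u < v" "v < n"
  using assms unfolding decode_edges_def by blast

lemma doubleton_less_eq_iff: "u < v \<Longrightarrow> x < y \<Longrightarrow> {x, y} = {u, v} \<longleftrightarrow> x = u \<and> y = v" for u v :: nat
  by (auto simp: doubleton_eq_iff)

lemma decode_edges_iff:
  assumes "u < v" "v < n"
  shows "{u, v} \<in> decode_edges n a \<longleftrightarrow> a (int (u * n + v)) \<noteq> 0"
proof
  assume "{u, v} \<in> decode_edges n a"
  then obtain x y where xy: "{x, y} = {u, v}" "x < y" "a (int (x * n + y)) \<noteq> 0"
    unfolding decode_edges_def by auto
  then show "a (int (u * n + v)) \<noteq> 0" using doubleton_less_eq_iff[OF assms(1) xy(2)] by simp
next
  assume "a (int (u * n + v)) \<noteq> 0"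
  then show "{u, v} \<in> decode_edges n a" unfolding decode_edges_def using assms by blast
qed

lemma decode_edges_upd:
  assumes "u < v" "v < n"
  shows "decode_edges n (a(int (u * n + v) := z)) =
    (if z = 0 then decode_edges n a - {{u, v}} else insert {u, v} (decode_edges n a))" (is "?l = ?r")
proof -
  have iff: "{x, y} \<in> ?l \<longleftrightarrow> {x, y} \<in> ?r" if "x < y" "y < n" for x y
  proof -
    have "int (x * n + y) = int (u * n + v) \<longleftrightarrow> {x, y} = {u, v}"
      unfolding of_nat_eq_iff doubleton_less_eq_iff[OF assms(1) that(1)]
      using edge_index_inj[of x n y u v] that assms by blast
    then show ?thesis unfolding decode_edges_iff[OF that] by (auto simp: decode_edges_iff[OF that])
  qed
  show ?thesis
  proof (intro set_eqI iffI)
    fix e assume e: "e \<in> ?l"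
    from e obtain x y where "e = {x, y}" "x < y" "y < n" by (rule decode_edgesE)
    then show "e \<in> ?r" using e iff by simp
  next
    fix e assume e: "e \<in> ?r"
    then have "e = {u, v} \<or> e \<in> decode_edges n a" by (auto split: if_splits)
    then obtain x y where "e = {x, y}" "x < y" "y < n" using assms by (metis decode_edgesE)
    then show "e \<in> ?l" using e iff by simp
  qed
qed

lemma graph_input_adj:
  assumes "u < n" "v < n"
  shows "graph_input n E ''adj'' (int (u * n + v)) \<noteq> 0 \<longleftrightarrow> {u, v} \<in> E"
proof -
  have "(\<exists>x<n. \<exists>y<n. int (u * n + v) = int (x * n + y) \<and> {x, y} \<in> E) \<longleftrightarrow> {u, v} \<in> E"
  proof
    assume "\<exists>x<n. \<exists>y<n. int (u * n + v) = int (x * n + y) \<and> {x, y} \<in> E"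
    then obtain x y where xy: "y < n" "u * n + v = x * n + y" "{x, y} \<in> E"
      unfolding of_nat_eq_iff by metis
    then show "{u, v} \<in> E" using edge_index_inj[OF xy(2) assms(2) xy(1)] by simp
  qed (use assms in metis)
  then show ?thesis by (simp add: graph_input_def)
qed

text \<open>The oracle is specified on nonempty queries, which covers every query made, as each
  contains the edge just inserted.\<close>

locale graph_program = graph_matroid E \<I> n + machine q m A for E \<I> n q m A +
  assumes box: "decode_edges n a \<noteq> {} \<Longrightarrow> q a \<noteq> 0 \<longleftrightarrow> decode_edges n a \<in> \<I>"
    and box_le: "\<bar>q a\<bar> \<le> 1"
    and nm: "n \<le> m" and nA: "int (n\<^sup>2) + int n + 2 \<le> A"
begin

definition scanned :: "nat set \<Rightarrow> nat \<Rightarrow> nat \<Rightarrow> nat set set" where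
  "scanned S i k = {{u, v} |u v. u < v \<and> v < n \<and> u \<in> S \<and> v \<in> S \<and> {u, v} \<in> E \<and> (u < i \<or> u = i \<and> v < k)}"

lemma scanned_next: "scanned S i n = scanned S (Suc i) 0"
  unfolding scanned_def by (auto simp: less_Suc_eq)

lemma scanned_0: "scanned S 0 0 = {}"
  by (simp add: scanned_def)

lemma scanned_end: "scanned S n 0 = induced_edges E S"
proof
  show "scanned S n 0 \<subseteq> induced_edges E S" by (auto simp: scanned_def induced_edges_def)
  show "induced_edges E S \<subseteq> scanned S n 0"
  proof
    fix e assume "e \<in> induced_edges E S"
    then have e: "e \<in> E" "e \<subseteq> S" by (auto simp: induced_edges_def)
    from e(1) obtain u v where "e = {u, v}" "u < v" "v < n" by (rule edgeE)
    then show "e \<in> scanned S n 0" using e by (auto simp: scanned_def)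
  qed
qed

lemma scanned_Suc:
  assumes "k < n"
  shows "scanned S i (Suc k) =
    (if i < k \<and> i \<in> S \<and> k \<in> S \<and> {i, k} \<in> E then insert {i, k} (scanned S i k) else scanned S i k)"
  using assms unfolding scanned_def by (auto simp: less_Suc_eq)

lemma scanned_notin: "i < k \<Longrightarrow> {i, k} \<notin> scanned S i k"
  by (auto simp: scanned_def doubleton_eq_iff)

lemma scanned_subset: "scanned S i k \<subseteq> E"
  by (auto simp: scanned_def)

text \<open>J is a basis of the scanned edges, by maximality, so \<open>val\<close> is their
  nullity.\<close>

definition count_inv :: "nat set \<Rightarrow> nat \<Rightarrow> nat \<Rightarrow> state \<Rightarrow> bool" where
  "count_inv S i k s \<longleftrightarrow> (let J = decode_edges n (imem s ''e'') in
     J \<subseteq> scanned S i k \<and> J \<in> \<I> \<and> (\<forall>x\<in>scanned S i k - J. insert x J \<notin> \<I>) \<and>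
     imem s ''val'' 0 + int (card J) = int (card (scanned S i k)))"

lemma count_inv_istore:
  assumes "y \<noteq> ''e''" "y \<noteq> ''val''"
  shows "count_inv S i k (istore y a z s) = count_inv S i k s"
proof -
  have "imem (istore y a z s) ''e'' = imem s ''e''" "imem (istore y a z s) ''val'' = imem s ''val''"
    using assms by (auto simp: imem_istore)
  then show ?thesis by (simp only: count_inv_def)
qed

lemma count_inv_next: "count_inv S i n s = count_inv S (Suc i) 0 s"
  by (simp only: count_inv_def scanned_next)

lemma count_inv_val: "count_inv S i k s \<Longrightarrow> imem s ''val'' 0 \<le> int (n\<^sup>2)"
proof -
  assume "count_inv S i k s"
  then have "imem s ''val'' 0 \<le> int (card (scanned S i k))"
    unfolding count_inv_def Let_def by linarith
  moreover have "card (scanned S i k) \<le> n\<^sup>2"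
    using card_mono[OF finite_E scanned_subset] card_edges_le by (rule order_trans)
  ultimately show ?thesis by linarith
qed

lemma wp_count_edge:
  assumes s: "imem s ''n'' 0 = int n" "imem s ''a'' 0 = int i" "imem s ''b'' 0 = int k"
      "imem s ''adj'' = graph_input n E ''adj''"
    and ik: "i < n" "k < n" and S: "decode_set n (imem s ''p'') = S" and inv: "count_inv S i k s"
  shows "wp count_edge (count_inv S i (Suc k)) s"
proof -
  let ?J = "decode_edges n (imem s ''e'')" and ?z = "int (i * n + k)"
  have J: "?J \<subseteq> scanned S i k" "?J \<in> \<I>" "\<And>x. x \<in> scanned S i k \<Longrightarrow> x \<notin> ?J \<Longrightarrow> insert x ?J \<notin> \<I>"
    "imem s ''val'' 0 + int (card ?J) = int (card (scanned S i k))"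
    using inv by (auto simp: count_inv_def Let_def)
  have idx: "ival edge_index s' = ?z" if "imem s' ''n'' 0 = int n" "imem s' ''a'' 0 = int i" "imem s' ''b'' 0 = int k" for s'
    using that by simp
  have adj: "imem s ''adj'' ?z \<noteq> 0 \<longleftrightarrow> {i, k} \<in> E"
    using graph_input_adj[OF ik] s by simp
  have p: "imem s ''p'' (int i) \<noteq> 0 \<longleftrightarrow> i \<in> S" "imem s ''p'' (int k) \<noteq> 0 \<longleftrightarrow> k \<in> S"
    using S ik by (auto simp: decode_set_def)
  let ?c = "i < k \<and> i \<in> S \<and> k \<in> S \<and> {i, k} \<in> E"
  have A1: "1 \<le> A" using nA by linarith
  show ?thesis
  proof (cases ?c)
    case False
    then show ?thesis unfolding count_edge_def
      using adj p idx[OF s(1-3)] s inv ik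
      by (intro wp_If wp_Skip) (auto simp: count_inv_def scanned_Suc)
  next
    case True
    let ?x = "{i, k}"
    have sc: "scanned S i (Suc k) = insert ?x (scanned S i k)" using True ik by (simp add: scanned_Suc)
    have xn: "?x \<notin> scanned S i k" using True by (intro scanned_notin) simp
    then have xJ: "?x \<notin> ?J" using J(1) by auto
    have finJ: "finite ?J" by (rule finite_indep[OF J(2)])
    have finS: "finite (scanned S i k)" by (rule finite_subset[OF scanned_subset finite_E])
    define s1 where "s1 = istore ''e'' ?z 1 s"
    have d1: "decode_edges n (imem s1 ''e'') = insert ?x ?J"
      using True ik decode_edges_upd[of i k n "imem s ''e''" 1] by (simp add: s1_def imem_istore)
    let ?r = "q (imem s1 ''e'')"
    have r: "?r \<noteq> 0 \<longleftrightarrow> insert ?x ?J \<in> \<I>" using box[of "imem s1 ''e''"] by (simp add: d1)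
    have rA: "\<bar>?r\<bar> \<le> A" using box_le[of "imem s1 ''e''"] A1 by linarith
    let ?s2 = "istore ''ok'' 0 ?r s1"
    have s2: "imem ?s2 ''n'' 0 = int n" "imem ?s2 ''a'' 0 = int i" "imem ?s2 ''b'' 0 = int k"
      using s by (simp_all add: imem_istore s1_def)
    have rest: "wp (If (IEq (cell ''ok'') (IConst 0))
         (Seq (IAssign ''e'' edge_index (IConst 0)) (assign ''val'' (IAdd (cell ''val'') (IConst 1))))
         Skip) (count_inv S i (Suc k)) ?s2"
    proof (rule wp_If, goal_cases)
      case 1
      then have r0: "insert ?x ?J \<notin> \<I>" using r by (auto simp: imem_istore)
      let ?s3 = "istore ''e'' ?z 0 ?s2"
      have d3: "decode_edges n (imem ?s3 ''e'') = ?J"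
        using True ik xJ d1 decode_edges_upd[of i k n "imem s1 ''e''" 0] by (simp add: imem_istore)
      have v3: "imem ?s3 ''val'' 0 = imem s ''val'' 0" by (simp add: imem_istore s1_def)
      have vA: "\<bar>imem s ''val'' 0 + 1\<bar> \<le> A"
      proof -
        have "card ?J \<le> card (scanned S i k)" using J(1) finS by (rule card_mono[rotated])
        then have "0 \<le> imem s ''val'' 0" using J(4) by linarith
        then show ?thesis using count_inv_val[OF inv] nA by linarith
      qed
      have "count_inv S i (Suc k) (istore ''val'' 0 (imem s ''val'' 0 + 1) ?s3)"
      proof -
        have "imem (istore ''val'' 0 (imem s ''val'' 0 + 1) ?s3) ''e'' = imem ?s3 ''e''" by (simp add: imem_istore)
        then show ?thesis
          unfolding count_inv_def Let_def sc using d3 J r0 xn finS by (auto simp: imem_istore)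
      qed
      then have "wp (assign ''val'' (IAdd (cell ''val'') (IConst 1))) (count_inv S i (Suc k)) ?s3"
        using v3 vA by (intro wp_IAssign) auto
      then have "wp (assign ''val'' (IAdd (cell ''val'') (IConst 1))) (count_inv S i (Suc k))
          (istore ''e'' (ival edge_index ?s2) (ival (IConst 0) ?s2) ?s2)"
        unfolding idx[OF s2] by simp
      then show ?case using A1 by (intro wp_Seq wp_IAssign[where x = "''e''"]) auto
    next
      case 2
      then have r1: "insert ?x ?J \<in> \<I>" using r by (auto simp: imem_istore)
      have e2: "decode_edges n (imem ?s2 ''e'') = insert ?x ?J" using d1 by (simp add: imem_istore)
      have v2: "imem ?s2 ''val'' 0 = imem s ''val'' 0" by (simp add: imem_istore s1_def)
      \<comment> \<open>A rejected edge stays rejected as J grows, since subsets of independent sets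
        are independent.\<close>
      have "insert y (insert ?x ?J) \<notin> \<I>" if "y \<in> scanned S i k" "y \<notin> ?J" for y
        using J(3)[OF that] indep_mono[of "insert y (insert ?x ?J)" "insert y ?J"] by auto
      then have "count_inv S i (Suc k) ?s2"
        unfolding count_inv_def Let_def e2 v2 sc using J r1 xn xJ finJ finS by auto
      then show ?case by (rule wp_Skip)
    qed
    have "wp (Seq (Query ''ok'' (IConst 0) ''e'') (If (IEq (cell ''ok'') (IConst 0))
         (Seq (IAssign ''e'' edge_index (IConst 0)) (assign ''val'' (IAdd (cell ''val'') (IConst 1))))
         Skip)) (count_inv S i (Suc k)) s1"
      using rest rA by (intro wp_Seq wp_Query) simp_all
    then have "wp (Seq (Query ''ok'' (IConst 0) ''e'') (If (IEq (cell ''ok'') (IConst 0))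
         (Seq (IAssign ''e'' edge_index (IConst 0)) (assign ''val'' (IAdd (cell ''val'') (IConst 1))))
         Skip)) (count_inv S i (Suc k)) (istore ''e'' (ival edge_index s) (ival (IConst 1) s) s)"
      unfolding idx[OF s(1-3)] s1_def by simp
    then show ?thesis unfolding count_edge_def
      using A1 adj p idx[OF s(1-3)] s True
      by (intro wp_If wp_Seq[where ?c1.0 = "IAssign ''e'' edge_index (IConst 1)"] wp_IAssign) auto
  qed
qed

lemma wp_count_dependent:
  assumes s: "imem s ''n'' 0 = int n" "imem s ''adj'' = graph_input n E ''adj''"
  shows "wp count_dependent (\<lambda>s'. imem s' ''val'' 0 = int (dependence (decode_set n (imem s ''p'')))) s"
proof -
  let ?S = "decode_set n (imem s ''p'')"
  have nA': "int n \<le> A" "2 \<le> A" using nA by linarith+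
  have count: "wp (For ''a'' (cell ''n'') (For ''b'' (cell ''n'') count_edge)) (count_inv ?S n 0) s1"
    if fr: "frame {''a'', ''b'', ''e'', ''val''} s s1" and inv: "count_inv ?S 0 0 s1" for s1
  proof (rule wp_For[where k = n and I = "\<lambda>i. count_inv ?S i 0"], goal_cases)
    case (4 s')
    then show ?case using s fr by (simp add: frame_def writes_count_edge)
  next
    case (6 i s2)
    have fr2: "frame {''a'', ''b'', ''e'', ''val'', ''ok''} s s2"
      by (rule frame_trans[of _ s s1]; rule frame_mono, rule fr 6(3)) (auto simp: writes_count_edge)
    show ?case
    proof (rule wp_For[where k = n and I = "count_inv ?S i"], goal_cases)
      case (4 s')
      then show ?case using s fr2 by (simp add: frame_def writes_count_edge)
    next
      case (6 k s3)
      have fr3: "frame {''b'', ''e'', ''val'', ''ok''} s2 s3"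
        by (rule frame_mono[OF 6(3)]) (auto simp: writes_count_edge)
      have fr3': "frame {''a'', ''b'', ''e'', ''val'', ''ok''} s s3"
        by (rule frame_trans[OF fr2]) (rule frame_mono[OF fr3], auto)
      have "wp count_edge (count_inv ?S i (Suc k)) s3"
        using 6 \<open>i < n\<close> \<open>imem s2 ''a'' 0 = int i\<close> s frame_imem[OF fr3, of "''a''"] frame_imem[OF fr3']
        by (intro wp_count_edge) auto
      then show ?case by (simp add: count_inv_istore)
    next
      case (7 s')
      then show ?case by (simp add: count_inv_istore count_inv_next)
    qed (use nm nA' 6 in \<open>auto simp: writes_count_edge count_inv_istore\<close>)
  qed (use nm nA' inv in \<open>auto simp: writes_count_edge count_inv_istore\<close>)
  have clear: "wp (For ''a'' (cell ''n'') (For ''b'' (cell ''n'') (IAssign ''e'' edge_index (IConst 0))))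
     (\<lambda>s'. \<forall>u<n. \<forall>v<n. imem s' ''e'' (int (u * n + v)) = 0) s"
  proof (rule wp_For[where k = n and I = "\<lambda>i s'. \<forall>u<i. \<forall>v<n. imem s' ''e'' (int (u * n + v)) = 0"], goal_cases)
    case (4 s')
    then show ?case using s by (simp add: frame_def)
  next
    case (6 i s2)
    have n2: "imem s2 ''n'' 0 = int n" using 6(3) s by (simp add: frame_def)
    show ?case
    proof (rule wp_For[where k = n and I = "\<lambda>k s'. (\<forall>u<i. \<forall>v<n. imem s' ''e'' (int (u * n + v)) = 0) \<and>
        (\<forall>v<k. imem s' ''e'' (int (i * n + v)) = 0)"], goal_cases)
      case (4 s')
      then show ?case using n2 by (simp add: frame_def)
    next
      case (6 k s3)
      have z: "ival edge_index s3 = int (i * n + k)"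
        using 6 n2 \<open>imem s2 ''a'' 0 = int i\<close> by (simp add: frame_def)
      show ?case
        by (rule wp_IAssign, use nA' in simp, unfold z) (use 6 in \<open>auto simp: imem_istore less_Suc_eq\<close>)
    qed (use nm nA' 6 in \<open>auto simp: imem_istore less_Suc_eq\<close>)
  qed (use nm nA' in \<open>auto simp: imem_istore\<close>)
  show ?thesis unfolding count_dependent_def
  proof (rule wp_Seq, rule wp_conseq[OF clear])
    fix s1 :: state
    assume fr: "frame (writes (For ''a'' (cell ''n'') (For ''b'' (cell ''n'') (IAssign ''e'' edge_index (IConst 0))))) s s1"
      and z: "\<forall>u<n. \<forall>v<n. imem s1 ''e'' (int (u * n + v)) = 0"
    let ?s = "istore ''val'' 0 0 s1"
    have "frame {''a'', ''b'', ''e'', ''val''} s ?s" using fr by (auto simp: frame_def imem_istore)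
    moreover have "decode_edges n (imem s1 ''e'') = {}" using z by (fastforce simp: decode_edges_def)
    then have "count_inv ?S 0 0 ?s"
      by (simp add: count_inv_def scanned_0 imem_istore indep_empty)
    ultimately have "wp (For ''a'' (cell ''n'') (For ''b'' (cell ''n'') count_edge)) (count_inv ?S n 0) ?s"
      by (rule count)
    then have "wp (For ''a'' (cell ''n'') (For ''b'' (cell ''n'') count_edge))
      (\<lambda>s'. imem s' ''val'' 0 = int (dependence ?S)) ?s"
    proof (rule wp_conseq)
      fix s' assume "count_inv ?S n 0 s'"
      then have J: "decode_edges n (imem s' ''e'') \<subseteq> induced_edges E ?S" "decode_edges n (imem s' ''e'') \<in> \<I>"
          "\<forall>x\<in>induced_edges E ?S - decode_edges n (imem s' ''e''). insert x (decode_edges n (imem s' ''e'')) \<notin> \<I>"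
          "imem s' ''val'' 0 + int (card (decode_edges n (imem s' ''e''))) = int (card (induced_edges E ?S))"
        by (simp_all add: count_inv_def scanned_end Let_def)
      \<comment> \<open>All induced edges have been scanned, so J is maximal among them and its size
        is their rank, whatever the order of the scan.\<close>
      from J(3) have "card (decode_edges n (imem s' ''e'')) = rank (induced_edges E ?S)"
        by (intro maximal_card J(1,2)) auto
      then show "imem s' ''val'' 0 = int (dependence ?S)"
        using J(4) rank_le_card[OF finite_induced, of ?S] by (simp add: dependence_def nullity_def of_nat_diff)
    qed
    then show "wp (Seq (assign ''val'' (IConst 0)) (For ''a'' (cell ''n'') (For ''b'' (cell ''n'') count_edge)))
      (\<lambda>s'. imem s' ''val'' 0 = int (dependence ?S)) s1"
      using nA' by (intro wp_Seq[where ?c1.0 = "assign ''val'' (IConst 0)"] wp_IAssign) auto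
  qed
qed

end

text \<open>The nullity is at most n^2 and its drops at most n, which fixes \<open>F\<close> and
  \<open>k\<close>. The matroid is a parameter here and need not be part of the instance, as long as
  \<open>box\<close> answers for it.\<close>

lemma graph_problem_approximable:
  fixes P :: "'i problem" and E :: "'i \<Rightarrow> nat set set"
  assumes G: "\<And>i. i \<in> instances P \<Longrightarrow> graph_matroid (E i) (\<I> i) (num P i)"
    and input: "\<And>i. i \<in> instances P \<Longrightarrow> int_input P i = graph_input (num P i) (E i)"
    and box: "\<And>i a. i \<in> instances P \<Longrightarrow> decode_edges (num P i) a \<noteq> {} \<Longrightarrow>
        box P i a \<noteq> 0 \<longleftrightarrow> decode_edges (num P i) a \<in> \<I> i"
      "\<And>i a. i \<in> instances P \<Longrightarrow> \<bar>box P i a\<bar> \<le> 1"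
    and feasible: "\<And>i S. i \<in> instances P \<Longrightarrow> S \<subseteq> {..<num P i} \<Longrightarrow> feasible P i S \<longleftrightarrow>
        deletion.hits {..<num P i} (graph_matroid.dependence (E i) (\<I> i)) \<rho> S"
    and cost: "\<And>i u. i \<in> instances P \<Longrightarrow> u < num P i \<Longrightarrow> 0 \<le> elem_cost P i u"
    and size: "\<And>i. i \<in> instances P \<Longrightarrow> input_size P i = num P i"
  shows "poly_time_approximable P (\<lambda>i. if num P i = 0 then 1 else 1 + ln (real (num P i)))"
proof (rule poly_time_greedy[where f = "\<lambda>i. graph_matroid.dependence (E i) (\<I> i)" and F = "\<lambda>i. (num P i)\<^sup>2"
      and ev = count_dependent and \<rho> = \<rho> and r = "[:0, 0, 1:]"])
  fix i assume i: "i \<in> instances P"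
  interpret graph_matroid "E i" "\<I> i" "num P i" by (rule G[OF i])
  show "deletion {..<num P i} dependence" by (rule deletion_dependence)
  show "dependence T \<le> (num P i)\<^sup>2" for T by (rule dependence_le)
  show "machine.wp (box P i) m A count_dependent
      (\<lambda>s'. imem s' ''val'' 0 = int (dependence (decode_set (num P i) (imem s ''p'')))) s"
    if "num P i \<le> m" "int ((num P i)\<^sup>2) + int (num P i) + 2 \<le> A" "imem s ''n'' 0 = int (num P i)"
      "imem s ''adj'' = int_input P i ''adj''" for m A s
  proof -
    interpret graph_program "E i" "\<I> i" "num P i" "box P i" m A
      by unfold_locales (use box[OF i] that in auto)
    show ?thesis using that by (intro wp_count_dependent) (simp_all add: input[OF i])
  qed
  show "int (dependence {..<num P i}) - int (dependence ({..<num P i} - {u})) \<le> int (num P i)" for u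
    by (rule dependence_drop)
  \<comment> \<open>The zero summand makes the general bound applicable; it gives length at most
    n^2, which the polynomial r allows.\<close>
  have "floorlog 2 (0 + (num P i)\<^sup>2) \<le> floorlog 2 0 + (num P i)\<^sup>2" by (rule floorlog_add_le)
  then show "floorlog 2 ((num P i)\<^sup>2) \<le> poly [:0, 0, 1:] (input_size P i)"
    using floorlog_eq_zero_iff[of 2 0] by (simp add: size[OF i] power2_eq_square)
qed (auto simp: input feasible cost size graph_input_def count_dependent_def writes_count_edge reserved_def)

text \<open>From n = 3 on ln n is at least 1, so doubling absorbs the additive 1.\<close>

lemma one_plus_ln_bigo: "(\<lambda>n. if n = 0 then 1 else 1 + ln (real n)) \<in> O(\<lambda>n. ln (real n))"
proof (rule bigoI[where c = 2])
  have "1 \<le> ln (real n)" if "3 \<le> n" for n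
  proof -
    have "exp 1 \<le> real n" using exp_le that by linarith
    then show ?thesis using that by (simp add: ln_ge_iff)
  qed
  then show "\<forall>\<^sub>F n in sequentially. norm (if n = 0 then 1 else 1 + ln (real n)) \<le> 2 * norm (ln (real n))"
    by (intro eventually_sequentiallyI[of 3]) force
qed

text \<open>The nullity in the matroid whose only independent set is empty is the cardinality, and a black box
  that always answers 0 is an independence oracle for it on non-empty queries.\<close>

lemma GraphDD_approximable:
  "poly_time_approximable (GraphDD \<rho>) (\<lambda>i. if g_num i = 0 then 1 else 1 + ln (real (g_num i)))"
proof -
  let ?P = "GraphDD \<rho>"
  have G: "graph_matroid (g_edges i) {{}} (g_num i)" if "i \<in> instances ?P" for i
  proof
    have g: "simple_graph {..<g_num i} (g_edges i)" using that by (simp add: GraphDD_def)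
    then have "g_edges i \<subseteq> Pow {..<g_num i}" by (auto simp: simple_graph_def)
    then have "finite (g_edges i)" by (rule finite_subset) simp
    then show "matroid (g_edges i) {{}}" by (auto simp: matroid_def)
    show "simple_graph {..<g_num i} (g_edges i)" by (rule g)
  qed
  have "poly_time_approximable ?P (\<lambda>i. if num ?P i = 0 then 1 else 1 + ln (real (num ?P i)))"
  proof (rule graph_problem_approximable[where E = g_edges and \<I> = "\<lambda>_. {{}}" and \<rho> = \<rho>])
    fix i assume i: "i \<in> instances ?P"
    interpret graph_matroid "g_edges i" "{{}}" "g_num i" by (rule G[OF i])
    interpret deletion "{..<g_num i}" dependence \<rho> by (rule deletion_dependence)
    have "rank X = 0" for X
    proof -
      have "{J \<in> {{}}. J \<subseteq> X} = {{}}" by auto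
      then show ?thesis by (simp add: rank_def)
    qed
    \<comment> \<open>Feasibility speaks of the graph G - S, so edges are induced twice; for T
      inside V - S the inner restriction changes nothing.\<close>
    then have "dependence T = card (induced_edges (induced_edges (g_edges i) ({..<g_num i} - S)) T)"
      if "T \<subseteq> {..<g_num i} - S" for S T
      using that by (auto simp: dependence_def nullity_def induced_edges_def intro!: arg_cong[of _ _ card])
    then show "feasible ?P i S \<longleftrightarrow> deletion.hits {..<num ?P i} (graph_matroid.dependence (g_edges i) {{}}) \<rho> S" for S
      using density_iff_hits[of S "\<lambda>T. real (card (induced_edges (induced_edges (g_edges i) ({..<g_num i} - S)) T))"]
      by (simp add: GraphDD_def graph_density_at_most_def)
  qed (use G in \<open>auto simp: GraphDD_def\<close>)
  moreover have "num ?P = g_num" by (simp add: GraphDD_def)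
  ultimately show ?thesis by (simp only:)
qed

lemma MatroidFVS_approximable:
  "poly_time_approximable MatroidFVS (\<lambda>i. if g_num i = 0 then 1 else 1 + ln (real (g_num i)))"
proof -
  let ?P = MatroidFVS
  have G: "graph_matroid (g_edges i) (m_indep i) (g_num i)" if "i \<in> instances ?P" for i
    by unfold_locales (use that in \<open>auto simp: MatroidFVS_def\<close>)
  have "poly_time_approximable ?P (\<lambda>i. if num ?P i = 0 then 1 else 1 + ln (real (num ?P i)))"
  proof (rule graph_problem_approximable[where E = g_edges and \<I> = m_indep and \<rho> = 0])
    fix i S assume i: "i \<in> instances ?P"
    interpret graph_matroid "g_edges i" "m_indep i" "g_num i" by (rule G[OF i])
    interpret deletion "{..<g_num i}" dependence 0 by (rule deletion_dependence)
    \<comment> \<open>For \<rho> = 0 every subset of V - S must have nullity 0, and by monotonicity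
      the largest one decides.\<close>
    have "hits S \<longleftrightarrow> dependence ({..<g_num i} - S) = 0"
      unfolding hits_def using f_mono[of _ "{..<g_num i} - S"] by fastforce
    also have "\<dots> \<longleftrightarrow> induced_edges (g_edges i) ({..<g_num i} - S) \<in> m_indep i"
      unfolding dependence_def by (rule nullity_eq_0_iff) (auto simp: induced_edges_def)
    finally show "feasible ?P i S \<longleftrightarrow> deletion.hits {..<num ?P i} (graph_matroid.dependence (g_edges i) (m_indep i)) 0 S"
      by (simp add: MatroidFVS_def)
  qed (use G in \<open>auto simp: MatroidFVS_def\<close>)
  moreover have "num ?P = g_num" by (simp add: MatroidFVS_def)
  ultimately show ?thesis by (simp only:)
qed

theorem corollary1p1:
  shows "(\<forall>\<rho>::nat. poly_time_approximable (SupmodDD \<rho>) supmod_factor) \<and>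
         (\<forall>\<rho>::nat. \<exists>\<alpha> :: nat \<Rightarrow> real. \<alpha> \<in> O(\<lambda>n. ln (real n)) \<and>
            poly_time_approximable (GraphDD \<rho>) (\<lambda>i. \<alpha> (g_num i))) \<and>
         (\<exists>\<alpha> :: nat \<Rightarrow> real. \<alpha> \<in> O(\<lambda>n. ln (real n)) \<and>
            poly_time_approximable MatroidFVS (\<lambda>i. \<alpha> (g_num i)))"
  using SupmodDD_approximable GraphDD_approximable MatroidFVS_approximable one_plus_ln_bigo by blast

end
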